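(* Let $A$ be an arbitrary abelian group. Restricting the evaluation of $\varphi\in\mathbf{H}(\mathcal{BT},A)$ to arrows of $\mathcal{T}_{v_{0}}$ (respectively, to arrows of type 1 of $\mathcal{BT}$) yields canonical isomorphisms $$\mathbf{H}(\mathcal{BT},A)\xrightarrow{\;\cong\;}\mathbf{H}(\mathcal{T}_{v_{0}},A),\qquad\text{respectively}\qquad \mathbf{H}(\mathcal{BT},A)\xrightarrow{\;\cong\;}\mathbf{D}^{0}(\mathbb{P}(V),A),\quad \varphi\mapsto\tilde{\varphi},$$ where the distribution $\tilde{\varphi}$ satisfies $\tilde{\varphi}(\mathbb{P}(V)(e))=\varphi(e)$ for each arrow $e$ of type 1 of $\mathcal{BT}$. The second isomorphism is equivariant for the natural actions of $G(K)=\mathrm{GL}(r,K)$ on both sides, while the first is equivariant for the actions of the stabilizer $G(O)Z(K)$ of $v_{0}$ in $G(K)$.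
   Context: Setting. $K$ is a non-archimedean local field with ring of integers $O$, uniformizer $\pi$, finite residue field $\mathbb{F}=O/(\pi)$. Let $r\ge 2$, $V=K^{r}$ (row vectors), $L_{0}=O^{r}$, $G(K)=\mathrm{GL}(r,K)$, $G(O)=\mathrm{GL}(r,O)$, $Z(K)\cong K^{*}$ the center of $G(K)$. Building. $\mathcal{BT}$ is the Bruhat-Tits building of $\mathrm{PGL}(r,K)$: vertices are the similarity classes $[L]$ of $O$-lattices $L\subset V$ (free $O$-submodules of rank $r$; $L\sim cL$ for $c\in K^{*}$); classes form an $s$-simplex iff they have representatives $M_{0}\supsetneq M_{1}\supsetneq\dots\supsetneq M_{s}\supsetneq \pi M_{0}$. $v_{0}=[L_{0}]$; $d(v,v')$ is the length of a shortest path from $v$ to $v'$ in the 1-skeleton. An arrow $e=(v,v')$ is an oriented 1-simplex, with origin $o(e)=v$, terminus $t(e)=v'$ and inverse $\bar{e}=(v',v)$; if $v=[L]$, $v'=[L']$ with $L\supsetneq L'\supsetneq\pi L$, then $\mathrm{type}(e)=\dim_{\mathbb{F}}(L'/\pi L)$, and $e$ corresponds to the subspace $\bar{M}_{e}=L'/\pi L$ of $L/\pi L$. $\mathbf{A}(\mathcal{S})$ is the set of arrows of a complex $\mathcal{S}$; $\mathbf{A}_{v}$ is the set of arrows of $\mathcal{BT}$ with origin $v$, $\mathbf{A}_{v,t}$ those of type $t$ among them. For $e,e'$ with the same origin, $e'\prec e$ means $\bar{M}_{e'}\subset\bar{M}_{e}$. Harmonic cochains. $\mathbf{H}(\mathcal{BT},A)$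 is the group of maps $\varphi\colon\mathbf{A}(\mathcal{BT})\to A$ such that: (A) $\sum\varphi(e)=0$ when $e$ ranges through the arrows of a closed path in $\mathcal{BT}$; (B) $\sum_{e\in\mathbf{A}_{v,t}}\varphi(e)=0$ for each vertex $v$ and each $1\le t\le r-1$; (C) $\varphi(e)=\sum_{e'\in\mathbf{A}_{v,1},\,e'\prec e}\varphi(e')$ for each vertex $v$ and $e\in\mathbf{A}_{v}$. The tree $\mathcal{T}_{v_{0}}$. A vertex $v$ is $n$-special ($n\ge 0$) if there is a path $(v_{0},v_{1},\dots,v_{n}=v)$ in $\mathcal{BT}$ all of whose arrows $(v_{i-1},v_{i})$ have type 1, and $d(v_{0},v)=n$ ($v_{0}$ is $0$-special). $\mathcal{T}_{v_{0}}$ is the full subcomplex of $\mathcal{BT}$ on all $n$-special vertices, $n\ge 0$, along with the 1-simplices connecting them; it is a tree. $\mathbf{H}(\mathcal{T}_{v_{0}},A)$ is the group of maps $\varphi\colon\mathbf{A}(\mathcal{T}_{v_{0}})\to A$ with $\varphi(e)+\varphi(\bar{e})=0$ for all $e$ and $\sum_{e\in\mathbf{A}(\mathcal{T}_{v_{0}}),\,o(e)=v}\varphi(e)=0$ for all vertices $v$ of $\mathcal{T}_{v_{0}}$. Distributions. $\mathbb{P}(V)$ is the compact, totally disconnected space of lines (1-dimensional $K$-subspaces) of $V$. An $A$-valued distribution on $\mathbb{P}(V)$ is a map $\delta$ from the compact-open subsets of $\mathbb{P}(V)$ to $A$ that is additive on finite disjoint unions; its total mass is $\delta(\mathbb{P}(V))$.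 $\mathbf{D}^{0}(\mathbb{P}(V),A)$ is the group of those with total mass $0$. An arrow $e=(v,v')$ of type 1 with $v=[L]$ points to the line $G\subset V$ if $v'=[(L\cap G)+\pi L]$; $\mathbb{P}(V)(e)$ is the compact-open set of lines $G$ to which $e$ points. Actions. $G(K)$ acts from the right on $V$, hence on lattices, on $\mathcal{BT}$ and on $\mathbb{P}(V)$; it acts on functions $\varphi$ on arrows by $(\gamma\varphi)(e)=\varphi(e\gamma)$ and on distributions by $(\gamma\delta)(U)=\delta(U\gamma)$. *)

theory Defs
  imports "HOL-Analysis.Analysis" "HOL-Algebra.Group" "HOL-Library.Disjoint_Sets"
begin

section \<open>Non-archimedean local fields\<close>

text \<open>
  A local field is a field that is complete under a normalised discrete valuation and has
  finite residue field (of any characteristic).  The value \<open>vord 0\<close> is unspecified, so that every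
  use of \<open>vord x\<close> is guarded by \<open>x \<noteq> 0\<close>; \<open>unif\<close> is an arbitrary uniformizer.
\<close>

class nonarch_local_field = field +
  fixes vord :: "'a \<Rightarrow> int"
    and unif :: 'a
  assumes vord_mult: "x \<noteq> 0 \<Longrightarrow> y \<noteq> 0 \<Longrightarrow> vord (x * y) = vord x + vord y"
    and vord_add: "x \<noteq> 0 \<Longrightarrow> y \<noteq> 0 \<Longrightarrow> x + y \<noteq> 0 \<Longrightarrow> min (vord x) (vord y) \<le> vord (x + y)"
    and unif_nonzero: "unif \<noteq> 0"
    and vord_unif: "vord unif = 1"
    and vord_complete:
      "(\<And>N. \<exists>M. \<forall>m\<ge>M. \<forall>n\<ge>M. X m = X n \<or> N \<le> vord (X m - X n)) \<Longrightarrow>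
        \<exists>l. \<forall>N. \<exists>M. \<forall>m\<ge>M. X (m::nat) = l \<or> N \<le> vord (X m - l)"
    and finite_residue_field:
      "finite ({x. x = 0 \<or> 0 \<le> vord x} //
        {(x, y). (x = 0 \<or> 0 \<le> vord x) \<and> (y = 0 \<or> 0 \<le> vord y) \<and> (x = y \<or> 1 \<le> vord (x - y))})"

definition integers :: "'k::nonarch_local_field set" where
  "integers = {x. x = 0 \<or> 0 \<le> vord x}"

definition vball :: "'k::nonarch_local_field \<Rightarrow> int \<Rightarrow> 'k set" where
  "vball x N = {y. y = x \<or> N \<le> vord (y - x)}"


section \<open>Lattices in $K^r$\<close>

text \<open>The space of row vectors is \<open>'k ^ 'n\<close>, with \<open>r = CARD('n)\<close>.\<close>

definition std_lattice :: "('k::nonarch_local_field ^ 'n) set" where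
  "std_lattice = {x. \<forall>i. x $ i \<in> integers}"

definition lattices :: "('k::nonarch_local_field ^ 'n::finite) set set" where
  "lattices = {L. \<exists>b :: 'n \<Rightarrow> 'k ^ 'n.
      L = {\<Sum>i\<in>UNIV. c i *s b i | c. \<forall>i. c i \<in> integers} \<and>
      (\<forall>c. (\<forall>i. c i \<in> integers) \<and> (\<Sum>i\<in>UNIV. c i *s b i) = 0 \<longrightarrow> (\<forall>i. c i = 0))}"

definition lscale :: "'k::nonarch_local_field \<Rightarrow> ('k ^ 'n) set \<Rightarrow> ('k ^ 'n) set" where
  "lscale c L = (\<lambda>x. c *s x) ` L"

definition sim_class :: "('k::nonarch_local_field ^ 'n::finite) set \<Rightarrow> ('k ^ 'n) set set" where
  "sim_class L = {lscale c L | c. c \<noteq> 0}"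

text \<open>
  \<open>coset_space L M\<close> is the set of cosets \<open>M / \<pi>L\<close>, for \<open>\<pi>L \<subseteq> M \<subseteq> L\<close> a subset of \<open>L / \<pi>L\<close>.
\<close>

definition coset_space ::
    "('k::nonarch_local_field ^ 'n) set \<Rightarrow> ('k ^ 'n) set \<Rightarrow> ('k ^ 'n) set set" where
  "coset_space L M = (\<lambda>x. {x + y | y. y \<in> lscale unif L}) ` M"

text \<open>
  \<open>has_residue_dim L M t\<close>: the vector space \<open>M / \<pi>L\<close> over the residue field \<open>O / \<pi>O\<close> has a basis
  of \<open>t\<close> elements.  Both the basis vectors (\<open>x i\<close>) and the scalars (\<open>c i\<close>) are given by
  representatives; a scalar is zero in the residue field iff it lies in \<open>\<pi>O\<close>, and a vector is zero
  in \<open>M / \<pi>L\<close> iff it lies in \<open>\<pi>L\<close>.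
\<close>

definition has_residue_dim ::
    "('k::nonarch_local_field ^ 'n) set \<Rightarrow> ('k ^ 'n) set \<Rightarrow> nat \<Rightarrow> bool" where
  "has_residue_dim L M t \<longleftrightarrow> (\<exists>x :: nat \<Rightarrow> 'k ^ 'n.
      (\<forall>i<t. x i \<in> M) \<and>
      (\<forall>y\<in>M. \<exists>c. (\<forall>i<t. c i \<in> integers) \<and> y - (\<Sum>i<t. c i *s x i) \<in> lscale unif L) \<and>
      (\<forall>c. (\<forall>i<t. c i \<in> integers) \<and> (\<Sum>i<t. c i *s x i) \<in> lscale unif L \<longrightarrow>
         (\<forall>i<t. c i \<in> (\<lambda>a. unif * a) ` integers)))"


section \<open>The Bruhat-Tits building\<close>

type_synonym ('k, 'n) vertex = "('k ^ 'n) set set"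
type_synonym ('k, 'n) arrow = "('k, 'n) vertex \<times> ('k, 'n) vertex"

definition vertices :: "('k::nonarch_local_field, 'n::finite) vertex set" where
  "vertices = sim_class ` lattices"

definition simplices ::
    "nat \<Rightarrow> ('k::nonarch_local_field, 'n::finite) vertex set set" where
  "simplices s = {(\<lambda>i. sim_class (M i)) ` {..s} | M.
      (\<forall>i\<le>s. M i \<in> lattices) \<and> (\<forall>i<s. M (Suc i) \<subset> M i) \<and> lscale unif (M 0) \<subset> M s}"

definition arrows :: "('k::nonarch_local_field, 'n::finite) arrow set" where
  "arrows = {(v, w). {v, w} \<in> simplices 1}"

definition base_vertex :: "('k::nonarch_local_field, 'n::finite) vertex" where
  "base_vertex = sim_class std_lattice"

text \<open>
  \<open>arrow_rep e L M\<close>: the arrow \<open>e\<close> is represented by the pair of lattices \<open>L \<supset> M \<supset> \<pi>L\<close>.  The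
  lattice \<open>M\<close> is determined by \<open>e\<close> and \<open>L\<close>, and the associated subspace of \<open>L / \<pi>L\<close> is
  \<open>coset_space L M\<close>.
\<close>

definition arrow_rep ::
    "('k::nonarch_local_field, 'n::finite) arrow \<Rightarrow> ('k ^ 'n) set \<Rightarrow> ('k ^ 'n) set \<Rightarrow> bool" where
  "arrow_rep e L M \<longleftrightarrow> L \<in> lattices \<and> M \<in> lattices \<and> fst e = sim_class L \<and> snd e = sim_class M \<and>
     M \<subset> L \<and> lscale unif L \<subset> M"

definition arrow_type :: "('k::nonarch_local_field, 'n::finite) arrow \<Rightarrow> nat" where
  "arrow_type e = (THE t. \<exists>L M. arrow_rep e L M \<and> has_residue_dim L M t)"

definition arrows_from ::
    "('k::nonarch_local_field, 'n::finite) vertex \<Rightarrow> ('k, 'n) arrow set" where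
  "arrows_from v = {e \<in> arrows. fst e = v}"

definition arrows_from_type ::
    "('k::nonarch_local_field, 'n::finite) vertex \<Rightarrow> nat \<Rightarrow> ('k, 'n) arrow set" where
  "arrows_from_type v t = {e \<in> arrows_from v. arrow_type e = t}"

definition type1_arrows :: "('k::nonarch_local_field, 'n::finite) arrow set" where
  "type1_arrows = {e \<in> arrows. arrow_type e = 1}"

definition arrow_prec ::
    "('k::nonarch_local_field, 'n::finite) arrow \<Rightarrow> ('k, 'n) arrow \<Rightarrow> bool" where
  "arrow_prec e' e \<longleftrightarrow>
     (\<exists>L M' M. arrow_rep e' L M' \<and> arrow_rep e L M \<and> coset_space L M' \<subseteq> coset_space L M)"

text \<open>
  A path is given by its nonempty list of vertices; its arrows are the pairs of consecutive ones.
\<close>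

definition path_arrows :: "'v list \<Rightarrow> ('v \<times> 'v) list" where
  "path_arrows p = zip p (tl p)"

definition is_bt_path :: "('k::nonarch_local_field, 'n::finite) vertex list \<Rightarrow> bool" where
  "is_bt_path p \<longleftrightarrow> p \<noteq> [] \<and> set p \<subseteq> vertices \<and> set (path_arrows p) \<subseteq> arrows"

definition bt_dist ::
    "('k::nonarch_local_field, 'n::finite) vertex \<Rightarrow> ('k, 'n) vertex \<Rightarrow> nat" where
  "bt_dist v w =
     (LEAST n. \<exists>p. is_bt_path p \<and> hd p = v \<and> last p = w \<and> length (path_arrows p) = n)"

definition special :: "nat \<Rightarrow> ('k::nonarch_local_field, 'n::finite) vertex \<Rightarrow> bool" where
  "special n v \<longleftrightarrow>
     (\<exists>p. is_bt_path p \<and> hd p = base_vertex \<and> last p = v \<and> length (path_arrows p) = n \<and>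
          (\<forall>e\<in>set (path_arrows p). arrow_type e = 1)) \<and>
     bt_dist base_vertex v = n"

definition tree_vertices :: "('k::nonarch_local_field, 'n::finite) vertex set" where
  "tree_vertices = {v. \<exists>n. special n v}"

definition tree_arrows :: "('k::nonarch_local_field, 'n::finite) arrow set" where
  "tree_arrows = {(v, w) \<in> arrows. v \<in> tree_vertices \<and> w \<in> tree_vertices}"


section \<open>Groups of functions\<close>

text \<open>
  Maps defined only on a set (of arrows, or of compact-open sets) are extended by zero to the
  whole type, so that a group of such maps is a set of total functions under pointwise addition.
\<close>

definition fun_group :: "('x \<Rightarrow> 'a::ab_group_add) set \<Rightarrow> ('x \<Rightarrow> 'a) monoid" where
  "fun_group S = \<lparr>carrier = S, monoid.mult = (\<lambda>f g x. f x + g x), one = (\<lambda>_. 0)\<rparr>"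

lemma comm_group_fun_group:
  assumes "(\<lambda>_. 0) \<in> S"
    and "\<And>f g. f \<in> S \<Longrightarrow> g \<in> S \<Longrightarrow> (\<lambda>x. f x + g x) \<in> S"
    and "\<And>f. f \<in> S \<Longrightarrow> (\<lambda>x. - f x) \<in> S"
  shows "comm_group (fun_group S)"
proof (rule comm_groupI)
  fix f assume "f \<in> carrier (fun_group S)"
  then show "\<exists>g\<in>carrier (fun_group S). g \<otimes>\<^bsub>fun_group S\<^esub> f = \<one>\<^bsub>fun_group S\<^esub>"
    using assms(3) by (intro bexI[of _ "\<lambda>x. - f x"]) (auto simp: fun_group_def)
qed (use assms in \<open>auto simp: fun_group_def algebra_simps\<close>)


section \<open>Harmonic cochains\<close>

definition harmonic_building ::
    "(('k::nonarch_local_field, 'n::finite) arrow \<Rightarrow> 'a::ab_group_add) set" where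
  "harmonic_building = {\<phi>.
     (\<forall>e. e \<notin> arrows \<longrightarrow> \<phi> e = 0) \<and>
     (\<forall>p. is_bt_path p \<and> hd p = last p \<longrightarrow> sum_list (map \<phi> (path_arrows p)) = 0) \<and>
     (\<forall>v\<in>vertices. \<forall>t\<in>{1..CARD('n) - 1}. (\<Sum>e\<in>arrows_from_type v t. \<phi> e) = 0) \<and>
     (\<forall>v\<in>vertices. \<forall>e\<in>arrows_from v. \<phi> e = (\<Sum>e' | e' \<in> arrows_from_type v 1 \<and> arrow_prec e' e. \<phi> e'))}"

definition harmonic_tree ::
    "(('k::nonarch_local_field, 'n::finite) arrow \<Rightarrow> 'a::ab_group_add) set" where
  "harmonic_tree = {\<phi>.
     (\<forall>e. e \<notin> tree_arrows \<longrightarrow> \<phi> e = 0) \<and>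
     (\<forall>e\<in>tree_arrows. \<phi> e + \<phi> (prod.swap e) = 0) \<and>
     (\<forall>v\<in>tree_vertices. (\<Sum>e | e \<in> tree_arrows \<and> fst e = v. \<phi> e) = 0)}"

definition restrict_tree ::
    "(('k::nonarch_local_field, 'n::finite) arrow \<Rightarrow> 'a::ab_group_add) \<Rightarrow> ('k, 'n) arrow \<Rightarrow> 'a" where
  "restrict_tree \<phi> = (\<lambda>e. if e \<in> tree_arrows then \<phi> e else 0)"

lemma comm_group_harmonic_building:
  "comm_group (fun_group
    (harmonic_building :: (('k::nonarch_local_field, 'n::finite) arrow \<Rightarrow> 'a::ab_group_add) set))"
  by (rule comm_group_fun_group)
    (auto simp: harmonic_building_def sum.distrib sum_negf sum_list_addf
      uminus_sum_list_map[unfolded o_def, symmetric])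

lemma comm_group_harmonic_tree:
  "comm_group (fun_group
    (harmonic_tree :: (('k::nonarch_local_field, 'n::finite) arrow \<Rightarrow> 'a::ab_group_add) set))"
proof (rule comm_group_fun_group)
  fix f g :: "('k, 'n) arrow \<Rightarrow> 'a"
  assume "f \<in> harmonic_tree" and "g \<in> harmonic_tree"
  then show "(\<lambda>x. f x + g x) \<in> harmonic_tree"
    by (auto simp: harmonic_tree_def sum.distrib algebra_simps add_eq_0_iff)
next
  fix f :: "('k, 'n) arrow \<Rightarrow> 'a"
  assume "f \<in> harmonic_tree"
  then show "(\<lambda>x. - f x) \<in> harmonic_tree"
    by (simp add: harmonic_tree_def sum_negf neg_eq_iff_add_eq_0)
qed (simp add: harmonic_tree_def)


section \<open>Distributions on projective space\<close>

definition lines :: "('k::nonarch_local_field ^ 'n::finite) set set" where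
  "lines = {G. vec.subspace G \<and> vec.dim G = 1}"

definition vec_topology :: "('k::nonarch_local_field ^ 'n::finite) topology" where
  "vec_topology =
     topology (\<lambda>U. \<forall>x\<in>U. \<exists>N. \<forall>y. (\<forall>i. y $ i \<in> vball (x $ i) N) \<longrightarrow> y \<in> U)"

text \<open>The quotient topology with respect to \<open>V - {0} \<rightarrow> \<P>(V)\<close>, \<open>x \<mapsto> K x\<close>.\<close>

definition proj_topology :: "('k::nonarch_local_field ^ 'n::finite) set topology" where
  "proj_topology = topology (\<lambda>U. U \<subseteq> lines \<and>
     openin (subtopology vec_topology (- {0})) {x \<in> - {0}. vec.span {x} \<in> U})"

lemma openin_vec_topology:
  fixes U :: "('k::nonarch_local_field ^ 'n::finite) set"
  shows "openin vec_topology U \<longleftrightarrow> (\<forall>x\<in>U. \<exists>N. \<forall>y. (\<forall>i. y $ i \<in> vball (x $ i) N) \<longrightarrow> y \<in> U)"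
proof -
  have "istopology (\<lambda>U :: ('k ^ 'n) set.
      \<forall>x\<in>U. \<exists>N. \<forall>y. (\<forall>i. y $ i \<in> vball (x $ i) N) \<longrightarrow> y \<in> U)" (is "istopology ?P")
    unfolding istopology_def
  proof (intro conjI allI impI)
    fix S T :: "('k ^ 'n) set"
    assume S: "?P S" and T: "?P T"
    show "?P (S \<inter> T)"
    proof
      fix x assume "x \<in> S \<inter> T"
      then obtain M N where M: "\<forall>y. (\<forall>i. y $ i \<in> vball (x $ i) M) \<longrightarrow> y \<in> S"
        and N: "\<forall>y. (\<forall>i. y $ i \<in> vball (x $ i) N) \<longrightarrow> y \<in> T"
        using S T by blast
      have "vball a (max M N) \<subseteq> vball a M \<inter> vball a N" for a :: 'k
        by (auto simp: vball_def)
      then show "\<exists>N. \<forall>y. (\<forall>i. y $ i \<in> vball (x $ i) N) \<longrightarrow> y \<in> S \<inter> T"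
        using M N by (intro exI[of _ "max M N"]) blast
    qed
  next
    fix F :: "('k ^ 'n) set set"
    assume "\<forall>S\<in>F. ?P S"
    then show "?P (\<Union>F)" by (meson Union_iff)
  qed
  then show ?thesis by (simp add: vec_topology_def topology_inverse')
qed

lemma openin_proj_topology:
  fixes U :: "('k::nonarch_local_field ^ 'n::finite) set set"
  shows "openin proj_topology U \<longleftrightarrow> U \<subseteq> lines \<and>
     openin (subtopology vec_topology (- {0})) {x \<in> - {0}. vec.span {x} \<in> U}"
proof -
  let ?X = "subtopology vec_topology (- {0 :: 'k ^ 'n})"
  let ?f = "\<lambda>U. {x \<in> - {0 :: 'k ^ 'n}. vec.span {x} \<in> U}"
  have "istopology (\<lambda>U. U \<subseteq> lines \<and> openin ?X (?f U))"
    unfolding istopology_def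
  proof (intro conjI allI impI)
    fix S T assume "S \<subseteq> lines \<and> openin ?X (?f S)" "T \<subseteq> lines \<and> openin ?X (?f T)"
    moreover have "?f (S \<inter> T) = ?f S \<inter> ?f T" by blast
    ultimately show "S \<inter> T \<subseteq> lines" "openin ?X (?f (S \<inter> T))" by auto
  next
    fix F assume "\<forall>S\<in>F. S \<subseteq> lines \<and> openin ?X (?f S)"
    moreover have "?f (\<Union>F) = \<Union> (?f ` F)" by blast
    ultimately show "\<Union>F \<subseteq> lines" "openin ?X (?f (\<Union>F))"
      by (auto simp del: Union_iff)
  qed
  then show ?thesis by (simp add: proj_topology_def topology_inverse')
qed

definition compact_open :: "('k::nonarch_local_field ^ 'n::finite) set set set" where
  "compact_open = {U. openin proj_topology U \<and> compactin proj_topology U}"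

definition distributions ::
    "(('k::nonarch_local_field ^ 'n::finite) set set \<Rightarrow> 'a::ab_group_add) set" where
  "distributions = {\<delta>.
     (\<forall>U. U \<notin> compact_open \<longrightarrow> \<delta> U = 0) \<and>
     (\<forall>F. finite F \<and> F \<subseteq> compact_open \<and> disjoint F \<longrightarrow> \<delta> (\<Union>F) = (\<Sum>U\<in>F. \<delta> U))}"

definition distributions0 ::
    "(('k::nonarch_local_field ^ 'n::finite) set set \<Rightarrow> 'a::ab_group_add) set" where
  "distributions0 = {\<delta> \<in> distributions. \<delta> lines = 0}"

lemma comm_group_distributions0:
  "comm_group (fun_group
    (distributions0 :: (('k::nonarch_local_field ^ 'n::finite) set set \<Rightarrow> 'a::ab_group_add) set))"
  by (rule comm_group_fun_group)
    (auto simp: distributions0_def distributions_def sum.distrib sum_negf)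

definition points_to ::
    "('k::nonarch_local_field, 'n::finite) arrow \<Rightarrow> ('k ^ 'n) set \<Rightarrow> bool" where
  "points_to e G \<longleftrightarrow> (\<exists>L\<in>lattices. fst e = sim_class L \<and>
     snd e = sim_class {x + y | x y. x \<in> L \<inter> G \<and> y \<in> lscale unif L})"

definition lines_of_arrow ::
    "('k::nonarch_local_field, 'n::finite) arrow \<Rightarrow> ('k ^ 'n) set set" where
  "lines_of_arrow e = {G \<in> lines. points_to e G}"

text \<open>
  The compact-open sets \<open>lines_of_arrow e\<close>, for \<open>e\<close> of type 1, form a base of the topology, so that
  their masses determine a distribution.
\<close>

definition tilde ::
    "(('k::nonarch_local_field, 'n::finite) arrow \<Rightarrow> 'a::ab_group_add) \<Rightarrow>
      ('k ^ 'n) set set \<Rightarrow> 'a" where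
  "tilde \<phi> = (THE \<delta>. \<delta> \<in> distributions0 \<and> (\<forall>e\<in>type1_arrows. \<delta> (lines_of_arrow e) = \<phi> e))"


section \<open>Group actions\<close>

definition GL_K :: "('k::nonarch_local_field ^ 'n ^ 'n::finite) set" where
  "GL_K = {g. invertible g}"

definition GL_O :: "('k::nonarch_local_field ^ 'n ^ 'n::finite) set" where
  "GL_O = {g. (\<forall>i j. g $ i $ j \<in> integers) \<and>
     (\<exists>h. (\<forall>i j. h $ i $ j \<in> integers) \<and> g ** h = mat 1 \<and> h ** g = mat 1)}"

definition center_GL_K :: "('k::nonarch_local_field ^ 'n ^ 'n::finite) set" where
  "center_GL_K = {z \<in> GL_K. \<forall>g\<in>GL_K. z ** g = g ** z}"

definition GL_O_center :: "('k::nonarch_local_field ^ 'n ^ 'n::finite) set" where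
  "GL_O_center = {g ** z | g z. g \<in> GL_O \<and> z \<in> center_GL_K}"

definition vecs_act ::
    "('k::nonarch_local_field ^ 'n) set \<Rightarrow> 'k ^ 'n ^ 'n::finite \<Rightarrow> ('k ^ 'n) set" where
  "vecs_act S g = (\<lambda>x. x v* g) ` S"

definition vertex_act ::
    "('k::nonarch_local_field, 'n::finite) vertex \<Rightarrow> 'k ^ 'n ^ 'n \<Rightarrow> ('k, 'n) vertex" where
  "vertex_act v g = (\<lambda>L. vecs_act L g) ` v"

definition arrow_act ::
    "('k::nonarch_local_field, 'n::finite) arrow \<Rightarrow> 'k ^ 'n ^ 'n \<Rightarrow> ('k, 'n) arrow" where
  "arrow_act e g = (vertex_act (fst e) g, vertex_act (snd e) g)"

definition lines_act ::
    "('k::nonarch_local_field ^ 'n::finite) set set \<Rightarrow> 'k ^ 'n ^ 'n \<Rightarrow> ('k ^ 'n) set set" where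
  "lines_act U g = (\<lambda>G. vecs_act G g) ` U"

definition cochain_act ::
    "'k ^ 'n ^ 'n \<Rightarrow> (('k::nonarch_local_field, 'n::finite) arrow \<Rightarrow> 'a) \<Rightarrow> ('k, 'n) arrow \<Rightarrow> 'a" where
  "cochain_act g \<phi> = (\<lambda>e. \<phi> (arrow_act e g))"

definition dist_act ::
    "'k ^ 'n ^ 'n \<Rightarrow> (('k::nonarch_local_field ^ 'n::finite) set set \<Rightarrow> 'a) \<Rightarrow>
      ('k ^ 'n) set set \<Rightarrow> 'a" where
  "dist_act g \<delta> = (\<lambda>U. \<delta> (lines_act U g))"

definition equivariant ::
    "'g set \<Rightarrow> ('g \<Rightarrow> 'x \<Rightarrow> 'x) \<Rightarrow> ('g \<Rightarrow> 'y \<Rightarrow> 'y) \<Rightarrow> 'x set \<Rightarrow> 'y set \<Rightarrow> ('x \<Rightarrow> 'y) \<Rightarrow> bool" where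
  "equivariant \<Gamma> actX actY X Y f \<longleftrightarrow>
     (\<forall>g\<in>\<Gamma>. (\<forall>x\<in>X. actX g x \<in> X) \<and> (\<forall>y\<in>Y. actY g y \<in> Y) \<and>
       (\<forall>x\<in>X. f (actX g x) = actY g (f x)))"

end

theory Submission
  imports Defs
begin

text \<open>
  The cells, i.e. the sets of lines congruent to a given line modulo \<open>\<pi>\<^sup>n\<close>, correspond to the
  \<open>n\<close>-special vertices.  They form a tree under inclusion and generate all compact-open sets, so that
  harmonic cochains on the tree are the same as distributions of total mass \<open>0\<close>.  Such a distribution
  \<open>\<delta>\<close> gives a harmonic cochain on the building: to an arrow represented by \<open>L \<supset> M\<close> it assigns the
  \<open>\<delta>\<close>-mass of the lines \<open>G\<close> with \<open>L \<inter> G \<subseteq> M\<close>.  It remains to see that a harmonic cochain \<open>\<phi>\<close> that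
  vanishes on the tree is \<open>0\<close>.  Let \<open>L\<^sub>0 = O\<^sup>r\<close> and \<open>L \<subseteq> L\<^sub>0\<close>.  By (A) and (C), the value of \<open>\<phi>\<close> on the arrow
  of type 1 from \<open>L\<close> in the direction of \<open>x \<in> L - \<pi>L\<^sub>0\<close> is a sum of such values for a smaller lattice, and
  repeated refinement leads to arrows of the tree; so this value is \<open>0\<close>.  By (B), \<open>\<phi>\<close> then vanishes on
  the arrow from \<open>L\<close> to \<open>L \<inter> \<pi>L\<^sub>0\<close>.  Iterating, \<open>L\<close> is joined to \<open>L\<^sub>0\<close> by a path on which \<open>\<phi>\<close> vanishes, and
  (A) shows \<open>\<phi> = 0\<close>.
\<close>

section \<open>Valuation bounds\<close>

text \<open>Conditions (A) and (B) for the cochain of a distribution \<delta> rest on one principle: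
  a finite family of compact-open sets that covers every line the same number k of times has total
  mass k times \<delta>(P(V)), which is 0. Nothing is divided, so A may have torsion. For (A) the
  covering number is constant because it can be read off from lattice exponents along a closed path;
  for (B), because the automorphisms of L are transitive on the vectors of L outside \<pi>L.
  Condition (C) is plain additivity.

  Only one map back to the building is built, \<delta> to its cochain. Going from the tree to
  distributions, on to cochains and back to the tree gives the identity by inspection of the tree
  arrows; injectivity of the restriction turns this into an inverse on the other side as well. The
  same map inverts \<open>tilde\<close>, since a distribution is determined by its values on the
  sets of arrows of type 1. This uniqueness also gives additivity and equivariance of
  \<open>tilde\<close>.\<close>

definition vge :: "int \<Rightarrow> 'k::nonarch_local_field \<Rightarrow> bool" where
  "vge n a \<longleftrightarrow> a = 0 \<or> n \<le> vord a"

lemma vord_one [simp]: "vord (1::'k::nonarch_local_field) = 0"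
  using vord_mult[of "1::'k" 1] by simp

lemma vord_neg1: "vord (- 1 :: 'k::nonarch_local_field) = 0"
  using vord_mult[of "- 1::'k" "- 1"] by simp

lemma vord_minus [simp]: "vord (- x :: 'k::nonarch_local_field) = vord x"
proof (cases "x = 0")
  case False
  then show ?thesis using vord_mult[of "-1" x] by (simp add: vord_neg1)
qed simp

lemma vord_inverse: "(x :: 'k::nonarch_local_field) \<noteq> 0 \<Longrightarrow> vord (inverse x) = - vord x"
  using vord_mult[of x "inverse x"] by simp

lemma vord_divide:
  "(x :: 'k::nonarch_local_field) \<noteq> 0 \<Longrightarrow> y \<noteq> 0 \<Longrightarrow> vord (x / y) = vord x - vord y"
  by (simp add: divide_inverse vord_mult vord_inverse)

lemma vord_power: "(x :: 'k::nonarch_local_field) \<noteq> 0 \<Longrightarrow> vord (x ^ n) = int n * vord x"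
  by (induction n) (auto simp: vord_mult algebra_simps)

lemma vge_0 [simp]: "vge n 0"
  by (simp add: vge_def)

lemma vge_mono: "vge n a \<Longrightarrow> m \<le> n \<Longrightarrow> vge m a"
  by (auto simp: vge_def)

lemma vge_add: "vge n a \<Longrightarrow> vge n b \<Longrightarrow> vge n (a + b)"
  using vord_add[of a b] by (force simp: vge_def)

lemma vge_minus [simp]: "vge n (- a) \<longleftrightarrow> vge n a"
  by (simp add: vge_def)

lemma vge_diff: "vge n a \<Longrightarrow> vge n b \<Longrightarrow> vge n (a - b)"
  using vge_add[of n a "- b"] by simp

lemma vge_mult: "vge m a \<Longrightarrow> vge n b \<Longrightarrow> vge (m + n) (a * b)"
  by (cases "a = 0 \<or> b = 0") (auto simp: vge_def vord_mult)

lemma vge_sum: "(\<And>i. i \<in> S \<Longrightarrow> vge n (f i)) \<Longrightarrow> vge n (\<Sum>i\<in>S. f i)"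
  by (induction S rule: infinite_finite_induct) (auto intro: vge_add)

lemma vge_prod:
  "finite S \<Longrightarrow> (\<And>i. i \<in> S \<Longrightarrow> vge n (f i)) \<Longrightarrow> vge (int (card S) * n) (\<Prod>i\<in>S. f i)"
proof (induction S rule: finite_induct)
  case (insert x F)
  then have "vge (n + int (card F) * n) (f x * prod f F)"
    by (intro vge_mult) auto
  then show ?case using insert by (simp add: algebra_simps)
qed (simp add: vge_def)

lemma vge_times_iff: "c \<noteq> 0 \<Longrightarrow> vge n (c * a) \<longleftrightarrow> vge (n - vord c) a"
  by (cases "a = 0") (auto simp: vge_def vord_mult)

lemma vge_ex_bound: "finite S \<Longrightarrow> \<exists>n. \<forall>i\<in>S. vge n (f i)"
proof (induction S rule: finite_induct)
  case (insert x F)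
  then obtain n where "\<forall>i\<in>F. vge n (f i)" by blast
  then show ?case
    by (intro exI[of _ "min n (vord (f x))"]) (auto intro: vge_mono simp: vge_def)
qed simp

lemma integers_iff_vge: "a \<in> integers \<longleftrightarrow> vge 0 a"
  by (simp add: integers_def vge_def)

lemma integers_0 [simp]: "0 \<in> integers" and integers_1 [simp]: "1 \<in> integers"
  and integers_unif [simp]: "unif \<in> integers"
  by (auto simp: integers_iff_vge vge_def vord_unif)

lemma integers_add: "a \<in> integers \<Longrightarrow> b \<in> integers \<Longrightarrow> a + b \<in> integers"
  by (simp add: integers_iff_vge vge_add)

lemma integers_minus [simp]: "- a \<in> integers \<longleftrightarrow> a \<in> integers"
  by (simp add: integers_iff_vge)

lemma integers_diff: "a \<in> integers \<Longrightarrow> b \<in> integers \<Longrightarrow> a - b \<in> integers"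
  by (simp add: integers_iff_vge vge_diff)

lemma integers_mult: "a \<in> integers \<Longrightarrow> b \<in> integers \<Longrightarrow> a * b \<in> integers"
  using vge_mult[of 0 a 0 b] by (simp add: integers_iff_vge)

lemma vord_powi: "vord ((unif :: 'k::nonarch_local_field) powi n) = n"
  by (simp add: power_int_def vord_power vord_unif vord_inverse unif_nonzero)

lemma unif_powi_nonzero [simp]: "(unif :: 'k::nonarch_local_field) powi n \<noteq> 0"
  by (simp add: power_int_def unif_nonzero)

lemma unif_nz [simp]: "(unif :: 'k::nonarch_local_field) \<noteq> 0"
  by (rule unif_nonzero)

lemma integer_unit_cases:
  assumes "a \<in> integers"
  obtains "a \<noteq> 0" "vord a = 0" | "vge 1 a"
  using assms by (force simp: integers_def vge_def)

lemma vge_1_iff: "vge 1 a \<longleftrightarrow> a \<in> (\<lambda>x. unif * x) ` integers"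
proof
  assume "vge 1 a"
  then have "inverse unif * a \<in> integers"
    by (simp add: integers_iff_vge vge_times_iff vord_inverse vord_unif)
  then show "a \<in> (\<lambda>x. unif * x) ` integers"
    by (intro image_eqI[of _ _ "inverse unif * a"]) auto
qed (auto simp: integers_iff_vge vge_times_iff vord_unif)

lemma inverse_unit_integer: "a \<noteq> 0 \<Longrightarrow> vord a = 0 \<Longrightarrow> inverse a \<in> integers"
  by (simp add: integers_iff_vge vge_def vord_inverse)

text \<open>The class axiom speaks of a quotient set. A finite system of representatives is the form
  in which it serves to count M/\<pi>L in \<open>residue_dim_card\<close> and to cover a ball by
  finitely many translates in \<open>oball_0_reps\<close>.\<close>

lemma finite_residue_reps:
  "\<exists>R. finite R \<and> R \<subseteq> integers \<and> (\<forall>a\<in>integers. \<exists>!r. r \<in> R \<and> vge 1 (a - (r::'k::nonarch_local_field)))"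
proof -
  define E where "E = {(x, y :: 'k). x \<in> integers \<and> y \<in> integers \<and> vge 1 (x - y)}"
  have fin: "finite (integers // E)"
    using finite_residue_field[where 'a='k]
    unfolding E_def integers_def vge_def by (simp add: conj_disj_distribL cong: conj_cong)
  have "equiv integers E"
  proof (rule equivI)
    show "E \<subseteq> integers \<times> integers" by (auto simp: E_def)
    show "refl_on integers E" by (auto simp: E_def refl_on_def)
    show "sym E" unfolding E_def sym_def
      by clarify (metis minus_diff_eq vge_minus)
    show "trans E" unfolding E_def trans_def
      by clarify (metis diff_add_cancel add_diff_eq vge_add)
  qed
  define rep where "rep C = (SOME x. x \<in> C)" for C :: "'k set"
  have rep: "rep C \<in> C" if "C \<in> integers // E" for C
    unfolding rep_def using in_quotient_imp_non_empty[OF \<open>equiv integers E\<close> that] some_in_eq by blast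
  have uniq: "\<exists>!r. r \<in> rep ` (integers // E) \<and> vge 1 (a - r)" if a: "a \<in> integers" for a
  proof (rule ex1I[of _ "rep (E `` {a})"])
    have "E `` {a} \<in> integers // E" using a by (rule quotientI)
    then show "rep (E `` {a}) \<in> rep ` (integers // E) \<and> vge 1 (a - rep (E `` {a}))"
      using rep[of "E `` {a}"] by (auto simp: E_def)
    fix r assume r: "r \<in> rep ` (integers // E) \<and> vge 1 (a - r)"
    then obtain C where C: "C \<in> integers // E" "r = rep C" by blast
    have "r \<in> C" using C rep by blast
    moreover have "C \<subseteq> integers" using in_quotient_imp_subset[OF \<open>equiv integers E\<close> C(1)] .
    ultimately have "(a, r) \<in> E" using a r by (auto simp: E_def)
    then have "C = E `` {a}"
      using \<open>r \<in> C\<close> C(1) \<open>equiv integers E\<close>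
      by (metis Image_singleton_iff equiv_class_eq quotientE)
    then show "r = rep (E `` {a})" using C by simp
  qed
  have "rep ` (integers // E) \<subseteq> integers"
  proof (intro image_subsetI)
    fix C assume C: "C \<in> integers // E"
    show "rep C \<in> integers" using in_quotient_imp_subset[OF \<open>equiv integers E\<close> C] rep[OF C] by (rule subsetD)
  qed
  then show ?thesis using fin uniq by (intro exI[of _ "rep ` (integers // E)"] conjI ballI) simp_all
qed

section \<open>Submodules and lattices\<close>

definition omod :: "('k::nonarch_local_field ^ 'n) set \<Rightarrow> bool" where
  "omod M \<longleftrightarrow> 0 \<in> M \<and> (\<forall>x\<in>M. \<forall>y\<in>M. x + y \<in> M) \<and> (\<forall>a\<in>integers. \<forall>x\<in>M. a *s x \<in> M)"

text \<open>The lattice \<pi>^n O^r, also for negative \<open>n\<close>. These balls are at once a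
  neighbourhood base of 0 and the lattices against which all others are measured.\<close>

definition oball :: "int \<Rightarrow> ('k::nonarch_local_field ^ 'n) set" where
  "oball n = {x. \<forall>i. vge n (x $ i)}"

text \<open>For a submodule N this is O x + N. With N = \<pi>L it describes the targets of arrows of
  type 1, with N = \<pi>^n O^r the vertices of the tree.\<close>

definition cyc :: "('k::nonarch_local_field ^ 'n) \<Rightarrow> ('k ^ 'n) set \<Rightarrow> ('k ^ 'n) set" where
  "cyc x N = {y. \<exists>a\<in>integers. y - a *s x \<in> N}"

lemma omod_0: "omod M \<Longrightarrow> 0 \<in> M" and omod_add: "omod M \<Longrightarrow> x \<in> M \<Longrightarrow> y \<in> M \<Longrightarrow> x + y \<in> M"
  and omod_scale: "omod M \<Longrightarrow> a \<in> integers \<Longrightarrow> x \<in> M \<Longrightarrow> a *s x \<in> M"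
  by (auto simp: omod_def)

lemma omod_minus: "omod M \<Longrightarrow> x \<in> M \<Longrightarrow> - x \<in> M"
  using omod_scale[of M "-1" x] by simp

lemma omod_diff: "omod M \<Longrightarrow> x \<in> M \<Longrightarrow> y \<in> M \<Longrightarrow> x - y \<in> M"
  using omod_add[of M x "- y"] omod_minus by auto

lemma omod_sum: "omod M \<Longrightarrow> (\<And>i. i \<in> S \<Longrightarrow> f i \<in> M) \<Longrightarrow> (\<Sum>i\<in>S. f i) \<in> M"
  by (induction S rule: infinite_finite_induct) (auto intro: omod_add omod_0)

lemma omod_unit_iff: "omod M \<Longrightarrow> a \<noteq> 0 \<Longrightarrow> vord a = 0 \<Longrightarrow> a *s x \<in> M \<longleftrightarrow> x \<in> M"
  using omod_scale[of M "inverse a" "a *s x"] omod_scale[of M a x] inverse_unit_integer[of a]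
  by (auto simp: integers_def)

lemma omod_add_cancel: "omod M \<Longrightarrow> y \<in> M \<Longrightarrow> x + y \<in> M \<longleftrightarrow> x \<in> M"
  using omod_add omod_diff by (metis add_diff_cancel_right')

lemma omod_Int: "omod M \<Longrightarrow> omod N \<Longrightarrow> omod (M \<inter> N)"
  by (auto simp: omod_def)

lemma omod_cyc: fixes N :: "('a::nonarch_local_field ^ 'b) set" assumes "omod N" shows "omod (cyc x N)"
  unfolding omod_def cyc_def
proof (intro conjI ballI; clarify)
  show "\<exists>a\<in>integers. 0 - a *s x \<in> N" using assms by (intro bexI[of _ 0]) (auto intro: omod_0)
next
  fix y z :: "'a ^ 'b" and a b :: 'a assume "a \<in> integers" "b \<in> integers" "y - a *s x \<in> N" "z - b *s x \<in> N"
  then show "\<exists>a\<in>integers. y + z - a *s x \<in> N"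
    using omod_add[OF assms, of "y - a *s x" "z - b *s x"]
    by (intro bexI[of _ "a + b"]) (auto simp: algebra_simps vec.scale_left_distrib intro: integers_add)
next
  fix y :: "'a ^ 'b" and a b :: 'a assume "a \<in> integers" "b \<in> integers" "y - b *s x \<in> N"
  then show "\<exists>c\<in>integers. a *s y - c *s x \<in> N"
    using omod_scale[OF assms, of a "y - b *s x"]
    by (intro bexI[of _ "a * b"]) (auto simp: vec.scale_right_diff_distrib intro: integers_mult)
qed

lemma cyc_superset: "N \<subseteq> cyc x N"
  unfolding cyc_def by (auto intro!: bexI[of _ 0])

lemma cyc_self: "omod N \<Longrightarrow> x \<in> cyc x N"
  unfolding cyc_def by (auto intro!: bexI[of _ 1] omod_0)

lemma cyc_subset: "cyc x N \<subseteq> M \<longleftrightarrow> x \<in> M \<and> N \<subseteq> M" if "omod N" "omod M"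
proof
  assume "x \<in> M \<and> N \<subseteq> M"
  then have "y \<in> M" if "y - a *s x \<in> N" "a \<in> integers" for y a
    using that omod_add[OF \<open>omod M\<close>, of "y - a *s x" "a *s x"] omod_scale[OF \<open>omod M\<close>, of a x] by auto
  then show "cyc x N \<subseteq> M" by (auto simp: cyc_def)
qed (use cyc_superset[of N x] cyc_self[OF that(1), of x] in blast)

lemma cyc_mono: "N \<subseteq> N' \<Longrightarrow> cyc x N \<subseteq> cyc x N'"
  by (auto simp: cyc_def)

lemma mem_lscale: "c \<noteq> 0 \<Longrightarrow> x \<in> lscale c L \<longleftrightarrow> inverse c *s x \<in> L"
  unfolding lscale_def by (auto intro!: image_eqI[of _ _ "inverse c *s x"])

lemma scale_mem_lscale [simp]: "c \<noteq> 0 \<Longrightarrow> c *s x \<in> lscale c L \<longleftrightarrow> x \<in> L"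
  by (simp add: mem_lscale)

lemma lscale_lscale: "lscale c (lscale d L) = lscale (c * d) L"
  by (simp add: lscale_def image_image)

lemma lscale_1 [simp]: "lscale 1 L = L"
  by (simp add: lscale_def)

lemma lscale_mono: "L \<subseteq> M \<Longrightarrow> lscale c L \<subseteq> lscale c M"
  by (auto simp: lscale_def)

lemma lscale_inverse [simp]: "c \<noteq> 0 \<Longrightarrow> lscale (inverse c) (lscale c L) = L"
  by (simp add: lscale_lscale)

lemma lscale_subset_iff: "c \<noteq> 0 \<Longrightarrow> lscale c L \<subseteq> lscale c M \<longleftrightarrow> L \<subseteq> M"
  using lscale_mono[of L M c] lscale_mono[of "lscale c L" "lscale c M" "inverse c"] by auto

lemma lscale_eq_iff: "c \<noteq> 0 \<Longrightarrow> lscale c L = lscale c M \<longleftrightarrow> L = M"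
  by (metis lscale_inverse)

lemma lscale_psubset_iff: "c \<noteq> 0 \<Longrightarrow> lscale c L \<subset> lscale c M \<longleftrightarrow> L \<subset> M"
  by (simp add: psubset_eq lscale_subset_iff lscale_eq_iff)

lemma lscale_inter: "c \<noteq> 0 \<Longrightarrow> lscale c (L \<inter> M) = lscale c L \<inter> lscale c M"
  by (auto simp: mem_lscale)

lemma omod_lscale:
  fixes M :: "('a::nonarch_local_field ^ 'b) set"
  shows "omod M \<Longrightarrow> omod (lscale c M)"
proof -
  have *: "a *s (c *s x) = c *s (a *s x)" for a and x :: "'a ^ 'b" by (simp add: mult.commute)
  assume M: "omod M"
  show ?thesis unfolding omod_def lscale_def
  proof (intro conjI ballI; (elim imageE)?; hypsubst?)
    show "0 \<in> (\<lambda>x. c *s x) ` M" using omod_0[OF M] by (intro image_eqI[of _ _ 0]) auto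
  next
    fix x y assume "x \<in> M" "y \<in> M"
    then show "c *s x + c *s y \<in> (\<lambda>x. c *s x) ` M"
      unfolding vec.scale_right_distrib[symmetric] by (intro imageI omod_add[OF M])
  next
    fix a :: 'a and x assume "a \<in> integers" "x \<in> M"
    then show "a *s (c *s x) \<in> (\<lambda>x. c *s x) ` M"
      unfolding * by (intro imageI omod_scale[OF M])
  qed
qed

lemma lscale_vge_subset: "omod M \<Longrightarrow> vge (vord d) c \<Longrightarrow> d \<noteq> 0 \<Longrightarrow> lscale c M \<subseteq> lscale d M"
proof
  fix x assume M: "omod M" "vge (vord d) c" "d \<noteq> 0" "x \<in> lscale c M"
  then obtain y where y: "y \<in> M" "x = c *s y" by (auto simp: lscale_def)
  have "inverse d * c \<in> integers" using M by (simp add: integers_iff_vge vge_times_iff vord_inverse)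
  then show "x \<in> lscale d M" using M y omod_scale[of M "inverse d * c" y] by (simp add: mem_lscale)
qed

lemma lscale_unif_subset: "omod M \<Longrightarrow> lscale unif M \<subseteq> M"
  using lscale_vge_subset[of M 1 unif] by (simp add: vge_def vord_unif)

lemma lscale_unit: "omod M \<Longrightarrow> vord c = vord d \<Longrightarrow> c \<noteq> 0 \<Longrightarrow> d \<noteq> 0 \<Longrightarrow> lscale c M = lscale d M"
  by (intro equalityI lscale_vge_subset) (auto simp: vge_def)

lemma omod_oball [simp]: "omod (oball n)"
  by (auto simp: omod_def oball_def integers_iff_vge intro: vge_add)
    (metis add_0 vge_mult)

lemma lscale_oball: "c \<noteq> 0 \<Longrightarrow> lscale c (oball n) = oball (n + vord c)"
  by (auto simp: mem_lscale oball_def vge_times_iff vord_inverse algebra_simps)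

lemma std_lattice_oball: "std_lattice = oball 0"
  by (simp add: std_lattice_def oball_def integers_iff_vge)

lemma oball_mono: "m \<le> n \<Longrightarrow> oball n \<subseteq> oball m"
  by (auto simp: oball_def intro: vge_mono)

lemma oball_scale: "x \<in> oball n \<Longrightarrow> vge m c \<Longrightarrow> c *s x \<in> oball (m + n)"
  by (auto simp: oball_def vge_mult)

lemma oball_scale_iff: "c \<noteq> 0 \<Longrightarrow> c *s x \<in> oball n \<longleftrightarrow> x \<in> oball (n - vord c)"
  by (auto simp: oball_def vge_times_iff)

lemma oball_union: "\<exists>n. (x :: 'k::nonarch_local_field ^ 'n::finite) \<in> oball n"
  using vge_ex_bound[of UNIV "\<lambda>i. x $ i"] by (auto simp: oball_def)

lemma oball_inter: assumes "x \<noteq> 0" shows "\<exists>n. x \<notin> oball n"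
proof -
  obtain i where "x $ i \<noteq> 0" using assms by (auto simp: vec_eq_iff)
  then show ?thesis by (auto simp: oball_def vge_def intro!: exI[of _ "vord (x $ i) + 1"] exI[of _ i])
qed

lemma oball_axis: "axis i c \<in> oball n \<longleftrightarrow> vge n c"
  by (auto simp: oball_def axis_def)

lemma det_vge:
  fixes A :: "'k::nonarch_local_field ^ 'n ^ 'n::finite"
  assumes "\<And>i. A $ i \<in> oball n"
  shows "vge (int CARD('n) * n) (det A)"
  unfolding det_def
proof (rule vge_sum)
  fix p assume "p \<in> {p. p permutes (UNIV :: 'n set)}"
  have "vge (int CARD('n) * n) (\<Prod>i\<in>UNIV. A $ i $ p i)"
    using assms by (intro vge_prod) (auto simp: oball_def)
  moreover have "vge 0 (of_int (sign p) :: 'k)"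
    by (auto simp: sign_def vge_def vord_neg1)
  ultimately show "vge (int CARD('n) * n) (of_int (sign p) * (\<Prod>i\<in>UNIV. A $ i $ p i))"
    using vge_mult by fastforce
qed

section \<open>Linear automorphisms of K^r, and lattices as submodules squeezed between
  balls\<close>

definition linaut :: "('k::nonarch_local_field ^ 'n \<Rightarrow> 'k ^ 'n) \<Rightarrow> bool" where
  "linaut f \<longleftrightarrow> (\<forall>x y. f (x + y) = f x + f y) \<and> (\<forall>c x. f (c *s x) = c *s f x) \<and> bij f"

lemma vector_matrix_mult_sum_rows: "x v* (B :: 'k::comm_semiring_1 ^ 'n ^ 'm) = (\<Sum>i\<in>UNIV. x $ i *s B $ i)"
  by (simp add: vec_eq_iff vector_matrix_mult_def mult.commute)

lemma scale_vector_matrix: "(c *s x) v* (B :: 'k::comm_semiring_1 ^ 'n ^ 'm) = c *s (x v* B)"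
  by (simp add: vec_eq_iff vector_matrix_mult_def sum_distrib_left algebra_simps)

lemma linaut_matrix:
  fixes B :: "'k::nonarch_local_field ^ 'n ^ 'n::finite"
  assumes "invertible B"
  shows "linaut (\<lambda>x. x v* B)"
proof -
  obtain C where C: "B ** C = mat 1" "C ** B = mat 1" using assms by (auto simp: invertible_def)
  then have "bij (\<lambda>x. x v* B)"
    by (intro o_bij[of "\<lambda>x. x v* C"]) (auto simp: fun_eq_iff vector_matrix_mul_assoc)
  then show ?thesis
    by (simp add: linaut_def vector_matrix_left_distrib scale_vector_matrix)
qed

lemma linaut_0: "linaut f \<Longrightarrow> f 0 = 0"
  unfolding linaut_def by (metis add_cancel_right_right)

lemma linaut_diff: "linaut f \<Longrightarrow> f (x - y) = f x - f y"
  unfolding linaut_def by (metis diff_add_cancel add_diff_cancel_right')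

lemma linaut_sum: "linaut f \<Longrightarrow> f (\<Sum>i\<in>S. g i) = (\<Sum>i\<in>S. f (g i))"
  by (induction S rule: infinite_finite_induct) (auto simp: linaut_0 linaut_def)

lemma linaut_inv: assumes "linaut f" shows "linaut (inv_into UNIV f)"
proof -
  have b: "bij f" using assms by (simp add: linaut_def)
  have 1: "f (inv_into UNIV f x) = x" and 2: "inv_into UNIV f (f x) = x" for x
    using b by (auto simp: bij_is_surj surj_f_inv_f bij_is_inj)
  show ?thesis unfolding linaut_def
    by (metis (no_types, lifting) 1 2 assms b bij_imp_bij_inv linaut_def)
qed

lemma linaut_image_inv: "linaut f \<Longrightarrow> inv_into UNIV f ` f ` S = S" "linaut f \<Longrightarrow> f ` inv_into UNIV f ` S = S"
  unfolding linaut_def by (auto simp: image_inv_f_f bij_is_inj image_f_inv_f bij_is_surj)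

lemma linaut_mem: "linaut f \<Longrightarrow> f x \<in> f ` S \<longleftrightarrow> x \<in> S"
  unfolding linaut_def by (auto simp: bij_def inj_def)

lemma linaut_scale: "c \<noteq> 0 \<Longrightarrow> linaut (\<lambda>x. c *s x)"
  unfolding linaut_def
  by (auto simp: vec.scale_right_distrib mult.commute
      intro!: o_bij[of "\<lambda>x. inverse c *s x"] simp: fun_eq_iff)

lemma linaut_lscale: "linaut f \<Longrightarrow> f ` lscale c L = lscale c (f ` L)"
  unfolding linaut_def lscale_def by (simp add: image_image)

lemma linaut_omod:
  fixes f :: "'a::nonarch_local_field ^ 'b \<Rightarrow> 'a ^ 'b"
  shows "linaut f \<Longrightarrow> omod (f ` M) \<longleftrightarrow> omod M"
proof -
  have "omod (f ` M)" if "linaut f" "omod M" for f :: "'a ^ 'b \<Rightarrow> 'a ^ 'b" and M :: "('a ^ 'b) set"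
    unfolding omod_def
  proof (intro conjI ballI; (elim imageE)?; hypsubst?)
    show "0 \<in> f ` M" using that linaut_0 omod_0 by (metis imageI)
  next
    fix x y assume "x \<in> M" "y \<in> M"
    then show "f x + f y \<in> f ` M" using that unfolding linaut_def by (metis imageI omod_add)
  next
    fix a :: 'a and x :: "'a ^ 'b" assume "a \<in> integers" "x \<in> M"
    then show "a *s f x \<in> f ` M" using that unfolding linaut_def by (metis imageI omod_scale)
  qed
  then show "linaut f \<Longrightarrow> ?thesis" using linaut_image_inv(1) linaut_inv by metis
qed

lemma linaut_cyc:
  fixes f :: "'k::nonarch_local_field ^ 'n \<Rightarrow> 'k ^ 'n"
  shows "linaut f \<Longrightarrow> f ` cyc x N = cyc (f x) (f ` N)"
proof -
  assume f: "linaut f"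
  then have s: "f (a *s x) = a *s f x" for a by (simp add: linaut_def)
  show ?thesis
  proof (intro equalityI subsetI)
    fix z assume "z \<in> f ` cyc x N"
    then obtain y a where y: "z = f y" "a \<in> integers" "y - a *s x \<in> N" by (auto simp: cyc_def)
    then have "f (y - a *s x) \<in> f ` N" by blast
    then show "z \<in> cyc (f x) (f ` N)" using y f by (auto simp: cyc_def linaut_diff s)
  next
    fix z assume "z \<in> cyc (f x) (f ` N)"
    then obtain a where a: "a \<in> integers" "z - a *s f x \<in> f ` N" by (auto simp: cyc_def)
    obtain y where y: "z = f y" using f unfolding linaut_def by (metis bij_pointE)
    have "f (y - a *s x) \<in> f ` N" using a y f by (simp add: linaut_diff s)
    then show "z \<in> f ` cyc x N" using y a f by (auto simp: cyc_def linaut_mem)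
  qed
qed

lemma lscale_image: "lscale c L = (\<lambda>x. c *s x) ` L" by (simp add: lscale_def)

lemma lscale_cyc: "c \<noteq> 0 \<Longrightarrow> lscale c (cyc x N) = cyc (c *s x) (lscale c N)"
  unfolding lscale_image by (rule linaut_cyc[OF linaut_scale])

lemma integral_span_eq:
  "{\<Sum>i\<in>UNIV. c i *s b i | c. \<forall>i. c i \<in> integers} = (\<lambda>x. x v* (\<chi> i. b i)) ` std_lattice"
proof (intro equalityI subsetI)
  fix y assume "y \<in> {\<Sum>i\<in>UNIV. c i *s b i | c. \<forall>i. c i \<in> integers}"
  then obtain c where "y = (\<Sum>i\<in>UNIV. c i *s b i)" "\<forall>i. c i \<in> integers" by blast
  then show "y \<in> (\<lambda>x. x v* (\<chi> i. b i)) ` std_lattice"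
    by (intro image_eqI[of _ _ "\<chi> i. c i"]) (auto simp: vector_matrix_mult_sum_rows std_lattice_def)
qed (auto simp: vector_matrix_mult_sum_rows std_lattice_def)

text \<open>Clearing denominators: a linear relation over K becomes integral after multiplication by
  a power of the uniformizer, so integral independence is linear independence over K.\<close>

lemma integrally_independent_invertible:
  fixes b :: "'n::finite \<Rightarrow> 'k::nonarch_local_field ^ 'n"
  shows "(\<forall>c. (\<forall>i. c i \<in> integers) \<and> (\<Sum>i\<in>UNIV. c i *s b i) = 0 \<longrightarrow> (\<forall>i. c i = 0)) \<longleftrightarrow>
    invertible (\<chi> i. b i)" (is "?I \<longleftrightarrow> ?R")
proof -
  have inv: "?R \<longleftrightarrow> (\<forall>c. (\<Sum>i\<in>UNIV. c i *s b i) = 0 \<longrightarrow> (\<forall>i. c i = 0))"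
    unfolding invertible_right_inverse matrix_right_invertible_independent_rows
    by (simp add: row_def)
  have "?R" if ?I
    unfolding inv
  proof (intro allI impI)
    fix c i assume c: "(\<Sum>i\<in>UNIV. c i *s b i) = 0"
    obtain n where n: "\<forall>i. vge n (c i)" using vge_ex_bound[of UNIV c] by auto
    let ?d = "\<lambda>i. unif powi (- n) * c i"
    have "(\<forall>i. ?d i \<in> integers)" using n by (simp add: integers_iff_vge vge_times_iff vord_powi)
    moreover have "(\<Sum>i\<in>UNIV. ?d i *s b i) = unif powi (- n) *s (\<Sum>i\<in>UNIV. c i *s b i)"
      by (simp add: vec.scale_sum_right)
    ultimately have "?d i = 0" using that c by (metis vec.scale_zero_right)
    then show "c i = 0" by simp
  qed
  then show ?thesis using inv by blast
qed

lemma lattices_eq: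
  "lattices = {(\<lambda>x. x v* B) ` std_lattice | B :: 'k::nonarch_local_field ^ 'n ^ 'n::finite. invertible B}"
  unfolding lattices_def integral_span_eq integrally_independent_invertible
proof (intro Collect_cong iffI)
  fix L :: "('k ^ 'n) set"
  assume "\<exists>B :: 'k ^ 'n ^ 'n. L = (\<lambda>x. x v* B) ` std_lattice \<and> invertible B"
  then obtain B :: "'k ^ 'n ^ 'n" where "L = (\<lambda>x. x v* B) ` std_lattice" "invertible B" by blast
  moreover have e: "(\<chi> i. B $ i) = B" by (simp add: vec_eq_iff)
  ultimately show "\<exists>b :: 'n \<Rightarrow> 'k ^ 'n. L = (\<lambda>x. x v* (\<chi> i. b i)) ` std_lattice \<and> invertible (\<chi> i. b i)"
    using e by (intro exI[of _ "\<lambda>i. B $ i"]) simp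
qed blast

lemma lattice_linaut:
  assumes "L \<in> lattices" obtains f where "linaut f" "L = f ` std_lattice"
  using assms linaut_matrix unfolding lattices_eq by blast

lemma matrix_bound:
  fixes B :: "'k::nonarch_local_field ^ 'n ^ 'n::finite"
  obtains m where "\<And>n x. x \<in> oball n \<Longrightarrow> x v* B \<in> oball (m + n)"
proof -
  obtain m where m: "\<forall>p\<in>UNIV. vge m (B $ fst p $ snd p)"
    using vge_ex_bound[of UNIV "\<lambda>p. B $ fst p $ snd p"] by auto
  have "x v* B \<in> oball (m + n)" if "x \<in> oball n" for n x
    using that m by (auto simp: oball_def vector_matrix_mult_def intro!: vge_sum)
        (metis add.commute mult.commute vge_mult)
  then show ?thesis using that by blast
qed

text \<open>A family of vectors of \<open>L\<close> whose determinant has minimal valuation is a basis, by Cramer's rule.\<close>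

lemma lattices_iff:
  "(L :: ('k::nonarch_local_field ^ 'n::finite) set) \<in> lattices \<longleftrightarrow> omod L \<and> (\<exists>m n. oball m \<subseteq> L \<and> L \<subseteq> oball n)"
proof
  assume "L \<in> lattices"
  then obtain B :: "'k ^ 'n ^ 'n" where B: "L = (\<lambda>x. x v* B) ` oball 0" "invertible B"
    by (auto simp: lattices_eq std_lattice_oball)
  then obtain C where C: "C ** B = mat 1" by (auto simp: invertible_def)
  obtain n where n: "\<And>l x. x \<in> oball l \<Longrightarrow> x v* B \<in> oball (n + l)" using matrix_bound by blast
  obtain m where m: "\<And>l x. x \<in> oball l \<Longrightarrow> x v* C \<in> oball (m + l)" using matrix_bound by blast
  have "L \<subseteq> oball n" using n[of _ 0] B by auto
  moreover have "oball (- m) \<subseteq> L"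
  proof
    fix x :: "'k ^ 'n" assume "x \<in> oball (- m)"
    then have "x v* C \<in> oball 0" using m by fastforce
    moreover have "x = (x v* C) v* B" using C by (simp add: vector_matrix_mul_assoc)
    ultimately show "x \<in> L" using B by blast
  qed
  moreover have "omod L" unfolding B(1) linaut_omod[OF linaut_matrix[OF B(2)]] by simp
  ultimately show "omod L \<and> (\<exists>m n. oball m \<subseteq> L \<and> L \<subseteq> oball n)" by blast
next
  assume "omod L \<and> (\<exists>m n. oball m \<subseteq> L \<and> L \<subseteq> oball n)"
  then obtain m n where L: "omod L" and m: "oball m \<subseteq> L" and n: "L \<subseteq> oball n" by blast
  define P where "P B \<longleftrightarrow> (\<forall>i. B $ i \<in> L) \<and> det B \<noteq> 0" for B :: "'k ^ 'n ^ 'n"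
  \<comment> \<open>Families of vectors of \<open>L \<subseteq> oball n\<close> have determinants of
    valuation at least \<open>r\<close>. Subtracting \<open>r\<close> turns the valuation into a
    natural number, so that a minimum exists.\<close>
  define r where "r = int CARD('n) * n"
  have low: "r \<le> vord (det B)" if "P B" for B
    using det_vge[of B n] that n unfolding P_def r_def by (auto simp: vge_def)
  have "P (\<chi> i j. if i = j then unif powi m else 0)"
  proof -
    have "(\<chi> j. if i = j then unif powi m else 0) \<in> L" for i :: 'n
      using m by (rule subsetD) (auto simp: oball_def vge_def vord_powi)
    then show ?thesis unfolding P_def by (subst det_diagonal) auto
  qed
  then obtain B where B: "P B" "\<And>B'. P B' \<Longrightarrow> nat (vord (det B) - r) \<le> nat (vord (det B') - r)"
    using ex_has_least_nat[of P _ "\<lambda>B. nat (vord (det B) - r)"] by blast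
  have min: "vord (det B) \<le> vord (det B')" if "P B'" for B'
    using B(2)[OF that] low[OF that] low[OF B(1)] by linarith
  have inv: "invertible B" using B(1) by (simp add: P_def invertible_det_nz)
  then obtain C where C: "C ** B = mat 1" by (auto simp: invertible_def)
  have "L = (\<lambda>x. x v* B) ` std_lattice"
  proof (intro equalityI subsetI)
    fix x assume x: "x \<in> L"
    define c where "c = x v* C"
    have xc: "x = c v* B" using C by (simp add: c_def vector_matrix_mul_assoc)
    have "c $ k \<in> integers" for k
    proof (cases "c $ k = 0")
      case False
      \<comment> \<open>With row \<open>k\<close> replaced by \<open>x\<close> the determinant
        becomes \<open>c $ k * det B\<close>; minimality of \<open>det B\<close> then excludes a
        negative valuation of \<open>c $ k\<close>.\<close>
      let ?B' = "(\<chi> i. if i = k then x else B $ i) :: 'k ^ 'n ^ 'n"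
      have "?B' = (\<chi> i. if i = k then (\<Sum>i\<in>UNIV. c $ i *s row i B) else row i B)"
        using xc by (simp add: vector_matrix_mult_sum_rows row_def vec_eq_iff)
      then have d: "det ?B' = c $ k * det B" using cramer_lemma_transpose[of k c B] by simp
      then have "P ?B'" using False B(1) x by (auto simp: P_def)
      then have "vord (det B) \<le> vord (c $ k) + vord (det B)"
        using min[of ?B'] d vord_mult[of "c $ k" "det B"] False B(1) by (simp add: P_def)
      then show ?thesis by (simp add: integers_def)
    qed simp
    then show "x \<in> (\<lambda>x. x v* B) ` std_lattice" using xc by (auto simp: std_lattice_def)
  next
    fix x assume "x \<in> (\<lambda>x. x v* B) ` std_lattice"
    then obtain c where "x = (\<Sum>i\<in>UNIV. c $ i *s B $ i)" "\<forall>i. c $ i \<in> integers"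
      by (auto simp: vector_matrix_mult_sum_rows std_lattice_def)
    then show "x \<in> L" using L B(1) by (auto simp: P_def intro!: omod_sum omod_scale)
  qed
  then show "L \<in> lattices" using inv by (auto simp: lattices_eq)
qed

lemma lattice_omod: "L \<in> lattices \<Longrightarrow> omod L"
  by (simp add: lattices_iff)

lemma lattice_oball [simp]: "oball n \<in> lattices"
  by (auto simp: lattices_iff)

lemma lattice_std [simp]: "std_lattice \<in> lattices"
  by (simp add: std_lattice_oball)

lemma lattice_sandwich:
  "L \<in> lattices \<Longrightarrow> L' \<in> lattices \<Longrightarrow> omod M \<Longrightarrow> L \<subseteq> M \<Longrightarrow> M \<subseteq> L' \<Longrightarrow> M \<in> lattices"
  unfolding lattices_iff by (metis subset_trans)

lemma linaut_matrix_ex: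
  fixes f :: "'k::nonarch_local_field ^ 'n \<Rightarrow> 'k ^ 'n::finite"
  assumes "linaut f"
  obtains B where "invertible B" "f = (\<lambda>x. x v* B)"
proof -
  let ?B = "\<chi> i. f (axis i 1)"
  have eq: "x v* ?B = f x" for x
  proof -
    have "x v* ?B = (\<Sum>i\<in>UNIV. f (x $ i *s axis i 1))"
      using assms by (simp add: vector_matrix_mult_sum_rows linaut_def)
    also have "\<dots> = f (\<Sum>i\<in>UNIV. x $ i *s axis i 1)" by (rule linaut_sum[OF assms, symmetric])
    finally show ?thesis by (simp add: basis_expansion)
  qed
  have "\<forall>i. c i = 0" if "(\<Sum>i\<in>UNIV. c i *s row i ?B) = 0" for c
  proof -
    have "(\<chi> i. c i) v* ?B = 0" using that unfolding vector_matrix_mult_sum_rows by (simp add: row_def)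
    then have "f (\<chi> i. c i) = f 0" using linaut_0[OF assms] by (simp add: eq)
    then have "(\<chi> i. c i) = 0" using assms by (simp add: linaut_def bij_def inj_eq)
    then show ?thesis by (simp add: vec_eq_iff)
  qed
  then have "invertible ?B" unfolding invertible_right_inverse matrix_right_invertible_independent_rows by blast
  then show ?thesis using that[of ?B] eq by auto
qed

lemma lattice_image:
  fixes f :: "'k::nonarch_local_field ^ 'n \<Rightarrow> 'k ^ 'n::finite"
  assumes "linaut f" shows "f ` L \<in> lattices \<longleftrightarrow> L \<in> lattices"
proof -
  have *: "g ` M \<in> lattices" if g: "linaut g" and M: "M \<in> lattices" for g :: "'k ^ 'n \<Rightarrow> 'k ^ 'n" and M
  proof -
    obtain B where B: "invertible B" "g = (\<lambda>x. x v* B)" using linaut_matrix_ex[OF g] .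
    obtain C :: "'k ^ 'n ^ 'n" where C: "invertible C" "M = (\<lambda>x. x v* C) ` std_lattice" using M unfolding lattices_eq by blast
    have "g ` M = (\<lambda>x. x v* (C ** B)) ` std_lattice" using B C by (simp add: image_image vector_matrix_mul_assoc)
    then show ?thesis using invertible_mult[OF C(1) B(1)] unfolding lattices_eq by blast
  qed
  show ?thesis using *[OF assms] *[OF linaut_inv[OF assms], of "f ` L"] linaut_image_inv(1)[OF assms] by auto
qed

lemma lattice_lscale: "c \<noteq> 0 \<Longrightarrow> lscale c (L :: ('k::nonarch_local_field ^ 'n::finite) set) \<in> lattices \<longleftrightarrow> L \<in> lattices"
  unfolding lscale_image by (rule lattice_image[OF linaut_scale])

lemma lattice_Int: "L \<in> lattices \<Longrightarrow> M \<in> lattices \<Longrightarrow> L \<inter> M \<in> lattices"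
proof -
  assume L: "L \<in> lattices" and M: "M \<in> lattices"
  obtain m n where "oball m \<subseteq> L" "oball n \<subseteq> M" using L M unfolding lattices_iff by blast
  then have "oball (max m n) \<subseteq> L \<inter> M" using oball_mono[of m "max m n"] oball_mono[of n "max m n"] by fastforce
  then show ?thesis using L M
    by (intro lattice_sandwich[OF lattice_oball L]) (auto intro: omod_Int lattice_omod)
qed

lemma lattice_cyc:
  assumes "L \<in> lattices" shows "cyc x L \<in> lattices"
proof -
  obtain n where n: "L \<subseteq> oball n" using assms unfolding lattices_iff by blast
  obtain k where k: "x \<in> oball k" using oball_union by blast
  have "cyc x L \<subseteq> oball (min n k)"
    unfolding cyc_subset[OF lattice_omod[OF assms] omod_oball]
    using n k oball_mono[of "min n k" n] oball_mono[of "min n k" k] by auto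
  then show ?thesis
    using assms by (intro lattice_sandwich[OF assms lattice_oball]) (auto intro: omod_cyc lattice_omod subsetD[OF cyc_superset])
qed

text \<open>\<pi>-adic expansion: representatives modulo \<pi>^(n+1) are the vectors r + \<pi>^n q,
  with r running modulo \<pi>^n and q modulo \<pi>.\<close>

lemma oball_0_reps:
  "\<exists>R. finite R \<and> (\<forall>x\<in>oball 0 :: ('k::nonarch_local_field ^ 'n::finite) set. \<exists>r\<in>R. x - r \<in> oball (int n))"
proof (induction n)
  case 0
  then show ?case by (intro exI[of _ "{0}"]) simp
next
  case (Suc n)
  obtain R :: "('k ^ 'n) set" where R: "finite R" "\<And>x. x \<in> oball 0 \<Longrightarrow> \<exists>r\<in>R. x - r \<in> oball (int n)"
    using Suc by blast
  obtain Q :: "'k set" where Q: "finite Q" "\<And>a. a \<in> integers \<Longrightarrow> \<exists>r\<in>Q. vge 1 (a - r)"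
    using finite_residue_reps[where 'k='k] by meson
  define Qv where "Qv = vec_lambda ` PiE (UNIV :: 'n set) (\<lambda>_. Q)"
  have finQ: "finite Qv" unfolding Qv_def using Q(1) by (intro finite_imageI finite_PiE) auto
  have repQ: "\<exists>r\<in>Qv. x - r \<in> oball 1" if "x \<in> oball 0" for x
  proof -
    have "\<forall>i. \<exists>r\<in>Q. vge 1 (x $ i - r)" using that Q(2) by (auto simp: oball_def integers_iff_vge)
    then obtain r where r: "\<forall>i. r i \<in> Q \<and> vge 1 (x $ i - r i)" by metis
    then show ?thesis unfolding Qv_def by (intro bexI[of _ "vec_lambda r"]) (auto simp: oball_def)
  qed
  let ?S = "(\<lambda>(r, q). r + unif powi int n *s q) ` (R \<times> Qv)"
  have "\<exists>s\<in>?S. x - s \<in> oball (int (Suc n))" if x: "x \<in> oball 0" for x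
  proof -
    obtain r where r: "r \<in> R" "x - r \<in> oball (int n)" using R(2)[OF x] by blast
    define y where "y = unif powi (- int n) *s (x - r)"
    have "y \<in> oball 0" using r(2) unfolding y_def oball_scale_iff[OF unif_powi_nonzero] by (simp add: vord_powi)
    then obtain q where q: "q \<in> Qv" "y - q \<in> oball 1" using repQ by blast
    have "unif powi int n *s y = x - r" by (simp add: y_def power_int_minus)
    then have eq: "x - (r + unif powi int n *s q) = unif powi int n *s (y - q)"
      by (simp add: vec.scale_right_diff_distrib)
    have "x - (r + unif powi int n *s q) \<in> oball (int (Suc n))"
      using q(2) unfolding eq oball_scale_iff[OF unif_powi_nonzero] vord_powi by simp
    then show ?thesis using r(1) q(1) by (intro bexI[of _ "r + unif powi int n *s q"]) auto
  qed
  then show ?case using R(1) finQ by (intro exI[of _ ?S]) auto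
qed

text \<open>Replacing \<open>L\<close> by a smaller and \<open>M\<close> by a larger ball and
  scaling reduces this to \<open>oball_0_reps\<close>. The truncation in \<open>nat (l - m)\<close>
  can only make the balls finer.\<close>

lemma lattice_reps:
  assumes "L \<in> lattices" "M \<in> lattices"
  obtains R where "finite R" "\<And>x. x \<in> M \<Longrightarrow> \<exists>r\<in>R. x - (r :: 'k::nonarch_local_field ^ 'n::finite) \<in> L"
proof -
  obtain l m where l: "oball l \<subseteq> L" and m: "M \<subseteq> oball m" using assms unfolding lattices_iff by blast
  define n where "n = nat (l - m)"
  obtain R :: "('k ^ 'n) set" where R: "finite R" "\<And>x. x \<in> oball 0 \<Longrightarrow> \<exists>r\<in>R. x - r \<in> oball (int n)"
    using oball_0_reps[where 'k='k and 'n='n and n=n] by meson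
  show ?thesis
  proof (rule that[of "(\<lambda>r. unif powi m *s r) ` R"])
    fix x assume "x \<in> M"
    then have "unif powi (- m) *s x \<in> oball 0" using m by (auto simp: oball_scale_iff vord_powi)
    then obtain r where r: "r \<in> R" "unif powi (- m) *s x - r \<in> oball (int n)" using R(2) by blast
    have "x - unif powi m *s r = unif powi m *s (unif powi (- m) *s x - r)"
      by (simp add: vec.scale_right_diff_distrib power_int_minus)
    moreover have "oball (int n) \<subseteq> oball (l - m)" by (rule oball_mono) (simp add: n_def)
    then have "unif powi m *s (unif powi (- m) *s x - r) \<in> oball l"
      unfolding oball_scale_iff[OF unif_powi_nonzero] vord_powi using r(2) by blast
    ultimately show "\<exists>r\<in>(\<lambda>r. unif powi m *s r) ` R. x - r \<in> L" using l r by auto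
  qed (simp add: R)
qed

text \<open>A module \<open>N\<close> between \<open>L\<close> and \<open>M\<close> is a union of
  cosets of \<open>L\<close>, hence determined by its trace on a finite set of representatives. This
  makes the sums over arrows at a vertex finite.\<close>

lemma finite_omod_between:
  assumes "L \<in> lattices" "M \<in> lattices"
  shows "finite {N. omod N \<and> L \<subseteq> N \<and> N \<subseteq> (M :: ('k::nonarch_local_field ^ 'n::finite) set)}" (is "finite ?S")
proof -
  obtain R where R: "finite R" "\<And>x. x \<in> M \<Longrightarrow> \<exists>r\<in>R. x - r \<in> L" using lattice_reps[OF assms] by blast
  have "inj_on (\<lambda>N. N \<inter> R) ?S"
  proof (rule inj_onI)
    have sub: "N \<subseteq> N'" if N: "N \<in> ?S" "N' \<in> ?S" "N \<inter> R = N' \<inter> R" for N N'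
    proof
      fix x assume x: "x \<in> N"
      then obtain r where r: "r \<in> R" "x - r \<in> L" using R(2) N by blast
      have "x - (x - r) \<in> N" using x r(2) N omod_diff[of N x "x - r"] by blast
      then have "r \<in> N" by simp
      then have "r \<in> N'" using N r by auto
      then have "r + (x - r) \<in> N'" using r N by (intro omod_add) auto
      then show "x \<in> N'" by simp
    qed
    then show "N = N'" if "N \<in> ?S" "N' \<in> ?S" "N \<inter> R = N' \<inter> R" for N N'
      using sub[OF that] sub[OF that(2,1)] that(3) by blast
  qed
  moreover have "finite ((\<lambda>N. N \<inter> R) ` ?S)"
    by (rule finite_subset[of _ "Pow R"]) (auto simp: R)
  ultimately show ?thesis by (rule finite_imageD[rotated])
qed


section \<open>Vertices and arrows\<close>

lemma sim_class_self [simp]: "L \<in> sim_class L"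
  unfolding sim_class_def by (rule CollectI, rule exI[of _ 1]) simp

lemma sim_class_lscale [simp]: assumes "c \<noteq> 0" shows "sim_class (lscale c L) = sim_class L"
proof -
  show ?thesis unfolding sim_class_def lscale_lscale
  proof (intro equalityI subsetI; elim CollectE exE conjE; intro CollectI)
    fix x d assume "x = lscale (d * c) L" "d \<noteq> 0"
    then show "\<exists>c. x = lscale c L \<and> c \<noteq> 0" using assms by (intro exI[of _ "d * c"]) simp
  next
    fix x d assume "x = lscale d L" "d \<noteq> 0"
    then show "\<exists>ca. x = lscale (ca * c) L \<and> ca \<noteq> 0" using assms by (intro exI[of _ "d / c"]) simp
  qed
qed

lemma sim_class_eq_iff: "sim_class L = sim_class M \<longleftrightarrow> (\<exists>c. c \<noteq> 0 \<and> M = lscale c L)"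
proof
  assume "sim_class L = sim_class M"
  then have "M \<in> sim_class L" by simp
  then show "\<exists>c. c \<noteq> 0 \<and> M = lscale c L" by (auto simp: sim_class_def)
qed auto

lemma sim_class_eq_powi:
  assumes "omod L" "sim_class L = sim_class M"
  obtains n where "M = lscale (unif powi n) L"
proof -
  obtain c where c: "c \<noteq> 0" "M = lscale c L" using assms sim_class_eq_iff by blast
  then have "M = lscale (unif powi (vord c)) L" using assms(1) by (metis lscale_unit unif_powi_nonzero vord_powi)
  then show ?thesis by (rule that)
qed

lemma vertices_iff: "v \<in> vertices \<longleftrightarrow> (\<exists>L\<in>lattices. v = sim_class L)"
  by (auto simp: vertices_def)

lemma lscale_powi_subset: "omod M \<Longrightarrow> 1 \<le> n \<Longrightarrow> lscale (unif powi n) M \<subseteq> lscale unif M"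
  by (intro lscale_vge_subset) (auto simp: vge_def vord_powi vord_unif)

text \<open>Similar submodules differ by a power \<pi>^n. For n \<ge> 1, M' = \<pi>^n M would lie in
  \<pi>L; for n \<le> -1 the same argument applies with \<open>M\<close> and \<open>M'\<close>
  exchanged. Hence an arrow and a representative of its origin determine the second lattice.\<close>

lemma between_unique:
  assumes "omod L" "omod M" "lscale unif L \<subset> M" "M \<subset> L" "lscale unif L \<subset> M'" "M' \<subset> L"
    "sim_class M = sim_class M'"
  shows "M' = M"
proof -
  obtain n where n: "M' = lscale (unif powi n) M" using sim_class_eq_powi[OF assms(2,7)] .
  then have om: "omod M'" and M: "M = lscale (unif powi (- n)) M'"
    using assms(2) by (auto simp: omod_lscale lscale_lscale power_int_minus)
  have False if "1 \<le> n" "omod N" "N \<subset> L" "lscale unif L \<subset> lscale (unif powi n) N" for N n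
    using lscale_powi_subset[OF that(2,1)] lscale_mono[of N L unif] that(3,4) by blast
  then have "n = 0" using om assms n M
    by (metis linorder_neqE_linordered_idom neg_0_less_iff_less zless_imp_add1_zle add_0)
  then show ?thesis using n by simp
qed

lemma arrow_rep_lscale: "c \<noteq> 0 \<Longrightarrow> arrow_rep e (lscale c L) (lscale c M) \<longleftrightarrow> arrow_rep e L M"
  unfolding arrow_rep_def by (simp add: lattice_lscale lscale_psubset_iff)
    (metis lscale_lscale lscale_psubset_iff mult.commute)

lemma arrow_rep_unique: "arrow_rep e L M \<Longrightarrow> arrow_rep e L M' \<Longrightarrow> M' = M"
  unfolding arrow_rep_def by (intro between_unique[of L M M']) (auto simp: lattice_omod)

lemma arrow_rep_sim:
  assumes "arrow_rep e L M" "arrow_rep e L' M'"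
  obtains c where "c \<noteq> 0" "L' = lscale c L" "M' = lscale c M"
proof -
  obtain c where c: "c \<noteq> 0" "L' = lscale c L" using assms unfolding arrow_rep_def by (metis sim_class_eq_iff)
  then have "arrow_rep e L' (lscale c M)" using assms arrow_rep_lscale by blast
  then show ?thesis using that c assms arrow_rep_unique by blast
qed

lemma arrows_sym: "(v, w) \<in> arrows \<longleftrightarrow> (w, v) \<in> arrows"
  by (simp add: arrows_def insert_commute)

text \<open>Rotation of the flag: L \<supset> M \<supset> \<pi>L continues as M \<supset> \<pi>L
  \<supset> \<pi>M.\<close>

lemma arrow_rep_flip: "arrow_rep (v, w) L M \<Longrightarrow> arrow_rep (w, v) M (lscale unif L)"
  by (simp add: arrow_rep_def lattice_lscale lscale_psubset_iff)

text \<open>\<open>arrows\<close> is defined through unordered simplices. If the flag of the simplex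
  starts at the terminus of \<open>e\<close>, rotating it by \<open>arrow_rep_flip\<close> gives one
  that starts at the origin.\<close>

lemma arrows_iff: "e \<in> arrows \<longleftrightarrow> (\<exists>L M. arrow_rep e L M)"
proof
  assume "e \<in> arrows"
  then have "{fst e, snd e} \<in> simplices 1" by (cases e) (simp add: arrows_def)
  then obtain M where M: "{fst e, snd e} = (\<lambda>i. sim_class (M i)) ` {..1::nat} \<and>
    (\<forall>i\<le>1. M i \<in> lattices) \<and> (\<forall>i<1. M (Suc i) \<subset> M i) \<and> lscale unif (M 0) \<subset> M 1"
    unfolding simplices_def by (elim CollectE exE) (rule that)
  have "{..1::nat} = {0, 1}" by auto
  then have "{fst e, snd e} = {sim_class (M 0), sim_class (M 1)}" using M by simp
  then have "e = (sim_class (M 0), sim_class (M 1)) \<or> e = (sim_class (M 1), sim_class (M 0))"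
    by (auto simp: doubleton_eq_iff prod_eq_iff)
  moreover have "arrow_rep (sim_class (M 0), sim_class (M 1)) (M 0) (M 1)"
    using M by (auto simp: arrow_rep_def)
  ultimately show "\<exists>L M. arrow_rep e L M" using arrow_rep_flip by blast
next
  assume "\<exists>L M. arrow_rep e L M"
  then obtain L M where LM: "arrow_rep e L M" by blast
  have "{..1::nat} = {0, 1}" by auto
  then have "{fst e, snd e} = (\<lambda>i. sim_class (if i = 0 then L else M)) ` {..1::nat}"
    using LM by (auto simp: arrow_rep_def)
  then have "{fst e, snd e} \<in> simplices 1"
    using LM unfolding simplices_def arrow_rep_def
    by (intro CollectI exI[of _ "\<lambda>i. if i = (0::nat) then L else M"]) auto
  then show "e \<in> arrows" by (auto simp: arrows_def)
qed

lemma arrow_rep_arrow: "arrow_rep e L M \<Longrightarrow> e \<in> arrows"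
  using arrows_iff by blast

text \<open>\<pi>^n L is contained in \<pi>L for n \<ge> 1 and contains L for n \<le> 0, so no
  lattice similar to L lies strictly between the two.\<close>

lemma arrows_irrefl: "(v, v) \<notin> arrows"
proof
  assume "(v, v) \<in> arrows"
  then obtain L M where LM: "arrow_rep (v, v) L M" by (auto simp: arrows_iff)
  then have L: "omod L" and M: "M \<subset> L" "lscale unif L \<subset> M" "sim_class L = sim_class M"
    by (auto simp: arrow_rep_def lattice_omod)
  obtain n where n: "M = lscale (unif powi n) L" using sim_class_eq_powi[OF L M(3)] .
  show False
  proof (cases "1 \<le> n")
    case True
    then show ?thesis using lscale_powi_subset[OF L] n M by blast
  next
    case False
    then have "lscale 1 L \<subseteq> lscale (unif powi n) L"
      by (intro lscale_vge_subset[OF L]) (auto simp: vge_def vord_powi)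
    then show ?thesis using n M by auto
  qed
qed

lemma arrow_vertices: "(v, w) \<in> arrows \<Longrightarrow> v \<in> vertices \<and> w \<in> vertices"
  by (auto simp: arrows_iff arrow_rep_def vertices_iff)

lemma arrow_rep_at:
  assumes "e \<in> arrows" "L \<in> lattices" "fst e = sim_class L"
  obtains M where "arrow_rep e L M"
proof -
  obtain L' M' where r: "arrow_rep e L' M'" using assms arrows_iff by blast
  then obtain c where c: "c \<noteq> 0" "L = lscale c L'" using assms unfolding arrow_rep_def by (metis sim_class_eq_iff)
  then have "arrow_rep e L (lscale c M')" using r arrow_rep_lscale by blast
  then show ?thesis by (rule that)
qed

text \<open>The preimages in \<open>L\<close> of the proper nonzero subspaces of L/\<pi>L. Via
  \<open>arr L\<close> they parametrise the arrows with origin [L].\<close>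

definition betw :: "('k::nonarch_local_field ^ 'n) set \<Rightarrow> ('k ^ 'n) set set" where
  "betw L = {M. omod M \<and> lscale unif L \<subset> M \<and> M \<subset> L}"

abbreviation arr :: "('k::nonarch_local_field ^ 'n::finite) set \<Rightarrow> ('k ^ 'n) set \<Rightarrow> ('k, 'n) arrow" where
  "arr L M \<equiv> (sim_class L, sim_class M)"

lemma lattice_between:
  fixes L :: "('k::nonarch_local_field ^ 'n::finite) set"
  shows "L \<in> lattices \<Longrightarrow> omod M \<Longrightarrow> lscale unif L \<subseteq> M \<Longrightarrow> M \<subseteq> L \<Longrightarrow> M \<in> lattices"
  by (rule lattice_sandwich[of "lscale unif L" L]) (auto simp: lattice_lscale)

lemma arrow_rep_arr: "L \<in> lattices \<Longrightarrow> arrow_rep (arr L M) L M \<longleftrightarrow> M \<in> betw L"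
  unfolding arrow_rep_def betw_def using lattice_between lattice_omod by auto

lemma finite_betw: "L \<in> lattices \<Longrightarrow> finite (betw (L :: ('k::nonarch_local_field ^ 'n::finite) set))"
  by (rule finite_subset[OF _ finite_omod_between[of "lscale unif L" L]]) (auto simp: betw_def lattice_lscale)

lemma arrows_from_eq: "L \<in> lattices \<Longrightarrow> arrows_from (sim_class L) = arr L ` betw L"
proof (intro equalityI subsetI)
  fix e assume L: "L \<in> lattices" "e \<in> arrows_from (sim_class L)"
  then obtain M where "arrow_rep e L M" unfolding arrows_from_def by (blast intro: arrow_rep_at)
  then show "e \<in> arr L ` betw L" using L
    by (intro image_eqI[of _ _ M]) (auto simp: arrow_rep_def betw_def prod_eq_iff lattice_omod)
qed (auto simp: arrows_from_def arrow_rep_arr[symmetric] intro: arrow_rep_arrow)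

lemma inj_on_arr: "L \<in> lattices \<Longrightarrow> inj_on (arr L) (betw L)"
  by (rule inj_onI) (metis arrow_rep_arr arrow_rep_unique)


section \<open>Residue dimension\<close>

lemma mem_coset:
  assumes "omod N"
  shows "{x + y | y. y \<in> N} = {x' + y | y. y \<in> N} \<longleftrightarrow> x - x' \<in> N"
proof -
  have *: "{x + y | y. y \<in> N} = {z. z - x \<in> N}" for x
    by (auto intro!: exI[of _ "_ - x"])
  show ?thesis unfolding *
  proof
    assume "{z. z - x \<in> N} = {z. z - x' \<in> N}"
    moreover have "x \<in> {z. z - x \<in> N}" using omod_0[OF assms] by simp
    ultimately show "x - x' \<in> N" by blast
  next
    assume a: "x - x' \<in> N"
    have "z - x \<in> N \<longleftrightarrow> z - x' \<in> N" for z
      using omod_add_cancel[OF assms a, of "z - x"] by simp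
    then show "{z. z - x \<in> N} = {z. z - x' \<in> N}" by simp
  qed
qed

lemma coset_space_subset_iff:
  assumes "omod L" "omod M" "lscale unif L \<subseteq> M"
  shows "coset_space L M' \<subseteq> coset_space L M \<longleftrightarrow> M' \<subseteq> M"
proof
  have oL: "omod (lscale unif L)" using assms omod_lscale by blast
  assume s: "coset_space L M' \<subseteq> coset_space L M"
  show "M' \<subseteq> M"
  proof
    fix x assume "x \<in> M'"
    then obtain y where y: "y \<in> M" "{x + z | z. z \<in> lscale unif L} = {y + z | z. z \<in> lscale unif L}"
      using s unfolding coset_space_def by blast
    then have "x - y \<in> M" using mem_coset[OF oL] assms by blast
    then show "x \<in> M" using omod_add[OF assms(2) _ y(1)] by fastforce
  qed
qed (auto simp: coset_space_def)

text \<open>Coordinates taken from the representatives \<open>R\<close> enumerate M/\<pi>L without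
  repetition, so its cardinality is q^t. This is how the dimension is seen to be well
  defined.\<close>

lemma residue_dim_card:
  fixes L :: "('k::nonarch_local_field ^ 'n) set" and R :: "'k set"
  assumes R: "finite R" "R \<subseteq> integers" "\<And>a. a \<in> integers \<Longrightarrow> \<exists>!r. r \<in> R \<and> vge 1 (a - r)"
    and L: "omod L" "omod M" "M \<subseteq> L" "has_residue_dim L M t"
  shows "card (coset_space L M) = card R ^ t"
proof -
  have oL: "omod (lscale unif L)" using L omod_lscale by blast
  obtain x where x: "\<And>i. i < t \<Longrightarrow> x i \<in> M"
      "\<And>y. y \<in> M \<Longrightarrow> \<exists>c. (\<forall>i<t. c i \<in> integers) \<and> y - (\<Sum>i<t. c i *s x i) \<in> lscale unif L"
      "\<And>c i. (\<forall>i<t. c i \<in> integers) \<Longrightarrow> (\<Sum>i<t. c i *s x i) \<in> lscale unif L \<Longrightarrow> i < t \<Longrightarrow> vge 1 (c i)"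
    using L(4) unfolding has_residue_dim_def vge_1_iff[symmetric] by blast
  define S where "S c = (\<Sum>i<t. c i *s x i)" for c
  define C where "C x = {x + y | y. y \<in> lscale unif L}" for x :: "'k ^ 'n"
  have C: "C y = C z \<longleftrightarrow> y - z \<in> lscale unif L" for y z unfolding C_def by (rule mem_coset[OF oL])
  have Sdiff: "S c - S d = S (\<lambda>i. c i - d i)" for c d
    by (simp add: S_def vec.scale_left_diff_distrib sum_subtractf)
  have "bij_betw (\<lambda>c. C (S c)) (PiE {..<t} (\<lambda>_. R)) (coset_space L M)"
    unfolding bij_betw_def
  proof
    show "inj_on (\<lambda>c. C (S c)) (PiE {..<t} (\<lambda>_. R))"
    proof (rule inj_onI)
      fix c d assume c: "c \<in> PiE {..<t} (\<lambda>_. R)" and d: "d \<in> PiE {..<t} (\<lambda>_. R)" and eq: "C (S c) = C (S d)"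
      have cd: "i < t \<Longrightarrow> c i \<in> R \<and> d i \<in> R \<and> c i \<in> integers \<and> d i \<in> integers" for i
        using c d R(2) by (auto simp: PiE_def Pi_def)
      have "S (\<lambda>i. c i - d i) \<in> lscale unif L" using eq C Sdiff by metis
      then have "vge 1 (c i - d i)" if "i < t" for i
        using x(3)[of "\<lambda>i. c i - d i" i] that cd integers_diff unfolding S_def by blast
      moreover have "vge 1 (c i - c i)" for i by simp
      ultimately have "c i = d i" if "i < t" for i using R(3)[of "c i"] cd that by blast
      then show "c = d" using c d by (intro PiE_ext) auto
    qed
    show "(\<lambda>c. C (S c)) ` PiE {..<t} (\<lambda>_. R) = coset_space L M"
    proof (intro equalityI subsetI)
      fix z assume "z \<in> (\<lambda>c. C (S c)) ` PiE {..<t} (\<lambda>_. R)"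
      then obtain c where c: "c \<in> PiE {..<t} (\<lambda>_. R)" "z = C (S c)" by blast
      then have "S c \<in> M" unfolding S_def using R(2) x(1) L(2)
        by (intro omod_sum omod_scale) (auto simp: PiE_def Pi_def)
      then show "z \<in> coset_space L M" using c unfolding coset_space_def C_def by blast
    next
      fix z assume "z \<in> coset_space L M"
      then obtain y where y: "y \<in> M" "z = C y" unfolding coset_space_def C_def by blast
      obtain d where d: "\<And>i. i < t \<Longrightarrow> d i \<in> integers" "y - S d \<in> lscale unif L"
        using x(2)[OF y(1)] unfolding S_def by blast
      define c where "c = restrict (\<lambda>i. THE r. r \<in> R \<and> vge 1 (d i - r)) {..<t}"
      have c: "c i \<in> R \<and> vge 1 (d i - c i)" if "i < t" for i
        using theI'[OF R(3)[OF d(1)[OF that]]] that unfolding c_def by simp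
      then have "c \<in> PiE {..<t} (\<lambda>_. R)" by (auto simp: c_def)
      moreover have "S (\<lambda>i. d i - c i) \<in> lscale unif L"
        unfolding S_def
      proof (rule omod_sum[OF oL])
        fix i assume i: "i \<in> {..<t}"
        then obtain b where b: "b \<in> integers" "d i - c i = unif * b" using c[of i] unfolding vge_1_iff by auto
        have "b *s x i \<in> L" using b x(1) i L by (intro omod_scale) auto
        moreover have "(d i - c i) *s x i = unif *s (b *s x i)" by (simp add: b(2))
        ultimately show "(d i - c i) *s x i \<in> lscale unif L" by (metis scale_mem_lscale unif_nz)
      qed
      then have "(y - S d) + (S d - S c) \<in> lscale unif L" unfolding Sdiff by (rule omod_add[OF oL d(2)])
      then have "y - S c \<in> lscale unif L" by simp
      then have "z = C (S c)" using y C by simp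
      ultimately show "z \<in> (\<lambda>c. C (S c)) ` PiE {..<t} (\<lambda>_. R)" by blast
    qed
  qed
  then show ?thesis by (simp add: bij_betw_same_card[symmetric] card_PiE R(1))
qed

lemma residue_dim_unique:
  fixes L :: "('k::nonarch_local_field ^ 'n) set"
  assumes L: "omod L" "omod M" "M \<subseteq> L" "has_residue_dim L M t" "has_residue_dim L M t'"
  shows "t = (t' :: nat)"
proof -
  obtain R :: "'k set" where R: "finite R" "R \<subseteq> integers" "\<And>a. a \<in> integers \<Longrightarrow> \<exists>!r. r \<in> R \<and> vge 1 (a - r)"
    using finite_residue_reps by meson
  \<comment> \<open>The representatives of 0 and 1 differ, so \<open>R\<close> has at least two
    elements and t is determined by q^t.\<close>
  obtain r where r: "r \<in> R" "vge 1 (0 - r)" using R(3)[of 0] by (meson integers_0)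
  obtain s where s: "s \<in> R" "vge 1 (1 - s)" using R(3)[of 1] by (meson integers_1)
  have "r \<noteq> s"
  proof
    assume "r = s"
    then have "vge 1 ((1 - s) - (0 - r))" using r s vge_diff by blast
    then show False using \<open>r = s\<close> by (simp add: vge_def)
  qed
  then have "2 \<le> card R" using r s R(1) card_le_Suc_iff[of 1 R]
    by (metis card_2_iff card_mono empty_subsetI insert_subset)
  moreover have "card R ^ t = card R ^ t'"
    using residue_dim_card[OF R L(1-4)] residue_dim_card[OF R L(1-3) L(5)] by simp
  ultimately show ?thesis by simp
qed

text \<open>A generating set of M modulo \<pi>L of least size is a basis: a relation with a unit
  coefficient would allow one generator to be dropped.\<close>

lemma residue_dim_exists:
  fixes L :: "('k::nonarch_local_field ^ 'n::finite) set"
  assumes L: "L \<in> lattices" "omod M" "M \<subseteq> L"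
  shows "\<exists>t. has_residue_dim L M t"
proof -
  have oL: "omod (lscale unif L)" using L omod_lscale lattice_omod by blast
  define gen where "gen S \<longleftrightarrow> finite S \<and> S \<subseteq> M \<and>
    (\<forall>y\<in>M. \<exists>c. (\<forall>s\<in>S. c s \<in> integers) \<and> y - (\<Sum>s\<in>S. c s *s s) \<in> lscale unif L)" for S :: "('k ^ 'n) set"
  have ex: "\<exists>S. gen S"
  proof -
    obtain R where R: "finite R" "\<And>x. x \<in> L \<Longrightarrow> \<exists>r\<in>R. x - r \<in> lscale unif L"
      using lattice_reps[of "lscale unif L" L] L(1) by (metis lattice_lscale unif_nz)
    \<comment> \<open>Representatives of L/\<pi>L need not lie in \<open>M\<close>. Each class that
      meets \<open>M\<close> gets a new representative inside \<open>M\<close>; the others get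
      0.\<close>
    define ch where "ch r = (if \<exists>x\<in>M. x - r \<in> lscale unif L then SOME x. x \<in> M \<and> x - r \<in> lscale unif L else 0)" for r
    have ch: "ch r \<in> M \<and> ch r - r \<in> lscale unif L" if "x \<in> M" "x - r \<in> lscale unif L" for x r
      using someI[of "\<lambda>x. x \<in> M \<and> x - r \<in> lscale unif L" x] that by (auto simp: ch_def)
    have "ch r \<in> M" for r
    proof (cases "\<exists>x\<in>M. x - r \<in> lscale unif L")
      case True
      then show ?thesis using ch by blast
    next
      case False
      then show ?thesis using omod_0[OF L(2)] by (simp add: ch_def)
    qed
    moreover have "\<exists>c. (\<forall>s\<in>ch ` R. c s \<in> integers) \<and> y - (\<Sum>s\<in>ch ` R. c s *s s) \<in> lscale unif L" if y: "y \<in> M" for y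
    proof -
      obtain r where r: "r \<in> R" "y - r \<in> lscale unif L" using R y L by blast
      have "(y - r) - (ch r - r) \<in> lscale unif L" using r ch[OF y r(2)] omod_diff[OF oL] by blast
      then have d: "y - ch r \<in> lscale unif L" by simp
      have "(\<Sum>s\<in>ch ` R. (if s = ch r then 1 else 0) *s s) = (\<Sum>s\<in>ch ` R. if s = ch r then s else 0)"
        by (rule sum.cong) auto
      also have "\<dots> = ch r" using R r by simp
      finally have "y - (\<Sum>s\<in>ch ` R. (if s = ch r then 1 else 0) *s s) \<in> lscale unif L" using d by simp
      then show ?thesis by (intro exI[of _ "\<lambda>s. if s = ch r then 1 else 0"]) auto
    qed
    ultimately have "gen (ch ` R)" unfolding gen_def using R(1) by blast
    then show ?thesis by blast
  qed
  obtain S where S: "gen S" and min: "\<And>T. gen T \<Longrightarrow> card S \<le> card T"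
    using ex_has_least_nat[of gen _ card] ex by blast
  have fin: "finite S" and SM: "S \<subseteq> M" using S by (auto simp: gen_def)
  have indep: "vge 1 (c s)" if c: "\<And>s. s \<in> S \<Longrightarrow> c s \<in> integers" and rel: "(\<Sum>s\<in>S. c s *s s) \<in> lscale unif L" and s: "s \<in> S" for c s
  proof (rule ccontr)
    assume "\<not> vge 1 (c s)"
    then have u: "c s \<noteq> 0" "vord (c s) = 0" using integer_unit_cases[OF c[OF s]] by blast+
    have "gen (S - {s})"
      unfolding gen_def
    proof (intro conjI ballI)
      fix y assume "y \<in> M"
      then obtain d where d: "\<And>s. s \<in> S \<Longrightarrow> d s \<in> integers" "y - (\<Sum>s\<in>S. d s *s s) \<in> lscale unif L"
        using S unfolding gen_def by blast
      \<comment> \<open>Subtracting \<open>q\<close> times the relation kills the coefficient of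
        \<open>s\<close>, so \<open>S - {s}\<close> still generates.\<close>
      define q where "q = d s * inverse (c s)"
      have q: "q \<in> integers" using d s u by (auto simp: q_def intro!: integers_mult inverse_unit_integer)
      let ?e = "\<lambda>s. d s - q * c s"
      have "(\<Sum>s\<in>S. ?e s *s s) = (\<Sum>s\<in>S. d s *s s) - q *s (\<Sum>s\<in>S. c s *s s)"
        by (simp add: vec.scale_left_diff_distrib sum_subtractf vec.scale_sum_right)
      then have eq: "y - (\<Sum>s\<in>S. ?e s *s s) = (y - (\<Sum>s\<in>S. d s *s s)) + q *s (\<Sum>s\<in>S. c s *s s)"
        by simp
      have "(y - (\<Sum>s\<in>S. d s *s s)) + q *s (\<Sum>s\<in>S. c s *s s) \<in> lscale unif L"
        by (rule omod_add[OF oL d(2) omod_scale[OF oL q rel]])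
      then have "y - (\<Sum>s\<in>S. ?e s *s s) \<in> lscale unif L" unfolding eq .
      moreover have "?e s = 0" using u by (simp add: q_def)
      then have "(\<Sum>s\<in>S. ?e s *s s) = (\<Sum>s\<in>S - {s}. ?e s *s s)"
        using sum.remove[OF fin s, of "\<lambda>s. ?e s *s s"] by simp
      moreover have "\<forall>s\<in>S - {s}. ?e s \<in> integers" using d(1) c q by (auto intro!: integers_diff integers_mult)
      ultimately show "\<exists>e. (\<forall>s\<in>S - {s}. e s \<in> integers) \<and> y - (\<Sum>s\<in>S - {s}. e s *s s) \<in> lscale unif L"
        by (intro exI[of _ ?e]) simp
    qed (use fin SM in auto)
    then have "card S \<le> card (S - {s})" by (rule min)
    then show False using card_Diff1_less[OF fin s] by simp
  qed
  obtain x where x: "bij_betw x {..<card S} S" using fin ex_bij_betw_nat_finite[of S] by (auto simp: atLeast0LessThan)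
  have tr: "(\<Sum>i<card S. c (x i) *s x i) = (\<Sum>s\<in>S. c s *s s)" for c
    by (rule sum.reindex_bij_betw[OF x])
  have xi: "i < card S \<Longrightarrow> x i \<in> S" for i using x by (auto simp: bij_betw_def)
  have "has_residue_dim L M (card S)"
    unfolding has_residue_dim_def vge_1_iff[symmetric]
  proof (intro exI[of _ x] conjI allI impI ballI)
    fix i assume "i < card S" then show "x i \<in> M" using xi SM by blast
  next
    fix y assume "y \<in> M"
    then obtain d where d: "\<And>s. s \<in> S \<Longrightarrow> d s \<in> integers" "y - (\<Sum>s\<in>S. d s *s s) \<in> lscale unif L"
      using S unfolding gen_def by blast
    then show "\<exists>c. (\<forall>i<card S. c i \<in> integers) \<and> y - (\<Sum>i<card S. c i *s x i) \<in> lscale unif L"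
      using xi by (intro exI[of _ "\<lambda>i. d (x i)"]) (simp add: tr)
  next
    fix c i assume c: "(\<forall>i<card S. c i \<in> integers) \<and> (\<Sum>i<card S. c i *s x i) \<in> lscale unif L" and i: "i < card S"
    let ?c = "\<lambda>s. c (inv_into {..<card S} x s)"
    have e: "inv_into {..<card S} x (x j) = j" if "j < card S" for j
      using x that by (simp add: bij_betw_def inv_into_f_f)
    have "(\<Sum>s\<in>S. ?c s *s s) = (\<Sum>i<card S. c i *s x i)"
      unfolding tr[symmetric] by (rule sum.cong) (auto simp: e)
    moreover have "?c s \<in> integers" if "s \<in> S" for s
      using c that x e by (metis (no_types, lifting) bij_betw_def imageE lessThan_iff)
    ultimately have "vge 1 (?c (x i))" using c xi[OF i] indep[of ?c "x i"] by simp
    then show "vge 1 (c i)" using e i by simp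
  qed
  then show ?thesis by blast
qed

lemma residue_dim_image:
  assumes f: "linaut f" and d: "has_residue_dim L M t"
  shows "has_residue_dim (f ` L) (f ` M) t"
proof -
  obtain x where x: "\<And>i. i < t \<Longrightarrow> x i \<in> M"
      "\<And>y. y \<in> M \<Longrightarrow> \<exists>c. (\<forall>i<t. c i \<in> integers) \<and> y - (\<Sum>i<t. c i *s x i) \<in> lscale unif L"
      "\<And>c i. (\<forall>i<t. c i \<in> integers) \<Longrightarrow> (\<Sum>i<t. c i *s x i) \<in> lscale unif L \<Longrightarrow> i < t \<Longrightarrow> vge 1 (c i)"
    using d unfolding has_residue_dim_def vge_1_iff[symmetric] by blast
  have s: "(\<Sum>i<t. c i *s f (x i)) = f (\<Sum>i<t. c i *s x i)" for c
    using f by (simp add: linaut_sum linaut_def)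
  show ?thesis unfolding has_residue_dim_def vge_1_iff[symmetric]
  proof (intro exI[of _ "\<lambda>i. f (x i)"] conjI allI impI ballI)
    fix y assume "y \<in> f ` M"
    then obtain z where z: "z \<in> M" "y = f z" by blast
    then obtain c where "\<forall>i<t. c i \<in> integers" "z - (\<Sum>i<t. c i *s x i) \<in> lscale unif L" using x(2) by blast
    then show "\<exists>c. (\<forall>i<t. c i \<in> integers) \<and> y - (\<Sum>i<t. c i *s f (x i)) \<in> lscale unif (f ` L)"
      using f z(2) by (intro exI[of _ c]) (simp add: s linaut_diff[symmetric] linaut_lscale[symmetric] linaut_mem)
  next
    fix c i assume c: "(\<forall>i<t. c i \<in> integers) \<and> (\<Sum>i<t. c i *s f (x i)) \<in> lscale unif (f ` L)" and i: "i < t"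
    then show "vge 1 (c i)" using x(3)[of c i] f by (simp add: s linaut_lscale[symmetric] linaut_mem)
  qed (use x in auto)
qed

lemma arrow_type_eq:
  assumes r: "arrow_rep e L M" and d: "has_residue_dim L M t"
  shows "arrow_type e = t"
  unfolding arrow_type_def
proof (rule the_equality)
  fix u assume "\<exists>L M. arrow_rep e L M \<and> has_residue_dim L M u"
  then obtain L' M' where *: "arrow_rep e L' M'" "has_residue_dim L' M' u" by blast
  then obtain c where c: "c \<noteq> 0" "L' = lscale c L" "M' = lscale c M" using arrow_rep_sim[OF r] by blast
  have "has_residue_dim L' M' t" using residue_dim_image[OF linaut_scale[OF c(1)] d] c by (simp add: lscale_image)
  then show "u = t" using *
    by (intro residue_dim_unique[of L' M']) (auto simp: arrow_rep_def lattice_omod)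
qed (use assms in blast)

lemma arrow_type_iff:
  assumes r: "arrow_rep e L M"
  shows "arrow_type e = t \<longleftrightarrow> has_residue_dim L M t"
  using arrow_type_eq[OF r] residue_dim_exists[of L M] r by (auto simp: arrow_rep_def lattice_omod)

lemma residue_dim_1_iff:
  assumes L: "omod L" "omod M" "M \<subseteq> L" "lscale unif L \<subseteq> M"
  shows "has_residue_dim L M 1 \<longleftrightarrow> (\<exists>x\<in>L - lscale unif L. M = cyc x (lscale unif L))"
proof
  have oL: "omod (lscale unif L)" using L omod_lscale by blast
  assume "has_residue_dim L M 1"
  then obtain x where x: "x (0::nat) \<in> M"
      "\<And>y. y \<in> M \<Longrightarrow> \<exists>c. c (0::nat) \<in> integers \<and> y - c 0 *s x 0 \<in> lscale unif L"
      "\<And>c. c (0::nat) \<in> integers \<Longrightarrow> c 0 *s x 0 \<in> lscale unif L \<Longrightarrow> vge 1 (c 0)"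
    unfolding has_residue_dim_def vge_1_iff[symmetric] by auto
  have "x 0 \<notin> lscale unif L" using x(3)[of "\<lambda>_. 1"] by (auto simp: vge_def)
  moreover have "M \<subseteq> cyc (x 0) (lscale unif L)" using x(2) unfolding cyc_def by blast
  moreover have "cyc (x 0) (lscale unif L) \<subseteq> M" using x(1) L cyc_subset[OF oL L(2)] by blast
  ultimately show "\<exists>x\<in>L - lscale unif L. M = cyc x (lscale unif L)" using x(1) L by blast
next
  have oL: "omod (lscale unif L)" using L omod_lscale by blast
  assume "\<exists>x\<in>L - lscale unif L. M = cyc x (lscale unif L)"
  then obtain x where x: "x \<in> L" "x \<notin> lscale unif L" "M = cyc x (lscale unif L)" by blast
  have "vge 1 c" if "c \<in> integers" "c *s x \<in> lscale unif L" for c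
    using that x(2) omod_unit_iff[OF oL] integer_unit_cases by blast
  then show "has_residue_dim L M 1"
    unfolding has_residue_dim_def vge_1_iff[symmetric]
  proof (intro exI[of _ "\<lambda>_. x"] conjI allI impI ballI)
    show "x \<in> M" using cyc_self[OF oL] x by simp
  next
    fix y assume "y \<in> M"
    then obtain a where "a \<in> integers" "y - a *s x \<in> lscale unif L" using x by (auto simp: cyc_def)
    then show "\<exists>c. (\<forall>i<1. c i \<in> integers) \<and> y - (\<Sum>i<1::nat. c i *s x) \<in> lscale unif L"
      by (intro exI[of _ "\<lambda>_. a"]) simp
  qed (use \<open>\<And>c. c \<in> integers \<Longrightarrow> c *s x \<in> lscale unif L \<Longrightarrow> vge 1 c\<close> in simp)
qed

lemma arrow_type_1_iff:
  assumes "arrow_rep e L M"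
  shows "arrow_type e = 1 \<longleftrightarrow> (\<exists>x\<in>L - lscale unif L. M = cyc x (lscale unif L))"
  unfolding arrow_type_iff[OF assms] using assms
  by (intro residue_dim_1_iff) (auto simp: arrow_rep_def lattice_omod)

lemma arrow_prec_iff:
  assumes "arrow_rep e' L M'" "arrow_rep e L M"
  shows "arrow_prec e' e \<longleftrightarrow> M' \<subseteq> M"
proof -
  have c: "coset_space L M' \<subseteq> coset_space L M \<longleftrightarrow> M' \<subseteq> M" if "arrow_rep e L M" for L M M'
    using that by (intro coset_space_subset_iff) (auto simp: arrow_rep_def lattice_omod)
  have "M' \<subseteq> M" if r: "arrow_rep e' L1 M1'" "arrow_rep e L1 M1" "M1' \<subseteq> M1" for L1 M1' M1
  proof -
    obtain c where c: "c \<noteq> 0" "L1 = lscale c L" "M1 = lscale c M" using arrow_rep_sim[OF assms(2) r(2)] .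
    then have "M1' = lscale c M'"
      using arrow_rep_unique[OF r(1), of "lscale c M'"] assms(1) arrow_rep_lscale by blast
    then show ?thesis using c r(3) lscale_subset_iff by blast
  qed
  then show ?thesis unfolding arrow_prec_def using c assms by blast
qed


section \<open>Primitive vectors and lines\<close>

text \<open>Write x = a z modulo N. A non-unit \<open>a\<close> would put \<open>x\<close> into
  \<open>N\<close>, so \<open>a\<close> is a unit and \<open>x\<close>, \<open>z\<close> generate
  the same module over \<open>N\<close>. For N = \<pi>L this says that a point of the projective
  space of L/\<pi>L is determined by any of its nonzero vectors.\<close>

lemma cyc_eq:
  assumes N: "omod N" "x \<in> cyc z N" "x \<notin> N" "unif *s z \<in> N"
  shows "cyc x N = cyc z N"
proof -
  obtain a where a: "a \<in> integers" "x - a *s z \<in> N" using N(2) by (auto simp: cyc_def)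
  from a(1) show ?thesis
  proof (cases rule: integer_unit_cases)
    case 1
    have "inverse a *s (a *s z - x) \<in> N"
      using omod_minus[OF N(1) a(2)] 1 by (intro omod_scale[OF N(1)] inverse_unit_integer) auto
    then have "z - inverse a *s x \<in> N" using 1 by (simp add: vec.scale_right_diff_distrib)
    then have "z \<in> cyc x N" using 1 inverse_unit_integer unfolding cyc_def by blast
    then have "cyc z N \<subseteq> cyc x N" using cyc_subset[OF N(1) omod_cyc[OF N(1)]] cyc_superset by blast
    moreover have "cyc x N \<subseteq> cyc z N" using N(2) cyc_subset[OF N(1) omod_cyc[OF N(1)]] cyc_superset by blast
    ultimately show ?thesis by blast
  next
    case 2
    then obtain b where b: "b \<in> integers" "a = unif * b" unfolding vge_1_iff by blast
    have "b *s (unif *s z) \<in> N" by (rule omod_scale[OF N(1) b(1) N(4)])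
    then have "a *s z \<in> N" using b by (simp add: mult.commute)
    then have "x \<in> N" using omod_add[OF N(1) a(2)] by fastforce
    then show ?thesis using N(3) by blast
  qed
qed

text \<open>If a x is in L with \<open>a\<close> of negative valuation, then x lies in \<pi>L. So
  for a vector \<open>x\<close> that is primitive in \<open>L\<close>, that is, outside \<pi>L, the
  intersection of \<open>L\<close> with the line K x is O x.\<close>

lemma prim_scale_iff:
  assumes "omod L" "x \<in> L - lscale unif L"
  shows "a *s x \<in> L \<longleftrightarrow> a \<in> integers"
proof
  assume a: "a *s x \<in> L"
  show "a \<in> integers"
  proof (rule ccontr)
    assume "a \<notin> integers"
    then have a0: "a \<noteq> 0" "vge 1 (inverse a)" by (auto simp: integers_def vge_def vord_inverse)
    then obtain b where b: "b \<in> integers" "inverse a = unif * b" unfolding vge_1_iff by blast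
    have "b *s (a *s x) \<in> L" by (rule omod_scale[OF assms(1) b(1) a])
    then have "unif *s (b *s (a *s x)) \<in> lscale unif L" by (simp only: scale_mem_lscale[OF unif_nz])
    moreover have eq: "unif *s (b *s (a *s x)) = (inverse a * a) *s x" unfolding b(2) by simp
    ultimately have "(inverse a * a) *s x \<in> lscale unif L" unfolding eq by blast
    then show False using a0 assms by simp
  qed
qed (use assms omod_scale in blast)

lemma prim_scale_prim_iff:
  assumes "omod L" "x \<in> L - lscale unif L"
  shows "a *s x \<in> L - lscale unif L \<longleftrightarrow> a \<noteq> 0 \<and> vord a = 0"
proof -
  have "a *s x \<in> lscale unif L \<longleftrightarrow> inverse unif * a \<in> integers"
    using prim_scale_iff[OF assms, of "inverse unif * a"] by (simp add: mem_lscale)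
  also have "\<dots> \<longleftrightarrow> vge 1 a" by (simp add: integers_iff_vge vge_times_iff vord_inverse vord_unif)
  finally show ?thesis using prim_scale_iff[OF assms, of a] by (auto simp: integers_iff_vge vge_def)
qed

lemma prim_nonzero: "omod L \<Longrightarrow> x \<in> L - lscale unif L \<Longrightarrow> x \<noteq> 0"
  using omod_0[OF omod_lscale] by auto

lemma lattice_prim_ex:
  fixes L :: "('k::nonarch_local_field ^ 'n::finite) set"
  assumes L: "L \<in> lattices" "x \<noteq> 0"
  obtains c where "c \<noteq> 0" "c *s x \<in> L - lscale unif L"
proof -
  obtain m n where mn: "oball m \<subseteq> L" "L \<subseteq> oball n" using L unfolding lattices_iff by blast
  obtain k where k: "x \<in> oball k" using oball_union by blast
  obtain j where j: "x \<notin> oball j" using oball_inter[OF L(2)] by blast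
  \<comment> \<open>The exponents are counted from \<open>n - j\<close>, where membership still
    fails: x is outside \<pi>^j O^r and L is contained in \<pi>^n O^r. The least good exponent then
    gives a vector of \<open>L\<close> outside \<pi>L.\<close>
  define P where "P i \<longleftrightarrow> unif powi (n - j + int i) *s x \<in> L" for i :: nat
  have "x \<in> oball (m - (n - j + int (nat (m - k - n + j))))"
    using k oball_mono[of "m - (n - j + int (nat (m - k - n + j)))" k] by auto
  then have "P (nat (m - k - n + j))"
    unfolding P_def using mn(1) by (intro subsetD[OF mn(1)]) (simp only: oball_scale_iff[OF unif_powi_nonzero] vord_powi)
  then obtain i where i: "P i" "\<And>i'. i' < i \<Longrightarrow> \<not> P i'" using exists_least_iff[of P] by blast
  have "\<not> P 0"
  proof
    assume "P 0"
    then have "unif powi (n - j) *s x \<in> oball n" using mn(2) by (auto simp: P_def)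
    then show False using j unfolding oball_scale_iff[OF unif_powi_nonzero] vord_powi by simp
  qed
  then have "i \<noteq> 0" using i(1) by metis
  then have "\<not> P (i - 1)" using i(2) by simp
  moreover have "inverse unif * (unif :: 'k) powi (n - j + int i) = unif powi (n - j + int (i - 1))"
  proof -
    have "n - j + int i = (n - j + int (i - 1)) + 1" using \<open>i \<noteq> 0\<close> by simp
    then have "unif powi (n - j + int i) = unif powi (n - j + int (i - 1)) * (unif :: 'k)"
      by (simp only: power_int_add_1[OF disjI1[OF unif_nz]])
    then show ?thesis by (simp only:) (simp add: field_simps)
  qed
  ultimately have "unif powi (n - j + int i) *s x \<notin> lscale unif L"
    by (simp add: mem_lscale P_def)
  then show ?thesis using i(1) by (intro that[of "unif powi (n - j + int i)"]) (auto simp: P_def)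
qed

abbreviation line :: "'k::nonarch_local_field ^ 'n::finite \<Rightarrow> ('k ^ 'n) set" where
  "line x \<equiv> vec.span {x}"

lemma mem_line: "y \<in> line x \<longleftrightarrow> (\<exists>a. y = a *s x)"
  by (auto simp: vec.span_singleton)

lemma lines_eq: "lines = line ` (- {0})"
proof (intro equalityI subsetI)
  fix G :: "('a ^ 'b) set" assume "G \<in> lines"
  then have G: "vec.subspace G" "vec.dim G = 1" by (auto simp: lines_def)
  obtain B where B: "B \<subseteq> G" "vec.independent B" "G \<subseteq> vec.span B" "card B = vec.dim G"
    using vec.basis_exists[of G] by blast
  then obtain x where x: "B = {x}" using G(2) by (metis card_1_singletonE)
  have "x \<noteq> 0" using B(2) x by (metis insertI1 vec.dependent_zero)
  moreover have "G = line x" using B x vec.span_minimal[OF B(1) G(1)] by auto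
  ultimately show "G \<in> line ` (- {0})" by blast
next
  fix G :: "('a ^ 'b) set" assume "G \<in> line ` (- {0})"
  then obtain x where x: "x \<noteq> 0" "G = line x" by auto
  then have "vec.independent {x}" by (simp add: vec.dependent_single)
  then have "vec.dim G = 1" using vec.dim_eq_card_independent[of "{x}"] x by (simp add: vec.dim_span)
  then show "G \<in> lines" using x by (simp add: lines_def vec.subspace_span)
qed

lemma line_scale:
  assumes "c \<noteq> 0" shows "line (c *s x) = line x"
proof (intro equalityI subsetI)
  fix y assume "y \<in> line x"
  then obtain a where "y = a *s x" by (auto simp: mem_line)
  then show "y \<in> line (c *s x)" unfolding mem_line using assms by (intro exI[of _ "a / c"]) simp
qed (auto simp: mem_line)

lemma line_eq_iff: assumes "y \<noteq> 0" shows "line x = line y \<longleftrightarrow> (\<exists>c. c \<noteq> 0 \<and> y = c *s x)"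
proof
  assume "line x = line y"
  then have "y \<in> line x" using mem_line[of y y] by (metis vec.scale_one)
  then show "\<exists>c. c \<noteq> 0 \<and> y = c *s x" using assms unfolding mem_line by auto
qed (auto simp: line_scale)

lemma lines_prim:
  assumes "L \<in> lattices"
  shows "lines = line ` (L - lscale unif L)"
proof -
  have "line x \<in> line ` (L - lscale unif L)" if x: "x \<noteq> 0" for x
  proof -
    obtain c where "c \<noteq> 0" "c *s x \<in> L - lscale unif L" using lattice_prim_ex[OF assms x] .
    then show ?thesis using line_scale[of c x] by (metis imageI)
  qed
  then show ?thesis using prim_nonzero[OF lattice_omod[OF assms]] unfolding lines_eq by blast
qed

lemma line_Int_subset_iff:
  assumes L: "omod L" "x \<in> L - lscale unif L" and M: "omod M"
  shows "L \<inter> line x \<subseteq> M \<longleftrightarrow> x \<in> M"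
proof
  assume "L \<inter> line x \<subseteq> M"
  moreover have "x \<in> line x" unfolding mem_line by (rule exI[of _ 1]) simp
  ultimately show "x \<in> M" using L by blast
next
  assume "x \<in> M"
  then show "L \<inter> line x \<subseteq> M" using prim_scale_iff[OF L] omod_scale[OF M] by (auto simp: mem_line)
qed

text \<open>The set \<open>lines_of_arrow e\<close>, with a meaning for arrows of every type.\<close>

definition lines_in :: "('k::nonarch_local_field, 'n::finite) arrow \<Rightarrow> ('k ^ 'n) set set" where
  "lines_in e = {G \<in> lines. \<exists>L M. arrow_rep e L M \<and> L \<inter> G \<subseteq> M}"

lemma lscale_line: assumes "c \<noteq> 0" shows "lscale c (line x) = line x"
proof (intro equalityI subsetI)
  fix y assume "y \<in> line x"
  then obtain a where "y = a *s x" by (auto simp: mem_line)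
  then show "y \<in> lscale c (line x)" using assms by (auto simp: mem_lscale mem_line)
qed (auto simp: lscale_def mem_line)

text \<open>A line is stable under scaling, so the condition
  \<open>L \<inter> G \<subseteq> M\<close> does not depend on the chosen representatives of
  \<open>e\<close>, and it can be tested on one primitive vector of the line.\<close>

lemma lines_in_iff:
  assumes r: "arrow_rep e L M" and x: "x \<in> L - lscale unif L"
  shows "line x \<in> lines_in e \<longleftrightarrow> x \<in> M"
proof -
  have oL: "L \<in> lattices" "omod L" "omod M" using r by (auto simp: arrow_rep_def lattice_omod)
  have "L \<inter> line x \<subseteq> M" if r': "arrow_rep e L' M'" "L' \<inter> line x \<subseteq> M'" for L' M'
  proof -
    obtain c where c: "c \<noteq> 0" "L' = lscale c L" "M' = lscale c M" using arrow_rep_sim[OF r r'(1)] .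
    then have "L' \<inter> line x = lscale c (L \<inter> line x)" using lscale_inter[OF c(1), of L "line x"] lscale_line[OF c(1)] by metis
    then show ?thesis using r' c lscale_subset_iff by metis
  qed
  moreover have "line x \<in> lines" using lines_prim[OF oL(1)] x by blast
  ultimately show ?thesis
    unfolding lines_in_def line_Int_subset_iff[OF oL(2) x oL(3), symmetric] using r by blast
qed

lemma lines_in_rep:
  assumes r: "arrow_rep e L M"
  shows "lines_in e = line ` (M - lscale unif L)"
proof -
  have l: "lines = line ` (L - lscale unif L)" and MsubL: "M \<subseteq> L"
    using r lines_prim by (auto simp: arrow_rep_def)
  have "lines_in e \<subseteq> lines" by (auto simp: lines_in_def)
  then show ?thesis using lines_in_iff[OF r] MsubL unfolding l by blast
qed

lemma lscale_plus:
  "{u + y | u y. u \<in> lscale c A \<and> y \<in> lscale c B} = lscale c {u + y | u y. u \<in> A \<and> y \<in> B}"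
proof (intro equalityI subsetI)
  fix z assume "z \<in> {u + y | u y. u \<in> lscale c A \<and> y \<in> lscale c B}"
  then obtain u y where "z = c *s u + c *s y" "u \<in> A" "y \<in> B" by (auto simp: lscale_def)
  then show "z \<in> lscale c {u + y | u y. u \<in> A \<and> y \<in> B}"
    unfolding lscale_def vec.scale_right_distrib[symmetric] by blast
next
  fix z assume "z \<in> lscale c {u + y | u y. u \<in> A \<and> y \<in> B}"
  then obtain u y where "z = c *s (u + y)" "u \<in> A" "y \<in> B" by (auto simp: lscale_def)
  then show "z \<in> {u + y | u y. u \<in> lscale c A \<and> y \<in> lscale c B}"
    unfolding lscale_def vec.scale_right_distrib by blast
qed

text \<open>The line of a primitive \<open>x\<close> is pointed to iff O x + \<pi>L is similar to
  \<open>M\<close>. By \<open>between_unique\<close> similarity is equality, and equality means x in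
  M because M/\<pi>L is generated by one vector.\<close>

lemma lines_of_arrow_type1:
  assumes r: "arrow_rep e L M" and t: "arrow_type e = 1"
  shows "lines_of_arrow e = lines_in e"
proof -
  let ?N = "lscale unif L"
  have oL: "L \<in> lattices" "omod L" "omod M" "M \<subset> L" and e: "e = arr L M"
    using r by (simp_all add: arrow_rep_def lattice_omod prod_eq_iff)
  have oN: "omod ?N" using oL omod_lscale by blast
  obtain z where z: "z \<in> L - ?N" "M = cyc z ?N" using t arrow_type_1_iff[OF r] by blast
  have "points_to e (line x) \<longleftrightarrow> x \<in> M" if x: "x \<in> L - ?N" for x
  proof -
    have set_eq: "{u + y | u y. u \<in> L \<inter> line x \<and> y \<in> ?N} = cyc x ?N"
    proof (intro equalityI subsetI)
      fix w assume "w \<in> {u + y | u y. u \<in> L \<inter> line x \<and> y \<in> ?N}"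
      then obtain a y where "w = a *s x + y" "a *s x \<in> L" "y \<in> ?N" by (auto simp: mem_line)
      then show "w \<in> cyc x ?N" using prim_scale_iff[OF oL(2) x, of a] by (auto simp: cyc_def intro!: bexI[of _ a])
    next
      fix w assume "w \<in> cyc x ?N"
      then obtain a where a: "a \<in> integers" "w - a *s x \<in> ?N" by (auto simp: cyc_def)
      then have "w = a *s x + (w - a *s x)" "a *s x \<in> L \<inter> line x"
        using prim_scale_iff[OF oL(2) x] by (auto simp: mem_line)
      then show "w \<in> {u + y | u y. u \<in> L \<inter> line x \<and> y \<in> ?N}" using a(2) by blast
    qed
    have "points_to e (line x) \<longleftrightarrow> sim_class M = sim_class (cyc x ?N)"
    proof
      assume "points_to e (line x)"
      then obtain L1 where L1: "L1 \<in> lattices" "sim_class L = sim_class L1"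
        "sim_class M = sim_class {u + y | u y. u \<in> L1 \<inter> line x \<and> y \<in> lscale unif L1}"
        unfolding points_to_def e by auto
      obtain c where c: "c \<noteq> 0" "L1 = lscale c L" using L1(2) sim_class_eq_iff by blast
      have i: "L1 \<inter> line x = lscale c (L \<inter> line x)" using lscale_inter[OF c(1), of L "line x"] lscale_line[OF c(1)] c by metis
      have n: "lscale unif L1 = lscale c ?N" using c by (simp add: lscale_lscale mult.commute)
      have "{u + y | u y. u \<in> L1 \<inter> line x \<and> y \<in> lscale unif L1} = lscale c {u + y | u y. u \<in> L \<inter> line x \<and> y \<in> ?N}"
        unfolding i n by (rule lscale_plus)
      then show "sim_class M = sim_class (cyc x ?N)" using L1(3) c(1) set_eq by simp
    next
      assume "sim_class M = sim_class (cyc x ?N)"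
      then show "points_to e (line x)" unfolding points_to_def e using oL(1) set_eq by auto
    qed
    also have "\<dots> \<longleftrightarrow> M = cyc x ?N"
    proof
      assume s: "sim_class M = sim_class (cyc x ?N)"
      have sub: "cyc x ?N \<subseteq> L" using cyc_subset[OF oN oL(2)] x lscale_unif_subset[OF oL(2)] by auto
      have "e \<in> arrows" using r arrow_rep_arrow by blast
      \<comment> \<open>Otherwise the terminus of \<open>e\<close> would be the class of
        \<open>L\<close>, making \<open>e\<close> a loop.\<close>
      then have "cyc x ?N \<noteq> L" using s e arrows_irrefl by metis
      moreover have "?N \<subset> cyc x ?N" using cyc_superset[of ?N x] cyc_self[OF oN, of x] x by blast
      ultimately have "cyc x ?N \<in> betw L" using sub omod_cyc[OF oN] by (auto simp: betw_def)
      then have "arrow_rep e L (cyc x ?N)" using arrow_rep_arr[OF oL(1)] s e by simp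
      then show "M = cyc x ?N" using r arrow_rep_unique by blast
    qed simp
    also have "\<dots> \<longleftrightarrow> x \<in> M"
    proof
      assume "x \<in> M"
      then show "M = cyc x ?N" using cyc_eq[OF oN, of x z] z x by simp
    qed (use cyc_self[OF oN] in auto)
    finally show ?thesis .
  qed
  then have "line x \<in> lines_of_arrow e \<longleftrightarrow> line x \<in> lines_in e" if "x \<in> L - ?N" for x
    using lines_in_iff[OF r that] that lines_prim[OF oL(1)] by (auto simp: lines_of_arrow_def)
  moreover have "lines_of_arrow e \<subseteq> line ` (L - ?N)" "lines_in e \<subseteq> line ` (L - ?N)"
    using lines_prim[OF oL(1)] by (auto simp: lines_of_arrow_def lines_in_def)
  ultimately show ?thesis by blast
qed

text \<open>One vector cannot generate L/\<pi>L once r \<ge> 2. After transport to O^r, two standard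
  basis vectors that are both multiples of \<open>x\<close> modulo \<pi> lead to a contradiction. It
  guarantees that every primitive vector defines an arrow.\<close>

lemma cyc_proper:
  fixes L :: "('k::nonarch_local_field ^ 'n::finite) set"
  assumes rank: "2 \<le> CARD('n)" and L: "L \<in> lattices"
  shows "cyc x (lscale unif L) \<noteq> L"
proof -
  have std: "cyc x (oball 1) \<noteq> oball 0" for x :: "'k ^ 'n"
  proof
    assume eq: "cyc x (oball 1) = oball 0"
    have "\<not> is_singleton (UNIV :: 'n set)" using rank by (simp add: is_singleton_altdef)
    then obtain i j :: 'n where ij: "i \<noteq> j" by (metis UNIV_I is_singletonI' empty_iff)
    have ax: "axis k 1 \<in> cyc x (oball 1)" for k unfolding eq oball_axis by (simp add: vge_def)
    obtain a where a: "a \<in> integers" "axis i 1 - a *s x \<in> oball 1" using ax[of i] by (auto simp: cyc_def)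
    obtain b where b: "b \<in> integers" "axis j 1 - b *s x \<in> oball 1" using ax[of j] by (auto simp: cyc_def)
    have 1: "vge 1 (1 - a * x $ i)" "vge 1 (a * x $ j)" "vge 1 (1 - b * x $ j)" "vge 1 (b * x $ i)"
    proof -
      have "vge 1 ((axis i 1 - a *s x) $ i)" "vge 1 ((axis i 1 - a *s x) $ j)"
        "vge 1 ((axis j 1 - b *s x) $ j)" "vge 1 ((axis j 1 - b *s x) $ i)"
        using a b by (simp_all only: oball_def mem_Collect_eq)
      then show "vge 1 (1 - a * x $ i)" "vge 1 (a * x $ j)" "vge 1 (1 - b * x $ j)" "vge 1 (b * x $ i)"
        using ij by (auto simp: axis_def)
    qed
    have "vge 1 ((a * x $ j) * (b * x $ i))" using vge_mult[OF 1(2,4)] by (rule vge_mono) simp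
    moreover have "vge 0 (1 - b * x $ j)" using 1(3) by (rule vge_mono) simp
    then have "vge 0 (b * x $ j)" using vge_diff[of 0 1 "1 - b * x $ j"] by (simp add: vge_def)
    then have "vge 1 ((1 - a * x $ i) * (b * x $ j))" using vge_mult[OF 1(1)] by fastforce
    \<comment> \<open>The three terms add up to 1, and each of them is divisible by \<pi>.\<close>
    ultimately have "vge 1 ((1 - b * x $ j) + (1 - a * x $ i) * (b * x $ j) + (a * x $ j) * (b * x $ i))"
      using 1(3) vge_add by blast
    then show False by (simp add: algebra_simps) (simp add: vge_def)
  qed
  obtain f where f: "linaut f" "L = f ` std_lattice" using lattice_linaut[OF L] .
  obtain y where y: "x = f y" using f(1) unfolding linaut_def by (metis bij_pointE)
  have l: "lscale unif L = f ` oball 1"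
    using f by (simp add: linaut_lscale[symmetric] std_lattice_oball lscale_oball vord_unif)
  have "cyc x (lscale unif L) = f ` cyc y (oball 1)" unfolding l y by (rule linaut_cyc[OF f(1), symmetric])
  then show ?thesis using std[of y] f
    by (metis linaut_image_inv(1) std_lattice_oball)
qed

section \<open>Cells of lines\<close>

abbreviation prim :: "('k::nonarch_local_field ^ 'n::finite) set" where
  "prim \<equiv> oball 0 - oball 1"

text \<open>For primitive \<open>x\<close> the lattices \<open>Ox + \<pi>\<^sup>n O\<^sup>r\<close> will represent the \<open>n\<close>-special vertices.\<close>

abbreviation tlat :: "nat \<Rightarrow> 'k::nonarch_local_field ^ 'n::finite \<Rightarrow> ('k ^ 'n) set" where
  "tlat n x \<equiv> cyc x (oball (int n))"

definition tlats :: "nat \<Rightarrow> ('k::nonarch_local_field ^ 'n::finite) set set" where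
  "tlats n = tlat n ` prim"

text \<open>Only the vectors of \<open>M\<close> that are primitive in O^r may be used: a tree
  lattice contains some \<pi>^n O^r, hence nonzero vectors of every line.\<close>

definition cell :: "('k::nonarch_local_field ^ 'n::finite) set \<Rightarrow> ('k ^ 'n) set set" where
  "cell M = line ` (M - oball 1)"

lemma unif_std: "lscale unif (oball 0) = (oball 1 :: ('k::nonarch_local_field ^ 'n::finite) set)"
  by (simp add: lscale_oball vord_unif)

lemma lines_std: "lines = line ` (prim :: ('k::nonarch_local_field ^ 'n::finite) set)"
  using lines_prim[OF lattice_oball[of 0]] by (simp add: unif_std)

lemma prim_unit_scale: "x \<in> prim \<Longrightarrow> a *s x \<in> prim \<longleftrightarrow> a \<noteq> 0 \<and> vord a = 0"
  using prim_scale_prim_iff[of "oball 0" x a] by (simp add: unif_std)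

lemma prim_not_0: "x \<in> prim \<Longrightarrow> x \<noteq> 0"
  using omod_0[OF omod_oball] by auto

lemma omod_close: "omod M \<Longrightarrow> x - y \<in> M \<Longrightarrow> x \<in> M \<longleftrightarrow> y \<in> M"
  using omod_add_cancel[of M "x - y" y] by (simp add: add.commute)

lemma prim_close: assumes "x \<in> prim" "1 \<le> n" "x - y \<in> oball n" shows "y \<in> prim"
proof -
  have 1: "x - y \<in> oball 1" "x - y \<in> oball 0" using assms oball_mono[of 1 n] oball_mono[of 0 n] by auto
  then show ?thesis using omod_close[OF omod_oball 1(1)] omod_close[OF omod_oball 1(2)] assms(1) by simp
qed

lemma cyc_unit:
  assumes N: "omod N" "a \<noteq> 0" "vord a = 0" "y - a *s x \<in> N"
  shows "cyc y N = cyc x N"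
proof -
  have "a \<in> integers" using N(3) by (simp add: integers_def)
  then have "y \<in> cyc x N" using N(4) unfolding cyc_def by blast
  moreover have "inverse a *s (a *s x - y) \<in> N"
    using omod_minus[OF N(1) N(4)] N(2,3) by (intro omod_scale[OF N(1)] inverse_unit_integer) auto
  then have "x - inverse a *s y \<in> N" using N by (simp add: vec.scale_right_diff_distrib)
  then have "x \<in> cyc y N" using N inverse_unit_integer unfolding cyc_def by blast
  ultimately show ?thesis
    using cyc_subset[OF N(1) omod_cyc[OF N(1)]] cyc_superset by (intro equalityI) blast+
qed

text \<open>A non-unit coefficient of \<open>x\<close> would put \<open>y\<close> into \<pi>O^r;
  here the error term \<pi>^n O^r must itself lie in \<pi>O^r, whence
  \<open>1 \<le> n\<close>.\<close>

lemma tlat_memD: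
  assumes x: "x \<in> prim" and n: "1 \<le> n" and y: "y \<in> tlat n x" "y \<notin> oball 1"
  obtains a where "a \<noteq> 0" "vord a = 0" "y - a *s x \<in> oball (int n)"
proof -
  obtain a where a: "a \<in> integers" "y - a *s x \<in> oball (int n)" using y by (auto simp: cyc_def)
  from a(1) show ?thesis
  proof (cases rule: integer_unit_cases)
    case 1
    then show ?thesis using a that by blast
  next
    case 2
    have "a *s x \<in> oball (1 + 0)" using 2 x by (intro oball_scale) auto
    moreover have "y - a *s x \<in> oball 1" using a n oball_mono[of 1 "int n"] by auto
    ultimately have "y \<in> oball 1" using omod_add[OF omod_oball, of "y - a *s x" 1 "a *s x"] by simp
    then show ?thesis using y by blast
  qed
qed

lemma tlat_lattice [simp]: "tlat n x \<in> lattices"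
  by (intro lattice_cyc) simp

lemma tlat_self: "x \<in> tlat n x"
  by (simp add: cyc_self)

lemma tlat_subset: "x \<in> prim \<Longrightarrow> tlat n x \<subseteq> oball 0"
  using cyc_subset[of "oball (int n)" "oball 0" x] oball_mono[of 0 "int n"] by simp

lemma tlat_0: "x \<in> prim \<Longrightarrow> tlat 0 x = oball 0"
  using tlat_subset[of x 0] cyc_superset[of "oball 0" x] by auto

lemma tlat_eq:
  assumes "x \<in> prim" "1 \<le> n" "y \<in> tlat n x" "y \<notin> oball 1" shows "tlat n y = tlat n x"
proof -
  obtain a where "a \<noteq> 0" "vord a = 0" "y - a *s x \<in> oball (int n)" using tlat_memD[OF assms] .
  then show ?thesis by (intro cyc_unit) auto
qed

lemma tlats_mem_eq: "M \<in> tlats n \<Longrightarrow> 1 \<le> n \<Longrightarrow> x \<in> M \<Longrightarrow> x \<notin> oball 1 \<Longrightarrow> M = tlat n x"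
  unfolding tlats_def using tlat_eq by blast

lemma tlats_omod: "M \<in> tlats n \<Longrightarrow> omod M"
  by (auto simp: tlats_def intro: omod_cyc)

lemma tlats_bounds: "M \<in> tlats n \<Longrightarrow> oball (int n) \<subseteq> M \<and> M \<subseteq> oball 0"
  unfolding tlats_def using tlat_subset cyc_superset by blast

lemma tlats_prim_ex: "M \<in> tlats n \<Longrightarrow> \<exists>x. x \<in> prim \<and> x \<in> M \<and> M = tlat n x"
  unfolding tlats_def using tlat_self by blast

lemma finite_tlats: "finite (tlats n :: ('k::nonarch_local_field ^ 'n::finite) set set)"
  by (rule finite_subset[OF _ finite_omod_between[OF lattice_oball[of "int n"] lattice_oball[of 0]]])
    (use tlats_omod tlats_bounds in blast)

lemma mem_cell:
  assumes "omod M" "M \<subseteq> oball 0" "x \<in> prim" shows "line x \<in> cell M \<longleftrightarrow> x \<in> M"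
proof
  assume "line x \<in> cell M"
  then obtain y where y: "line x = line y" "y \<in> M" "y \<notin> oball 1" by (auto simp: cell_def)
  then have yp: "y \<in> prim" using assms by auto
  then obtain c where c: "c \<noteq> 0" "y = c *s x" using y line_eq_iff prim_not_0 by blast
  then have "vord c = 0" using prim_unit_scale[OF assms(3)] yp by blast
  then show "x \<in> M" using omod_unit_iff[OF assms(1) c(1)] y c by simp
qed (use assms in \<open>auto simp: cell_def\<close>)

lemma mem_cell_tlats: "M \<in> tlats n \<Longrightarrow> x \<in> prim \<Longrightarrow> line x \<in> cell M \<longleftrightarrow> x \<in> M"
  using mem_cell tlats_omod tlats_bounds by blast

lemma cell_lines: "M \<in> tlats n \<Longrightarrow> cell M \<subseteq> lines"
  unfolding cell_def lines_std using tlats_bounds by blast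

lemma cell_nonempty: "M \<in> tlats n \<Longrightarrow> cell M \<noteq> {}"
  using tlats_prim_ex unfolding cell_def by blast

text \<open>As in every ultrametric space, balls of equal radius that meet coincide: both lattices
  equal \<open>tlat n x\<close> for a primitive generator \<open>x\<close> of
  \<open>G\<close>.\<close>

lemma cell_eqI: "M \<in> tlats n \<Longrightarrow> M' \<in> tlats n \<Longrightarrow> 1 \<le> n \<Longrightarrow> G \<in> cell M \<Longrightarrow> G \<in> cell M' \<Longrightarrow> M = M'"
proof -
  assume M: "M \<in> tlats n" "M' \<in> tlats n" "1 \<le> n" "G \<in> cell M" "G \<in> cell M'"
  then obtain x where x: "x \<in> prim" "G = line x" using cell_lines lines_std by blast
  then have "x \<in> M" "x \<in> M'" using M mem_cell_tlats by blast+
  then show "M = M'" using M tlats_mem_eq x by (metis DiffD2)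
qed

lemma mem_cell_tlat: "x \<in> prim \<Longrightarrow> line x \<in> cell (tlat n x)"
  unfolding cell_def using tlat_self by blast

lemma tlat_tlats: "x \<in> prim \<Longrightarrow> tlat n x \<in> tlats n"
  unfolding tlats_def by blast

lemma lines_cells: "lines = \<Union> (cell ` tlats n)"
proof (intro equalityI subsetI)
  fix G assume "G \<in> lines"
  then obtain x where "x \<in> prim" "G = line x" unfolding lines_std by blast
  then show "G \<in> \<Union> (cell ` tlats n)" using mem_cell_tlat tlat_tlats by blast
qed (use cell_lines in blast)

text \<open>A uniform form of openness: membership of a line is unaffected by changing a primitive
  generator modulo \<pi>^n. For \<open>1 \<le> n\<close> these sets are the unions of cells of level
  \<open>n\<close>; with \<open>n\<close> varying they are exactly the compact-open sets
  (\<open>compact_open_iff\<close>).\<close>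

definition saturated :: "nat \<Rightarrow> ('k::nonarch_local_field ^ 'n::finite) set set \<Rightarrow> bool" where
  "saturated n U \<longleftrightarrow> U \<subseteq> lines \<and>
    (\<forall>x\<in>prim. \<forall>y. x - y \<in> oball (int n) \<longrightarrow> line x \<in> U \<longrightarrow> line y \<in> U)"

lemma saturated_mono:
  assumes "saturated m U" "m \<le> n" shows "saturated n U"
  unfolding saturated_def
proof (intro conjI ballI allI impI)
  show "U \<subseteq> lines" using assms(1) by (simp add: saturated_def)
  fix x y :: "'a ^ 'b" assume *: "x \<in> prim" "x - y \<in> oball (int n)" "line x \<in> U"
  then have "x - y \<in> oball (int m)" using oball_mono[of "int m" "int n"] assms(2) by auto
  then show "line y \<in> U" using assms(1) * unfolding saturated_def by blast
qed

lemma saturated_cell: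
  assumes U: "saturated n U" "1 \<le> n" and M: "M \<in> tlats n" "G \<in> cell M" "G \<in> U"
  shows "cell M \<subseteq> U"
proof
  fix H assume H: "H \<in> cell M"
  obtain x where x: "x \<in> prim" "G = line x" using M cell_lines lines_std by blast
  obtain y where y: "y \<in> prim" "H = line y" using H M cell_lines lines_std by blast
  have "x \<in> M" "y \<in> M" using M H x y mem_cell_tlats by blast+
  then have "y \<in> tlat n x" using tlats_mem_eq M U x by blast
  then obtain a where a: "a \<noteq> 0" "vord a = 0" "y - a *s x \<in> oball (int n)" using tlat_memD[OF x(1) U(2)] y by blast
  have "a *s x - y \<in> oball (int n)" using omod_minus[OF omod_oball a(3)] by simp
  moreover have "a *s x \<in> prim" using prim_unit_scale[OF x(1)] a by blast
  moreover have "line (a *s x) \<in> U" using line_scale[OF a(1), of x] x M by simp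
  ultimately show "H \<in> U" using U(1) y unfolding saturated_def by blast
qed

lemma saturated_cell_self: assumes M: "M \<in> tlats n" "1 \<le> n" shows "saturated n (cell M)"
  unfolding saturated_def
proof (intro conjI ballI allI impI)
  show "cell M \<subseteq> lines" using M cell_lines by blast
  fix x y :: "'a ^ 'b" assume x: "x \<in> prim" "x - y \<in> oball (int n)" "line x \<in> cell M"
  have xM: "x \<in> M" using x M mem_cell_tlats by blast
  have "y \<in> M" using omod_close[OF tlats_omod[OF M(1)], of x y] x xM tlats_bounds[OF M(1)] by blast
  moreover have "y \<in> prim" using prim_close[OF x(1) _ x(2)] M by simp
  ultimately show "line y \<in> cell M" using M mem_cell_tlats by blast
qed

lemma saturated_union_cells:
  assumes "saturated n U" "1 \<le> n"
  shows "U = \<Union> (cell ` {M \<in> tlats n. cell M \<subseteq> U})"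
proof (intro equalityI subsetI)
  fix G assume G: "G \<in> U"
  then have "G \<in> lines" using assms by (auto simp: saturated_def)
  then obtain M where "M \<in> tlats n" "G \<in> cell M" using lines_cells by blast
  then show "G \<in> \<Union> (cell ` {M \<in> tlats n. cell M \<subseteq> U})" using saturated_cell assms G by blast
qed auto

text \<open>A vector congruent to a primitive one modulo \<pi> is primitive. At level 0 the vector
  \<open>y\<close> could be 0, which spans no line; hence \<open>1 \<le> n\<close>.\<close>

lemma saturated_lines: "1 \<le> n \<Longrightarrow> saturated n lines"
  unfolding saturated_def
proof (intro conjI ballI allI impI)
  fix x y :: "'a ^ 'b" assume "1 \<le> n" "x \<in> prim" "x - y \<in> oball (int n)"
  then have "y \<in> prim" using prim_close[of x "int n" y] by simp
  then show "line y \<in> lines" unfolding lines_std by blast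
qed simp

text \<open>Let \<pi>^m O^r \<subseteq> \<pi>L and L \<subseteq> \<pi>^l O^r. If \<open>x\<close> is
  primitive in O^r and c x is in L, then \<open>vord c \<ge> l\<close>, so changing \<open>x\<close>
  modulo \<pi>^(m-l) changes c x by an element of \<pi>L. This affects neither primitivity in
  \<open>L\<close> nor membership in \<open>M\<close>.\<close>

lemma saturated_lines_in:
  fixes e :: "('k::nonarch_local_field, 'n::finite) arrow"
  assumes "e \<in> arrows"
  shows "\<exists>n. saturated n (lines_in e)"
proof -
  obtain L M where r: "arrow_rep e L M" using assms arrows_iff by blast
  have L: "L \<in> lattices" "lscale unif L \<in> lattices" "omod M" "lscale unif L \<subseteq> M"
    using r by (auto simp: arrow_rep_def lattice_lscale lattice_omod)
  obtain m where m: "oball m \<subseteq> lscale unif L" using L(2) unfolding lattices_iff by blast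
  obtain l where l: "L \<subseteq> oball l" using L(1) unfolding lattices_iff by blast
  have "line y \<in> lines_in e" if x: "x \<in> prim" and xy: "x - y \<in> oball (int (nat (m - l)))" and G: "line x \<in> lines_in e" for x y
  proof -
    obtain c where c: "c \<noteq> 0" "c *s x \<in> L - lscale unif L" using lattice_prim_ex[OF L(1) prim_not_0[OF x]] .
    have "x \<in> oball (l - vord c)" using c l oball_scale_iff[OF c(1), of x l] by blast
    then have "l \<le> vord c" using x oball_mono[of 1 "l - vord c"] by (cases "l \<le> vord c") auto
    then have "m - vord c \<le> int (nat (m - l))" by linarith
    then have "x - y \<in> oball (m - vord c)" using xy oball_mono by blast
    then have d: "c *s x - c *s y \<in> lscale unif L"
      using m oball_scale_iff[OF c(1), of "x - y" m] by (auto simp: vec.scale_right_diff_distrib)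
    have cy: "c *s y \<in> L - lscale unif L"
      using c(2) omod_diff[of L "c *s x" "c *s x - c *s y"] omod_add[OF lattice_omod[OF L(2)] d, of "c *s y"]
        d lscale_unif_subset[of L] lattice_omod[OF L(1)] by auto
    have "c *s x \<in> M" using G line_scale[OF c(1), of x] lines_in_iff[OF r c(2)] by simp
    then have "c *s y \<in> M" using omod_diff[OF L(3), of "c *s x" "c *s x - c *s y"] d L(4) by auto
    then show ?thesis using lines_in_iff[OF r cy] line_scale[OF c(1), of y] by simp
  qed
  then show ?thesis unfolding saturated_def by (intro exI[of _ "nat (m - l)"]) (auto simp: lines_in_def)
qed


section \<open>Compact-open sets of lines\<close>

lemma open_proj_iff:
  fixes U :: "('k::nonarch_local_field ^ 'n::finite) set set"
  shows "openin proj_topology U \<longleftrightarrow> U \<subseteq> lines \<and>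
    (\<forall>x. x \<noteq> 0 \<longrightarrow> line x \<in> U \<longrightarrow> (\<exists>n. \<forall>y. y - x \<in> oball n \<longrightarrow> line y \<in> U))"
proof -
  let ?S = "{x \<in> - {0}. line x \<in> U}"
  have ball: "(\<forall>i. y $ i \<in> vball (x $ i) N) \<longleftrightarrow> y - x \<in> oball N" for x y :: "'k ^ 'n" and N
    by (auto simp: vball_def oball_def vge_def)
  have eq: "?S \<inter> - {0} = ?S" by blast
  have nz: "U \<subseteq> lines \<Longrightarrow> line x \<in> U \<Longrightarrow> x \<noteq> 0" for x
  proof
    assume "U \<subseteq> lines" "line x \<in> U" "x = 0"
    then obtain y where y: "y \<noteq> 0" "line (0 :: 'k ^ 'n) = line y" unfolding lines_eq by blast
    then show False using line_eq_iff[OF y(1), of 0] by auto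
  qed
  show ?thesis
  proof (cases "U \<subseteq> lines")
    case True
    have "openin (subtopology vec_topology (- {0})) ?S \<longleftrightarrow> (\<forall>x\<in>?S. \<exists>n. \<forall>y. y - x \<in> oball n \<longrightarrow> y \<in> ?S)"
    proof
      assume "openin (subtopology vec_topology (- {0})) ?S"
      then obtain T where T: "openin vec_topology T" "?S = T \<inter> - {0}" unfolding openin_subtopology by blast
      show "\<forall>x\<in>?S. \<exists>n. \<forall>y. y - x \<in> oball n \<longrightarrow> y \<in> ?S"
      proof
        fix x assume x: "x \<in> ?S"
        then obtain N where N: "\<forall>y. y - x \<in> oball N \<longrightarrow> y \<in> T" using T unfolding openin_vec_topology ball by blast
        \<comment> \<open>The ball of exponent \<open>j\<close> around \<open>x\<close> misses 0, so
          a small ball in the whole space stays in the punctured one.\<close>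
        obtain j where j: "x \<notin> oball j" using oball_inter x by blast
        have "y \<in> ?S" if y: "y - x \<in> oball (max N j)" for y
        proof -
          have "y - x \<in> oball N" "y - x \<in> oball j" using y oball_mono[of N "max N j"] oball_mono[of j "max N j"] by auto
          moreover have "0 - x \<notin> oball j" using j omod_minus[OF omod_oball, of "- x" j] by auto
          ultimately have "y \<in> T" "y \<noteq> 0" using N by auto
          then show ?thesis using T(2) by blast
        qed
        then show "\<exists>n. \<forall>y. y - x \<in> oball n \<longrightarrow> y \<in> ?S" by blast
      qed
    next
      assume "\<forall>x\<in>?S. \<exists>n. \<forall>y. y - x \<in> oball n \<longrightarrow> y \<in> ?S"
      then have "openin vec_topology ?S" unfolding openin_vec_topology ball .
      then show "openin (subtopology vec_topology (- {0})) ?S"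
        unfolding openin_subtopology using eq by (intro exI[of _ ?S]) auto
    qed
    moreover have S: "y \<in> ?S \<longleftrightarrow> line y \<in> U" for y using nz[OF True] by blast
    moreover have "(\<forall>x\<in>?S. Q x) \<longleftrightarrow> (\<forall>x. x \<noteq> 0 \<longrightarrow> line x \<in> U \<longrightarrow> Q x)" for Q by auto
    ultimately show ?thesis unfolding openin_proj_topology S using True by simp
  next
    case False
    then show ?thesis unfolding openin_proj_topology by blast
  qed
qed

lemma saturated_open:
  assumes "saturated n U"
  shows "openin proj_topology (U :: ('k::nonarch_local_field ^ 'n::finite) set set)"
  unfolding open_proj_iff
proof (intro conjI allI impI)
  show "U \<subseteq> lines" using assms by (simp add: saturated_def)
  fix x :: "'k ^ 'n" assume x: "x \<noteq> 0" "line x \<in> U"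
  obtain c where c: "c \<noteq> 0" "c *s x \<in> oball 0 - lscale unif (oball 0)" using lattice_prim_ex[OF lattice_oball x(1)] .
  then have cp: "c *s x \<in> prim" by (simp only: unif_std)
  have "line y \<in> U" if y: "y - x \<in> oball (int n - vord c)" for y
  proof -
    have "x - y \<in> oball (int n - vord c)" using omod_minus[OF omod_oball y] by simp
    then have "c *s (x - y) \<in> oball (int n)" using oball_scale_iff[OF c(1)] by blast
    then have "c *s x - c *s y \<in> oball (int n)" by (simp add: vec.scale_right_diff_distrib)
    moreover have "line (c *s x) \<in> U" using x line_scale[OF c(1), of x] by simp
    ultimately have "line (c *s y) \<in> U" using assms cp unfolding saturated_def by blast
    then show ?thesis using line_scale[OF c(1), of y] by simp
  qed
  then show "\<exists>n. \<forall>y. y - x \<in> oball n \<longrightarrow> line y \<in> U" by blast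
qed

text \<open>Completeness of K in each coordinate, with a rate: balls are closed under addition, so
  all later terms, and with them the limit, differ from \<open>X n\<close> by an element of \<pi>^n
  O^r.\<close>

lemma vec_complete:
  fixes X :: "nat \<Rightarrow> 'k::nonarch_local_field ^ 'n::finite"
  assumes X: "\<And>n. X (Suc n) - X n \<in> oball (int n)"
  obtains l where "\<And>n. X n - l \<in> oball (int n)"
proof -
  have Xmn: "X (n + k) - X n \<in> oball (int n)" for n k
  proof (induction k)
    case (Suc k)
    have "X (Suc (n + k)) - X (n + k) \<in> oball (int n)" using X[of "n + k"] oball_mono[of "int n" "int (n + k)"] by auto
    then have "(X (Suc (n + k)) - X (n + k)) + (X (n + k) - X n) \<in> oball (int n)" using Suc by (intro omod_add) auto
    then show ?case by simp
  qed (simp add: omod_0)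
  have Xge: "X m - X n \<in> oball (int k)" if "k \<le> m" "k \<le> n" for m n k
  proof -
    have "X m - X k \<in> oball (int k)" "X n - X k \<in> oball (int k)" using Xmn[of k "m - k"] Xmn[of k "n - k"] that by simp_all
    then have "(X m - X k) - (X n - X k) \<in> oball (int k)" by (rule omod_diff[OF omod_oball])
    then show ?thesis by simp
  qed
  have "\<exists>l. \<forall>N. \<exists>M. \<forall>m\<ge>M. X m $ i = l \<or> N \<le> vord (X m $ i - l)" for i
  proof (rule vord_complete)
    fix N
    have "vge N (X m $ i - X n $ i)" if "nat N \<le> m" "nat N \<le> n" for m n
    proof -
      have "vge (int (nat N)) (X m $ i - X n $ i)" using Xge[OF that] by (simp only: oball_def mem_Collect_eq vector_minus_component)
      then show ?thesis by (rule vge_mono) simp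
    qed
    then show "\<exists>M. \<forall>m\<ge>M. \<forall>n\<ge>M. X m $ i = X n $ i \<or> N \<le> vord (X m $ i - X n $ i)"
      by (intro exI[of _ "nat N"]) (auto simp: vge_def)
  qed
  then obtain l where l: "\<And>i N. \<exists>M. \<forall>m\<ge>M. X m $ i = l i \<or> N \<le> vord (X m $ i - l i)" by metis
  have "X n - vec_lambda l \<in> oball (int n)" for n
    unfolding oball_def
  proof (intro CollectI allI)
    fix i
    obtain M where M: "\<And>m. M \<le> m \<Longrightarrow> X m $ i = l i \<or> int n \<le> vord (X m $ i - l i)" using l[of i "int n"] by blast
    have "vge (int n) (X (max M n) $ i - l i)" using M[of "max M n"] by (auto simp: vge_def)
    moreover have "vge (int n) (X n $ i - X (max M n) $ i)" using Xge[of n n "max M n"] by (auto simp: oball_def)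
    ultimately have "vge (int n) ((X n $ i - X (max M n) $ i) + (X (max M n) $ i - l i))" by (intro vge_add)
    then show "vge (int n) ((X n - vec_lambda l) $ i)" by simp
  qed
  then show ?thesis by (rule that)
qed

text \<open>Bisection: if no finite subfamily covers \<open>U\<close>, some cell of each level,
  nested in the previous one, has no finite cover either. The centres converge by completeness, and
  a member of the cover containing the limit line contains a whole cell of the chain.\<close>

lemma saturated_compact:
  fixes U :: "('k::nonarch_local_field ^ 'n::finite) set set"
  assumes sat: "saturated n0 U"
  shows "compactin proj_topology U"
  unfolding compactin_def
proof (intro conjI allI impI)
  show "U \<subseteq> topspace proj_topology" using saturated_open[OF sat] by (rule openin_subset)
  fix T assume T: "(\<forall>W\<in>T. openin proj_topology W) \<and> U \<subseteq> \<Union>T"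
  define bad where "bad S \<longleftrightarrow> \<not> (\<exists>F. finite F \<and> F \<subseteq> T \<and> S \<inter> U \<subseteq> \<Union>F)" for S
  have split: "\<exists>M\<in>B. bad (cell M)" if B: "finite B" "S \<subseteq> \<Union> (cell ` B)" "bad S" for S and B :: "('k ^ 'n) set set"
  proof (rule ccontr)
    assume "\<not> (\<exists>M\<in>B. bad (cell M))"
    then obtain F where F: "\<And>M. M \<in> B \<Longrightarrow> finite (F M) \<and> F M \<subseteq> T \<and> cell M \<inter> U \<subseteq> \<Union> (F M)"
      unfolding bad_def by metis
    have "finite (\<Union> (F ` B))" using B(1) F by simp
    moreover have "\<Union> (F ` B) \<subseteq> T" using F by blast
    moreover have "S \<inter> U \<subseteq> \<Union> (\<Union> (F ` B))"
    proof
      fix G assume "G \<in> S \<inter> U"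
      then obtain M where "M \<in> B" "G \<in> cell M \<inter> U" using B(2) by blast
      then show "G \<in> \<Union> (\<Union> (F ` B))" using F[of M] by blast
    qed
    ultimately show False using B(3) unfolding bad_def by blast
  qed
  have "\<not> bad U"
  proof
    assume bU: "bad U"
    then have "bad lines" using sat unfolding bad_def saturated_def by (simp add: Int_absorb1)
    then obtain M1 where M1: "M1 \<in> tlats 1" "bad (cell M1)" using split[OF finite_tlats[of 1], of lines] lines_cells[of 1] by blast
    obtain x1 where x1: "x1 \<in> prim" "M1 = tlat 1 x1" using M1 unfolding tlats_def by blast
    have "\<exists>X. \<forall>n. (X n \<in> prim \<and> bad (cell (tlat (Suc n) (X n)))) \<and> X (Suc n) - X n \<in> oball (int (Suc n))"
    proof (rule dependent_nat_choice)
      show "\<exists>x. x \<in> prim \<and> bad (cell (tlat (Suc 0) x))" using x1 M1 by auto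
    next
      fix x :: "'k ^ 'n" and n assume x: "x \<in> prim \<and> bad (cell (tlat (Suc n) x))"
      let ?B = "{M \<in> tlats (Suc (Suc n)). M \<subseteq> tlat (Suc n) x}"
      have xT: "tlat (Suc n) x \<in> tlats (Suc n)" using x by (auto simp: tlats_def)
      have "cell (tlat (Suc n) x) \<subseteq> \<Union> (cell ` ?B)"
      proof
        fix G assume G: "G \<in> cell (tlat (Suc n) x)"
        then obtain y where y: "y \<in> prim" "G = line y" using cell_lines[OF xT] lines_std by blast
        then have "y \<in> tlat (Suc n) x" using mem_cell_tlats[OF xT] G by blast
        then have "tlat (Suc n) y = tlat (Suc n) x" using x y by (intro tlat_eq) auto
        then have "tlat (Suc (Suc n)) y \<subseteq> tlat (Suc n) x"
          using cyc_mono[OF oball_mono[of "int (Suc n)" "int (Suc (Suc n))"], of y] by simp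
        then have "tlat (Suc (Suc n)) y \<in> ?B" using y by (simp add: tlats_def)
        moreover have "G \<in> cell (tlat (Suc (Suc n)) y)" using y mem_cell_tlat by blast
        ultimately show "G \<in> \<Union> (cell ` ?B)" by blast
      qed
      moreover have "finite ?B" by (rule finite_subset[OF _ finite_tlats[of "Suc (Suc n)"]]) blast
      ultimately obtain M where M: "M \<in> ?B" "bad (cell M)" using split x by blast
      obtain z where z: "z \<in> prim" "M = tlat (Suc (Suc n)) z" using M unfolding tlats_def by blast
      then have "z \<in> tlat (Suc n) x" using M tlat_self by blast
      then obtain a where a: "a \<noteq> 0" "vord a = 0" "z - a *s x \<in> oball (int (Suc n))" using x z tlat_memD[of x "Suc n" z] by auto
      \<comment> \<open>Cells determine their centre only up to units. Dividing by \<open>a\<close>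
        makes the new centre congruent to the old one modulo \<pi>^(n+1), so that the centres
        themselves form a Cauchy sequence.\<close>
      let ?y = "inverse a *s z"
      have "?y \<in> prim" using prim_unit_scale[OF z(1)] a by (simp add: vord_inverse)
      moreover have "inverse a *s (z - a *s x) \<in> oball (int (Suc n))"
        using a by (intro omod_scale[OF omod_oball]) (auto intro: inverse_unit_integer)
      then have "?y - x \<in> oball (int (Suc n))" using a by (simp add: vec.scale_right_diff_distrib)
      moreover have "tlat (Suc (Suc n)) ?y = M" unfolding z
        using a by (intro cyc_unit[of _ "inverse a"]) (auto simp: vord_inverse omod_0)
      ultimately show "\<exists>y. (y \<in> prim \<and> bad (cell (tlat (Suc (Suc n)) y))) \<and> y - x \<in> oball (int (Suc n))"
        using M(2) by (intro exI[of _ ?y]) simp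
    qed
    then obtain X where X: "\<And>n. X n \<in> prim" "\<And>n. bad (cell (tlat (Suc n) (X n)))"
      "\<And>n. X (Suc n) - X n \<in> oball (int (Suc n))" by blast
    have "X (Suc n) - X n \<in> oball (int n)" for n using X(3)[of n] oball_mono[of "int n" "int (Suc n)"] by auto
    then obtain l where l0: "\<And>n. X n - l \<in> oball (int n)" using vec_complete by blast
    have l: "X n - l \<in> oball (int (Suc n))" for n
      using omod_diff[OF omod_oball l0[of "Suc n"] X(3)[of n]] by simp
    have lp: "l \<in> prim" using prim_close[OF X(1)[of 0] _ l[of 0]] by simp
    have tl: "tlat (Suc n) (X n) = tlat (Suc n) l" for n
      using l[of n] by (intro cyc_unit[of _ 1]) auto
    have tls: "tlat (Suc n) l \<in> tlats (Suc n)" for n using lp by (auto simp: tlats_def)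
    have inU: "line l \<in> U"
    proof -
      \<comment> \<open>A bad cell meets \<open>U\<close>, since the empty set needs no cover;
        beyond level \<open>n0\<close> it is then contained in \<open>U\<close>.\<close>
      have "cell (tlat (Suc n0) l) \<inter> U \<noteq> {}"
        using X(2)[of n0] unfolding tl bad_def by (metis Union_empty empty_subsetI finite.emptyI)
      then have "cell (tlat (Suc n0) l) \<subseteq> U"
        using saturated_cell[OF saturated_mono[OF sat, of "Suc n0"] _ tls] by auto
      then show ?thesis using mem_cell_tlats[OF tls lp] tlat_self by blast
    qed
    then obtain W where W: "W \<in> T" "line l \<in> W" using T by blast
    then obtain N where N: "\<And>y. y - l \<in> oball N \<Longrightarrow> line y \<in> W"
      using T prim_not_0[OF lp] unfolding open_proj_iff by meson
    have "cell (tlat (Suc (nat N)) l) \<subseteq> W"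
    proof
      fix G assume "G \<in> cell (tlat (Suc (nat N)) l)"
      then obtain y where y: "y \<in> tlat (Suc (nat N)) l" "y \<notin> oball 1" "G = line y" by (auto simp: cell_def)
      obtain a where a: "a \<noteq> 0" "vord a = 0" "y - a *s l \<in> oball (int (Suc (nat N)))"
        using tlat_memD[OF lp _ y(1,2)] by auto
      have "inverse a *s (y - a *s l) \<in> oball (int (Suc (nat N)))"
        using a by (intro omod_scale[OF omod_oball]) (auto intro: inverse_unit_integer)
      then have "inverse a *s y - l \<in> oball (int (Suc (nat N)))" using a by (simp add: vec.scale_right_diff_distrib)
      moreover have "N \<le> int (Suc (nat N))" by linarith
      ultimately have "inverse a *s y - l \<in> oball N" using oball_mono by blast
      then show "G \<in> W" using N[of "inverse a *s y"] line_scale[of "inverse a" y] a y by simp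
    qed
    then show False using X(2)[of "nat N"] W unfolding tl bad_def
      by (metis (no_types, lifting) Union_insert Union_empty empty_subsetI finite.intros inf.coboundedI1 insert_subset sup_bot_right)
  qed
  then show "\<exists>F. finite F \<and> F \<subseteq> T \<and> U \<subseteq> \<Union>F" unfolding bad_def by auto
qed

text \<open>An open set is a union of cells; by compactness finitely many suffice, and the largest
  of their levels serves for the whole set.\<close>

lemma compact_open_iff: "U \<in> compact_open \<longleftrightarrow> (\<exists>n. saturated n U)"
proof
  assume U: "U \<in> compact_open"
  then have op: "openin proj_topology U" and comp: "compactin proj_topology U" by (auto simp: compact_open_def)
  have sub: "U \<subseteq> lines" using op by (simp only: open_proj_iff)
  define C where "C = {(n, M). 1 \<le> n \<and> M \<in> tlats n \<and> cell M \<subseteq> U}"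
  have "U \<subseteq> \<Union> ((cell \<circ> snd) ` C)"
  proof
    fix G assume G: "G \<in> U"
    then obtain x where x: "x \<in> prim" "G = line x" using sub lines_std by blast
    then obtain N where N: "\<And>y. y - x \<in> oball N \<Longrightarrow> line y \<in> U"
      using op prim_not_0[OF x(1)] G unfolding open_proj_iff by meson
    have "cell (tlat (Suc (nat N)) x) \<subseteq> U"
    proof
      fix H assume "H \<in> cell (tlat (Suc (nat N)) x)"
      then obtain y where y: "y \<in> tlat (Suc (nat N)) x" "y \<notin> oball 1" "H = line y" by (auto simp: cell_def)
      obtain a where a: "a \<noteq> 0" "vord a = 0" "y - a *s x \<in> oball (int (Suc (nat N)))"
        using tlat_memD[OF x(1) _ y(1,2)] by auto
      have "inverse a *s (y - a *s x) \<in> oball (int (Suc (nat N)))"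
        using a by (intro omod_scale[OF omod_oball]) (auto intro: inverse_unit_integer)
      then have "inverse a *s y - x \<in> oball (int (Suc (nat N)))" using a by (simp add: vec.scale_right_diff_distrib)
      moreover have "N \<le> int (Suc (nat N))" by linarith
      ultimately have "inverse a *s y - x \<in> oball N" using oball_mono by blast
      then show "H \<in> U" using N[of "inverse a *s y"] line_scale[of "inverse a" y] a y by simp
    qed
    then have "(Suc (nat N), tlat (Suc (nat N)) x) \<in> C" using x by (auto simp: C_def tlats_def)
    moreover have "G \<in> cell (tlat (Suc (nat N)) x)" using x mem_cell_tlat by blast
    ultimately show "G \<in> \<Union> ((cell \<circ> snd) ` C)" by force
  qed
  moreover have "\<forall>W\<in>(cell \<circ> snd) ` C. openin proj_topology W"
    using saturated_open[OF saturated_cell_self] by (auto simp: C_def)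
  ultimately obtain F where F: "finite F" "F \<subseteq> (cell \<circ> snd) ` C" "U \<subseteq> \<Union>F"
    using comp unfolding compactin_def by meson
  obtain D where D: "finite D" "D \<subseteq> C" "F = (cell \<circ> snd) ` D" using finite_subset_image[OF F(1,2)] by blast
  define n where "n = Max (insert 1 (fst ` D))"
  have nD: "m \<le> n" if "(m, M) \<in> D" for m M using that D(1) unfolding n_def by (intro Max_ge) force+
  have "saturated n U" unfolding saturated_def
  proof (intro conjI ballI allI impI)
    show "U \<subseteq> lines" by (rule sub)
    fix x y :: "'a ^ 'b" assume x: "x \<in> prim" "x - y \<in> oball (int n)" "line x \<in> U"
    then obtain m M where M: "(m, M) \<in> D" "line x \<in> cell M" using F(3) D(3) by force
    then have MC: "1 \<le> m" "M \<in> tlats m" "cell M \<subseteq> U" using D(2) by (auto simp: C_def)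
    then have "saturated n (cell M)" using saturated_mono[OF saturated_cell_self nD[OF M(1)]] by blast
    then have "line y \<in> cell M" using x M(2) unfolding saturated_def by blast
    then show "line y \<in> U" using MC by blast
  qed
  then show "\<exists>n. saturated n U" by blast
next
  assume "\<exists>n. saturated n U"
  then show "U \<in> compact_open" using saturated_open saturated_compact by (auto simp: compact_open_def)
qed

section \<open>Distributions\<close>

lemma compact_open_saturated:
  assumes "U \<in> compact_open" obtains n where "1 \<le> n" "saturated n U"
  using assms saturated_mono[of _ U "Suc _"] unfolding compact_open_iff by (metis le_add1 le_add2 plus_1_eq_Suc saturated_mono)

lemma cell_compact_open: "M \<in> tlats n \<Longrightarrow> 1 \<le> n \<Longrightarrow> cell M \<in> compact_open"
  using saturated_cell_self compact_open_iff by blast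

lemma lines_in_compact_open: "e \<in> arrows \<Longrightarrow> lines_in e \<in> compact_open"
  using saturated_lines_in compact_open_iff by blast

lemma distribution_Union:
  "\<delta> \<in> distributions \<Longrightarrow> finite F \<Longrightarrow> F \<subseteq> compact_open \<Longrightarrow> disjoint F \<Longrightarrow> \<delta> (\<Union>F) = (\<Sum>U\<in>F. \<delta> U)"
  unfolding distributions_def by blast

text \<open>Additivity in \<open>distributions\<close> is stated for sets of sets, so the indexing
  must be injective. Disjointness ensures this for nonempty members only.\<close>

lemma distribution_indexed_union:
  assumes d: "\<delta> \<in> distributions" and I: "finite I" "\<And>i. i \<in> I \<Longrightarrow> U i \<in> compact_open"
    "\<And>i. i \<in> I \<Longrightarrow> U i \<noteq> {}" "\<And>i j. i \<in> I \<Longrightarrow> j \<in> I \<Longrightarrow> i \<noteq> j \<Longrightarrow> U i \<inter> U j = {}"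
  shows "\<delta> (\<Union> (U ` I)) = (\<Sum>i\<in>I. \<delta> (U i))"
proof -
  have inj: "inj_on U I"
  proof (rule inj_onI)
    fix i j assume "i \<in> I" "j \<in> I" "U i = U j"
    then show "i = j" using I(3)[of i] I(4)[of i j] by auto
  qed
  have "disjoint (U ` I)" using I(4) unfolding pairwise_def disjnt_def by blast
  then have "\<delta> (\<Union> (U ` I)) = (\<Sum>V\<in>U ` I. \<delta> V)" using I by (intro distribution_Union[OF d]) auto
  also have "\<dots> = (\<Sum>i\<in>I. \<delta> (U i))" using sum.reindex[OF inj, of \<delta>] by simp
  finally show ?thesis .
qed

lemma distribution_cells:
  assumes d: "\<delta> \<in> distributions" and U: "saturated n U" "1 \<le> n"
  shows "\<delta> U = (\<Sum>M | M \<in> tlats n \<and> cell M \<subseteq> U. \<delta> (cell M))"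
proof -
  have "\<delta> (\<Union> (cell ` {M \<in> tlats n. cell M \<subseteq> U})) = (\<Sum>M | M \<in> tlats n \<and> cell M \<subseteq> U. \<delta> (cell M))"
  proof (rule distribution_indexed_union[OF d])
    show "finite {M \<in> tlats n. cell M \<subseteq> U}" by (rule finite_subset[OF _ finite_tlats]) blast
    show "\<And>i. i \<in> {M \<in> tlats n. cell M \<subseteq> U} \<Longrightarrow> cell i \<in> compact_open" using cell_compact_open U(2) by blast
    show "\<And>i. i \<in> {M \<in> tlats n. cell M \<subseteq> U} \<Longrightarrow> cell i \<noteq> {}" using cell_nonempty by blast
    show "\<And>i j. i \<in> {M \<in> tlats n. cell M \<subseteq> U} \<Longrightarrow> j \<in> {M \<in> tlats n. cell M \<subseteq> U} \<Longrightarrow> i \<noteq> j \<Longrightarrow> cell i \<inter> cell j = {}"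
      using cell_eqI U(2) by blast
  qed
  then show ?thesis using saturated_union_cells[OF U] by simp
qed

lemma common_saturated:
  assumes "finite I" "\<And>i. i \<in> I \<Longrightarrow> U i \<in> compact_open"
  obtains n where "1 \<le> n" "\<And>i. i \<in> I \<Longrightarrow> saturated n (U i)"
proof -
  have "\<exists>n\<ge>1. \<forall>i\<in>I. saturated n (U i)" using assms
  proof (induction I rule: finite_induct)
    case (insert i I)
    then obtain n where n: "1 \<le> n" "\<forall>i\<in>I. saturated n (U i)" by auto
    obtain m where "saturated m (U i)" using insert compact_open_iff by blast
    then show ?case using n saturated_mono[of _ _ "max m n"]
      by (intro exI[of _ "max m n"]) (auto intro: saturated_mono)
  qed auto
  then show ?thesis using that by blast
qed

text \<open>The source of (A) and (B). At a common level each cell lies in exactly \<open>k\<close>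
  of the sets, so exchanging the order of summation gives \<open>k\<close> times the total
  mass.\<close>

lemma distribution0_sum_const:
  fixes \<delta> :: "('k::nonarch_local_field ^ 'n::finite) set set \<Rightarrow> 'a::ab_group_add"
  assumes d: "\<delta> \<in> distributions0" and I: "finite I" "\<And>i. i \<in> I \<Longrightarrow> U i \<in> compact_open"
    and k: "\<And>G. G \<in> lines \<Longrightarrow> card {i \<in> I. G \<in> U i} = k"
  shows "(\<Sum>i\<in>I. \<delta> (U i)) = 0"
proof -
  have d': "\<delta> \<in> distributions" "\<delta> lines = 0" using d by (auto simp: distributions0_def)
  obtain n where n: "1 \<le> n" "\<And>i. i \<in> I \<Longrightarrow> saturated n (U i)" using common_saturated[of I U] I by blast
  have "(\<Sum>i\<in>I. \<delta> (U i)) = (\<Sum>i\<in>I. \<Sum>M | M \<in> tlats n \<and> cell M \<subseteq> U i. \<delta> (cell M))"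
    using distribution_cells[OF d'(1) n(2) n(1)] by (intro sum.cong) auto
  also have "\<dots> = (\<Sum>M\<in>tlats n. \<Sum>i | i \<in> I \<and> cell M \<subseteq> U i. \<delta> (cell M))"
    by (rule sum.swap_restrict[OF I(1) finite_tlats])
  \<comment> \<open>The k-fold multiple is written as a sum over \<open>j<k\<close>, so that it can
    be exchanged with the sum over the cells.\<close>
  also have "\<dots> = (\<Sum>M\<in>tlats n. \<Sum>j<k. \<delta> (cell M))"
  proof (rule sum.cong[OF refl])
    fix M assume M: "M \<in> (tlats n :: ('k ^ 'n) set set)"
    obtain G where G: "G \<in> cell M" using cell_nonempty[OF M] by blast
    have "{i \<in> I. cell M \<subseteq> U i} = {i \<in> I. G \<in> U i}"
      using saturated_cell[OF n(2) n(1) M G] G by blast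
    then have "card {i \<in> I. cell M \<subseteq> U i} = k" using k G cell_lines[OF M] by auto
    then obtain h where h: "bij_betw h {..<k} {i \<in> I. cell M \<subseteq> U i}"
      using ex_bij_betw_nat_finite[of "{i \<in> I. cell M \<subseteq> U i}"] I(1) by (auto simp: atLeast0LessThan)
    show "(\<Sum>i | i \<in> I \<and> cell M \<subseteq> U i. \<delta> (cell M)) = (\<Sum>j<k. \<delta> (cell M))"
      using sum.reindex_bij_betw[OF h, of "\<lambda>_. \<delta> (cell M)"] by simp
  qed
  also have "\<dots> = (\<Sum>j<k. \<Sum>M\<in>tlats n. \<delta> (cell M))" by (rule sum.swap)
  also have "(\<Sum>M\<in>tlats n. \<delta> (cell M)) = \<delta> lines"
  proof -
    have "{M \<in> tlats n. cell M \<subseteq> lines} = (tlats n :: ('k ^ 'n) set set)" using cell_lines by blast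
    then show ?thesis using distribution_cells[OF d'(1) saturated_lines[OF n(1)] n(1)] by simp
  qed
  finally show ?thesis using d'(2) by simp
qed

section \<open>Distributions from compatible masses of cells\<close>

definition mass :: "(nat \<Rightarrow> ('k::nonarch_local_field ^ 'n::finite) set \<Rightarrow> 'a::ab_group_add) \<Rightarrow> nat \<Rightarrow>
    ('k ^ 'n) set set \<Rightarrow> 'a" where
  "mass g n U = (\<Sum>M | M \<in> tlats n \<and> cell M \<subseteq> U. g n M)"

text \<open>The least admissible level is a mere choice: for masses that add up from each level to
  the next, every admissible level gives the same value (\<open>dist_of_eq_mass\<close>).\<close>

definition dist_of :: "(nat \<Rightarrow> ('k::nonarch_local_field ^ 'n::finite) set \<Rightarrow> 'a::ab_group_add) \<Rightarrow>
    ('k ^ 'n) set set \<Rightarrow> 'a" where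
  "dist_of g U = (if U \<in> compact_open then mass g (LEAST n. 1 \<le> n \<and> saturated n U) U else 0)"

lemma tlats_parent: "M \<in> tlats (Suc n) \<Longrightarrow> \<exists>P\<in>tlats n. M \<subseteq> P"
proof -
  assume "M \<in> tlats (Suc n)"
  then obtain x where x: "x \<in> prim" "M = tlat (Suc n) x" unfolding tlats_def by blast
  then have "M \<subseteq> tlat n x" using cyc_mono[OF oball_mono[of "int n" "int (Suc n)"], of x] by simp
  then show ?thesis using tlat_tlats[OF x(1)] by blast
qed

lemma tlats_0: "M \<in> tlats 0 \<longleftrightarrow> M = (oball 0 :: ('k::nonarch_local_field ^ 'n::finite) set)"
proof
  assume "M \<in> tlats 0"
  then show "M = oball 0" using tlat_0 unfolding tlats_def by fastforce
next
  assume "M = oball 0"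
  moreover have "(\<chi> i. 1) \<in> (prim :: ('k ^ 'n) set)" by (auto simp: oball_def vge_def)
  ultimately show "M \<in> tlats 0" using tlat_0 unfolding tlats_def by (metis imageI)
qed

lemma tlats_parent_unique:
  assumes "M \<in> tlats m" "P \<in> tlats n" "P' \<in> tlats n" "M \<subseteq> P" "M \<subseteq> P'"
  shows "P = P'"
proof (cases "1 \<le> n")
  case True
  obtain x where x: "x \<in> prim" "x \<in> M" using tlats_prim_ex[OF assms(1)] by blast
  then have "x \<in> P" "x \<in> P'" "x \<notin> oball 1" using assms by auto
  then show ?thesis using tlats_mem_eq True assms by metis
next
  case False
  then have "n = 0" by simp
  then show ?thesis using assms tlats_0 by blast
qed

lemma mass_Suc:
  assumes g: "\<And>n P. 1 \<le> n \<Longrightarrow> P \<in> tlats n \<Longrightarrow> (\<Sum>M | M \<in> tlats (Suc n) \<and> M \<subseteq> P. g (Suc n) M) = g n P"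
    and U: "saturated n U" "1 \<le> n"
  shows "mass g (Suc n) U = mass g n U"
proof -
  let ?I = "{P \<in> tlats n. cell P \<subseteq> U}" and ?C = "\<lambda>P. {M \<in> tlats (Suc n). M \<subseteq> P}"
  have "{M \<in> tlats (Suc n). cell M \<subseteq> U} = \<Union> (?C ` ?I)"
  proof (intro equalityI subsetI)
    fix M assume M: "M \<in> {M \<in> tlats (Suc n). cell M \<subseteq> U}"
    then obtain P where P: "P \<in> tlats n" "M \<subseteq> P" using tlats_parent by blast
    obtain G where G: "G \<in> cell M" using cell_nonempty M by blast
    then have "G \<in> cell P" using P(2) by (auto simp: cell_def)
    then have "cell P \<subseteq> U" using saturated_cell[OF U P(1)] G M by blast
    then show "M \<in> \<Union> (?C ` ?I)" using P M by blast
  qed (auto simp: cell_def)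
  then have "mass g (Suc n) U = sum (g (Suc n)) (\<Union> (?C ` ?I))" by (simp add: mass_def)
  also have "\<dots> = (\<Sum>P\<in>?I. sum (g (Suc n)) (?C P))"
  proof (rule sum.UNION_disjoint)
    show "finite ?I" by (rule finite_subset[OF _ finite_tlats]) blast
    show "\<forall>i\<in>?I. finite (?C i)" by (intro ballI finite_subset[OF _ finite_tlats]) blast
    show "\<forall>i\<in>?I. \<forall>j\<in>?I. i \<noteq> j \<longrightarrow> ?C i \<inter> ?C j = {}" using tlats_parent_unique by blast
  qed
  also have "\<dots> = mass g n U" unfolding mass_def by (rule sum.cong) (use g U in auto)
  finally show ?thesis .
qed

lemma dist_of_eq_mass:
  assumes g: "\<And>n P. 1 \<le> n \<Longrightarrow> P \<in> tlats n \<Longrightarrow> (\<Sum>M | M \<in> tlats (Suc n) \<and> M \<subseteq> P. g (Suc n) M) = g n P"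
    and U: "saturated n U" "1 \<le> n"
  shows "dist_of g U = mass g n U"
proof -
  define N where "N = (LEAST n. 1 \<le> n \<and> saturated n U)"
  have N: "1 \<le> N \<and> saturated N U" "N \<le> n"
    using LeastI[of "\<lambda>n. 1 \<le> n \<and> saturated n U" n] Least_le[of "\<lambda>n. 1 \<le> n \<and> saturated n U" n] U
    unfolding N_def by auto
  have "mass g (N + k) U = mass g N U" for k
  proof (induction k)
    case (Suc k)
    have "saturated (N + k) U" using N saturated_mono by (metis le_add1)
    then show ?case using mass_Suc[of g, OF g, of "N + k" U] Suc N by simp
  qed simp
  from this[of "n - N"] N(2) have "mass g n U = mass g N U" by simp
  then show ?thesis using U compact_open_iff unfolding dist_of_def N_def by auto
qed

text \<open>Evaluated at a level common to all members of \<open>F\<close>, additivity only splits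
  the set of cells: each nonempty cell inside the union lies in exactly one member.\<close>

lemma dist_of_distribution:
  fixes g :: "nat \<Rightarrow> ('k::nonarch_local_field ^ 'n::finite) set \<Rightarrow> 'a::ab_group_add"
  assumes g: "\<And>n P. 1 \<le> n \<Longrightarrow> P \<in> tlats n \<Longrightarrow> (\<Sum>M | M \<in> tlats (Suc n) \<and> M \<subseteq> P. g (Suc n) M) = g n P"
  shows "dist_of g \<in> distributions"
  unfolding distributions_def
proof (intro CollectI conjI allI impI)
  fix U :: "('k ^ 'n) set set" assume "U \<notin> compact_open" then show "dist_of g U = 0" by (simp add: dist_of_def)
next
  fix F :: "('k ^ 'n) set set set" assume F: "finite F \<and> F \<subseteq> compact_open \<and> disjoint F"
  then obtain n where n: "1 \<le> n" "\<And>U. U \<in> F \<Longrightarrow> saturated n U"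
    using common_saturated[of F "\<lambda>U. U"] by blast
  have sF: "saturated n (\<Union>F)" using n(2) unfolding saturated_def by blast
  have "{M \<in> tlats n. cell M \<subseteq> \<Union>F} = (\<Union>U\<in>F. {M \<in> tlats n. cell M \<subseteq> U})"
  proof (intro equalityI subsetI)
    fix M assume M: "M \<in> {M \<in> tlats n. cell M \<subseteq> \<Union>F}"
    then obtain G where G: "G \<in> cell M" using cell_nonempty by blast
    then obtain U where U: "U \<in> F" "G \<in> U" using M by blast
    then have "cell M \<subseteq> U" using saturated_cell[OF n(2) n(1)] M G by blast
    then show "M \<in> (\<Union>U\<in>F. {M \<in> tlats n. cell M \<subseteq> U})" using U M by blast
  qed blast
  then have "dist_of g (\<Union>F) = sum (g n) (\<Union>U\<in>F. {M \<in> tlats n. cell M \<subseteq> U})"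
    using dist_of_eq_mass[of g, OF g sF n(1)] by (simp add: mass_def)
  also have "\<dots> = (\<Sum>U\<in>F. sum (g n) {M \<in> tlats n. cell M \<subseteq> U})"
  proof (rule sum.UNION_disjoint)
    show "finite F" using F by blast
    show "\<forall>i\<in>F. finite {M \<in> tlats n. cell M \<subseteq> i}" by (intro ballI finite_subset[OF _ finite_tlats]) blast
    show "\<forall>U\<in>F. \<forall>V\<in>F. U \<noteq> V \<longrightarrow> {M \<in> tlats n. cell M \<subseteq> U} \<inter> {M \<in> tlats n. cell M \<subseteq> V} = {}"
    proof (intro ballI impI, rule ccontr)
      fix U V assume UV: "U \<in> F" "V \<in> F" "U \<noteq> V" "{M \<in> tlats n. cell M \<subseteq> U} \<inter> {M \<in> tlats n. cell M \<subseteq> V} \<noteq> {}"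
      then obtain M where M: "M \<in> tlats n" "cell M \<subseteq> U" "cell M \<subseteq> V" by blast
      have "U \<inter> V = {}" using F UV unfolding pairwise_def disjnt_def by blast
      then show False using cell_nonempty[OF M(1)] M by blast
    qed
  qed
  also have "\<dots> = (\<Sum>U\<in>F. dist_of g U)"
    using dist_of_eq_mass[of g, OF g n(2) n(1)] by (intro sum.cong) (auto simp: mass_def)
  finally show "dist_of g (\<Union>F) = (\<Sum>U\<in>F. dist_of g U)" .
qed

lemma dist_of_cell:
  assumes g: "\<And>n P. 1 \<le> n \<Longrightarrow> P \<in> tlats n \<Longrightarrow> (\<Sum>M | M \<in> tlats (Suc n) \<and> M \<subseteq> P. g (Suc n) M) = g n P"
    and M: "M \<in> tlats n" "1 \<le> n"
  shows "dist_of g (cell M) = g n M"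
proof -
  have "{M' \<in> tlats n. cell M' \<subseteq> cell M} = {M}"
    using cell_eqI[OF _ M(1) M(2)] cell_nonempty M(1) by blast
  then show ?thesis
    using dist_of_eq_mass[of g, OF g saturated_cell_self[OF M] M(2)] by (simp add: mass_def)
qed

lemma dist_of_lines:
  fixes g :: "nat \<Rightarrow> ('k::nonarch_local_field ^ 'n::finite) set \<Rightarrow> 'a::ab_group_add"
  assumes g: "\<And>n P. 1 \<le> n \<Longrightarrow> P \<in> tlats n \<Longrightarrow> (\<Sum>M | M \<in> tlats (Suc n) \<and> M \<subseteq> P. g (Suc n) M) = g n P"
  shows "dist_of g lines = (\<Sum>M\<in>tlats 1. g 1 M)"
proof -
  have "{M \<in> tlats 1. cell M \<subseteq> lines} = (tlats 1 :: ('k ^ 'n) set set)" using cell_lines by blast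
  then show ?thesis using dist_of_eq_mass[of g, OF g saturated_lines[of 1]] by (simp add: mass_def)
qed

lemma distribution_eqI:
  assumes "\<delta> \<in> distributions" "\<delta>' \<in> distributions"
    and "\<And>n M. 1 \<le> n \<Longrightarrow> M \<in> tlats n \<Longrightarrow> \<delta> (cell M) = \<delta>' (cell M)"
  shows "\<delta> = \<delta>'"
proof
  fix U
  show "\<delta> U = \<delta>' U"
  proof (cases "U \<in> compact_open")
    case True
    then obtain n where n: "1 \<le> n" "saturated n U" by (rule compact_open_saturated)
    show ?thesis unfolding distribution_cells[OF assms(1) n(2,1)] distribution_cells[OF assms(2) n(2,1)]
      by (rule sum.cong) (use assms(3)[OF n(1)] in auto)
  next
    case False
    then show ?thesis using assms by (auto simp: distributions_def)
  qed
qed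

section \<open>Paths\<close>

lemma path_arrows_simps [simp]:
  "path_arrows [v] = []" "path_arrows (v # w # p) = (v, w) # path_arrows (w # p)"
  by (simp_all add: path_arrows_def)

lemma is_bt_path_simps [simp]:
  "is_bt_path [v] \<longleftrightarrow> v \<in> vertices"
  "is_bt_path (v # w # p) \<longleftrightarrow> (v, w) \<in> arrows \<and> is_bt_path (w # p)"
  using arrow_vertices by (auto simp: is_bt_path_def)

lemma not_bt_path_Nil [simp]: "\<not> is_bt_path []"
  by (simp add: is_bt_path_def)

text \<open>
  Along an arrow \<open>e\<close> the exponent \<open>lord\<close> of a vector \<open>x\<close> grows by one, unless the line of \<open>x\<close> belongs
  to \<open>lines_in e\<close>.  Hence the number of arrows \<open>e\<close> of a closed path with \<open>G \<in> lines_in e\<close> does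
  not depend on the line \<open>G\<close>, which yields condition (A).
\<close>

definition lord :: "('k::nonarch_local_field ^ 'n::finite) set \<Rightarrow> 'k ^ 'n \<Rightarrow> int" where
  "lord L x = (THE n. unif powi n *s x \<in> L - lscale unif L)"

lemma lord_eqI:
  assumes L: "omod L" "c \<noteq> 0" "c *s x \<in> L - lscale unif L"
  shows "lord L x = vord c"
  unfolding lord_def
proof (rule the_equality)
  have eq: "unif powi n *s x = (unif powi n / c) *s (c *s x)" for n using L by simp
  have "unif powi n *s x \<in> L - lscale unif L \<longleftrightarrow> n = vord c" for n
    unfolding eq[of n] prim_scale_prim_iff[OF L(1,3)] using L(2) by (simp add: vord_divide vord_powi)
  then show "unif powi vord c *s x \<in> L - lscale unif L"
    "\<And>n. unif powi n *s x \<in> L - lscale unif L \<Longrightarrow> n = vord c" by auto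
qed

lemma lord_prim: "omod L \<Longrightarrow> x \<in> L - lscale unif L \<Longrightarrow> lord L x = 0"
  using lord_eqI[of L 1 x] by simp

lemma lord_arrow:
  assumes r: "arrow_rep e L M" and x: "x \<noteq> 0"
  shows "lord M x + (if line x \<in> lines_in e then 1 else 0) = lord L x + 1"
proof -
  have L: "L \<in> lattices" "omod L" "omod M" "M \<subseteq> L" "lscale unif L \<subseteq> M"
    using r by (auto simp: arrow_rep_def lattice_omod)
  obtain c where c: "c \<noteq> 0" "c *s x \<in> L - lscale unif L" using lattice_prim_ex[OF L(1) x] .
  have iff: "line x \<in> lines_in e \<longleftrightarrow> c *s x \<in> M" using lines_in_iff[OF r c(2)] line_scale[OF c(1), of x] by simp
  show ?thesis
  proof (cases "c *s x \<in> M")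
    case True
    then have "c *s x \<in> M - lscale unif M" using c L(4) lscale_mono[of M L unif] by blast
    then show ?thesis using lord_eqI[OF L(3) c(1)] lord_eqI[OF L(2) c] iff True by simp
  next
    case False
    have s: "(unif * c) *s x = unif *s (c *s x)" by simp
    have "unif *s (c *s x) \<in> lscale unif L" using c(2) by (simp only: scale_mem_lscale[OF unif_nz] Diff_iff)
    moreover have "unif *s (c *s x) \<notin> lscale unif M" using False by (simp only: scale_mem_lscale[OF unif_nz] not_False_eq_True)
    ultimately have "(unif * c) *s x \<in> M - lscale unif M" unfolding s using L(5) by blast
    then have "lord M x = vord (unif * c)" using c(1) by (intro lord_eqI[OF L(3)]) auto
    then show ?thesis using lord_eqI[OF L(2) c] iff False c(1) by (simp add: vord_mult vord_unif)
  qed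
qed

lemma lord_path:
  assumes "is_bt_path p" "L \<in> lattices" "hd p = sim_class L"
  shows "\<exists>M\<in>lattices. last p = sim_class M \<and> (\<forall>x. x \<noteq> 0 \<longrightarrow>
    lord M x + int (length (filter (\<lambda>e. line x \<in> lines_in e) (path_arrows p))) = lord L x + int (length (path_arrows p)))"
  using assms
proof (induction p arbitrary: L rule: induct_list012)
  case (2 v)
  then show ?case by auto
next
  case (3 v w p)
  then have e: "(v, w) \<in> arrows" and p: "is_bt_path (w # p)" by auto
  obtain M where M: "arrow_rep (v, w) L M" using arrow_rep_at[OF e 3(4)] 3(5) by auto
  then have M': "M \<in> lattices" "hd (w # p) = sim_class M" by (auto simp: arrow_rep_def)
  obtain N where N: "N \<in> lattices" "last (w # p) = sim_class N \<and> (\<forall>x. x \<noteq> 0 \<longrightarrow>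
      lord N x + int (length (filter (\<lambda>e. line x \<in> lines_in e) (path_arrows (w # p)))) =
      lord M x + int (length (path_arrows (w # p))))"
    using 3(2)[OF p M'] by (rule bexE)
  show ?case
  proof (intro bexI[of _ N] conjI allI impI)
    fix x :: "'a ^ 'b" assume x: "x \<noteq> 0"
    show "lord N x + int (length (filter (\<lambda>e. line x \<in> lines_in e) (path_arrows (v # w # p)))) =
      lord L x + int (length (path_arrows (v # w # p)))"
      using lord_arrow[OF M x] conjunct2[OF N(2), rule_format, OF x] by (simp split: if_splits)
  qed (use N in auto)
qed auto

text \<open>Following representatives along a closed path leads from \<open>L\<close> to some c L.
  This shifts the exponent of every vector by the same amount, so by \<open>lord_path\<close> the
  count is the length of the path minus \<open>vord c\<close> for every line.\<close>

lemma closed_path_count: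
  assumes p: "is_bt_path p" "hd p = last p"
  shows "\<exists>k. \<forall>G\<in>lines. length (filter (\<lambda>e. G \<in> lines_in e) (path_arrows p)) = k"
proof -
  have "hd p \<in> vertices" using p(1) by (cases p) (auto simp: is_bt_path_def)
  then obtain L where L: "L \<in> lattices" "hd p = sim_class L" using vertices_iff by blast
  obtain M where M': "M \<in> lattices" "last p = sim_class M \<and> (\<forall>x. x \<noteq> 0 \<longrightarrow>
    lord M x + int (length (filter (\<lambda>e. line x \<in> lines_in e) (path_arrows p))) = lord L x + int (length (path_arrows p)))"
    using lord_path[OF p(1) L] by (rule bexE)
  note M = M'(1) conjunct1[OF M'(2)] conjunct2[OF M'(2), rule_format]
  obtain c where c: "c \<noteq> 0" "M = lscale c L" using sim_class_eq_iff[of L M] L(2) M(2) p(2) by auto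
  have "length (filter (\<lambda>e. G \<in> lines_in e) (path_arrows p)) = nat (int (length (path_arrows p)) - vord c)" if G: "G \<in> lines" for G
  proof -
    obtain x where x: "x \<in> L - lscale unif L" "G = line x" using G lines_prim[OF L(1)] by blast
    have x0: "x \<noteq> 0" using prim_nonzero[OF lattice_omod[OF L(1)] x(1)] .
    have "lscale unif M = lscale c (lscale unif L)" using c by (simp add: lscale_lscale mult.commute)
    then have "c *s x \<in> M - lscale unif M" using x(1) c by simp
    then have "lord M x = vord c" using lord_eqI[OF lattice_omod[OF M(1)] c(1)] by blast
    then show ?thesis using M(3)[OF x0] lord_prim[OF lattice_omod[OF L(1)] x(1)] x(2) by simp
  qed
  then show ?thesis by blast
qed


section \<open>Arrows of type one\<close>

text \<open>The points of the projective space of L/\<pi>L, each as a submodule of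
  \<open>L\<close>.\<close>

definition pts :: "('k::nonarch_local_field ^ 'n) set \<Rightarrow> ('k ^ 'n) set set" where
  "pts L = (\<lambda>x. cyc x (lscale unif L)) ` (L - lscale unif L)"

lemma pts_betw:
  fixes L :: "('k::nonarch_local_field ^ 'n::finite) set"
  assumes rank: "2 \<le> CARD('n)" and L: "L \<in> lattices"
  shows "pts L \<subseteq> betw L"
proof
  fix W assume "W \<in> pts L"
  then obtain x where x: "x \<in> L" "x \<notin> lscale unif L" "W = cyc x (lscale unif L)" by (auto simp: pts_def)
  have o: "omod L" "omod (lscale unif L)" using lattice_omod[OF L] omod_lscale by auto
  have "W \<subseteq> L" unfolding x cyc_subset[OF o(2,1)] using x lscale_unif_subset[OF o(1)] by blast
  moreover have "W \<noteq> L" using cyc_proper[OF rank L] x by blast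
  moreover have "lscale unif L \<subseteq> W" "x \<in> W" "omod W" unfolding x using cyc_superset cyc_self[OF o(2)] omod_cyc[OF o(2)] by auto
  ultimately show "W \<in> betw L" using x unfolding betw_def by blast
qed

lemma arrows_from_type_eq:
  fixes L :: "('k::nonarch_local_field ^ 'n::finite) set"
  assumes L: "L \<in> lattices"
  shows "arrows_from_type (sim_class L) t = arr L ` {M \<in> betw L. has_residue_dim L M t}"
  unfolding arrows_from_type_def arrows_from_eq[OF L]
  using arrow_type_iff[OF arrow_rep_arr[OF L, THEN iffD2]] by blast

lemma pts_eq:
  fixes L :: "('k::nonarch_local_field ^ 'n::finite) set"
  assumes rank: "2 \<le> CARD('n)" and L: "L \<in> lattices"
  shows "{M \<in> betw L. has_residue_dim L M 1} = pts L"
proof -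
  have "has_residue_dim L M 1 \<longleftrightarrow> M \<in> pts L" if "M \<in> betw L" for M
    using residue_dim_1_iff[OF lattice_omod[OF L], of M] that by (auto simp: betw_def pts_def)
  then show ?thesis using pts_betw[OF rank L] by blast
qed

lemma arrows_from_type1:
  fixes L :: "('k::nonarch_local_field ^ 'n::finite) set"
  assumes rank: "2 \<le> CARD('n)" and L: "L \<in> lattices"
  shows "arrows_from_type (sim_class L) 1 = arr L ` pts L"
  using arrows_from_type_eq[OF L, of 1] pts_eq[OF rank L] by simp

lemma arrows_prec_eq:
  fixes L :: "('k::nonarch_local_field ^ 'n::finite) set"
  assumes rank: "2 \<le> CARD('n)" and L: "L \<in> lattices" and M: "M \<in> betw L"
  shows "{e'. e' \<in> arrows_from_type (sim_class L) 1 \<and> arrow_prec e' (arr L M)} = arr L ` {W \<in> pts L. W \<subseteq> M}"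
proof -
  have "arrow_prec (arr L W) (arr L M) \<longleftrightarrow> W \<subseteq> M" if "W \<in> pts L" for W
    using that pts_betw[OF rank L] M arrow_rep_arr[OF L] by (intro arrow_prec_iff) auto
  then show ?thesis unfolding arrows_from_type1[OF rank L] by blast
qed

lemma sum_arr:
  assumes L: "L \<in> lattices" and S: "S \<subseteq> betw L"
  shows "(\<Sum>e\<in>arr L ` S. \<phi> e) = (\<Sum>M\<in>S. \<phi> (arr L M))"
  using sum.reindex[OF inj_on_subset[OF inj_on_arr[OF L] S], of \<phi>] by simp

lemma pts_mem_eq:
  assumes "omod L" "W \<in> pts L" "x \<in> W" "x \<notin> lscale unif L"
  shows "W = cyc x (lscale unif L)"
proof -
  obtain z where z: "z \<in> L" "W = cyc z (lscale unif L)" using assms(2) by (auto simp: pts_def)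
  then show ?thesis using cyc_eq[OF omod_lscale[OF assms(1)], of x z unif] assms by simp
qed


section \<open>From distributions to cochains\<close>

definition cochain_of ::
    "(('k::nonarch_local_field ^ 'n::finite) set set \<Rightarrow> 'a::ab_group_add) \<Rightarrow> ('k, 'n) arrow \<Rightarrow> 'a" where
  "cochain_of \<delta> e = (if e \<in> arrows then \<delta> (lines_in e) else 0)"

text \<open>Condition (C): the line of a primitive \<open>x\<close> in \<open>M\<close> belongs to
  exactly one of the sets on the right, the one given by the point O x + \<pi>L. So the union is
  disjoint.\<close>

lemma cochain_of_prec:
  fixes L :: "('k::nonarch_local_field ^ 'n::finite) set"
  assumes rank: "2 \<le> CARD('n)" and d: "\<delta> \<in> distributions" and L: "L \<in> lattices" and M: "M \<in> betw L"
  shows "\<delta> (lines_in (arr L M)) = (\<Sum>W | W \<in> pts L \<and> W \<subseteq> M. \<delta> (lines_in (arr L W)))"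
proof -
  let ?I = "{W \<in> pts L. W \<subseteq> M}" and ?N = "lscale unif L"
  have o: "omod L" "omod ?N" "omod M" "M \<subseteq> L" using lattice_omod[OF L] omod_lscale M by (auto simp: betw_def)
  have IB: "?I \<subseteq> betw L" using pts_betw[OF rank L] by blast
  have r: "arrow_rep (arr L W) L W" if "W \<in> ?I" for W using that IB arrow_rep_arr[OF L] by blast
  have rM: "arrow_rep (arr L M) L M" using M arrow_rep_arr[OF L] by blast
  have mem: "line x \<in> lines_in (arr L W) \<longleftrightarrow> x \<in> W" if "W \<in> ?I" "x \<in> L - ?N" for W x
    using lines_in_iff[OF r[OF that(1)] that(2)] .
  have l: "lines = line ` (L - ?N)" using lines_prim[OF L] .
  have sub: "lines_in e \<subseteq> lines" for e :: "('k, 'n) arrow" by (auto simp: lines_in_def)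
  have "lines_in (arr L M) = \<Union> ((\<lambda>W. lines_in (arr L W)) ` ?I)"
  proof (intro equalityI subsetI)
    fix G assume G: "G \<in> lines_in (arr L M)"
    then obtain x where x: "x \<in> L - ?N" "G = line x" using sub l by blast
    then have xM: "x \<in> M" using G lines_in_iff[OF rM] by blast
    have "cyc x ?N \<subseteq> M" using cyc_subset[OF o(2,3)] xM M by (auto simp: betw_def)
    then have W: "cyc x ?N \<in> ?I" using x by (auto simp: pts_def)
    then have "G \<in> lines_in (arr L (cyc x ?N))" using mem[OF W x(1)] cyc_self[OF o(2)] x by simp
    then show "G \<in> \<Union> ((\<lambda>W. lines_in (arr L W)) ` ?I)" using W by blast
  next
    fix G assume "G \<in> \<Union> ((\<lambda>W. lines_in (arr L W)) ` ?I)"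
    then obtain W where W: "W \<in> ?I" "G \<in> lines_in (arr L W)" by blast
    then obtain x where x: "x \<in> L - ?N" "G = line x" using sub l by blast
    then have "x \<in> M" using W mem by blast
    then show "G \<in> lines_in (arr L M)" using x lines_in_iff[OF rM] by blast
  qed
  moreover have "\<delta> (\<Union> ((\<lambda>W. lines_in (arr L W)) ` ?I)) = (\<Sum>W\<in>?I. \<delta> (lines_in (arr L W)))"
  proof (rule distribution_indexed_union[OF d])
    show "finite ?I" using finite_subset[OF IB finite_betw[OF L]] .
    show "lines_in (arr L W) \<in> compact_open" if "W \<in> ?I" for W
      using lines_in_compact_open arrow_rep_arrow[OF r[OF that]] by blast
    show "lines_in (arr L W) \<noteq> {}" if "W \<in> ?I" for W
    proof -
      obtain x where "x \<in> L - ?N" "W = cyc x ?N" using \<open>W \<in> ?I\<close> by (auto simp: pts_def)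
      then show ?thesis using mem[OF that] cyc_self[OF o(2)] by blast
    qed
    show "lines_in (arr L W) \<inter> lines_in (arr L W') = {}" if W: "W \<in> ?I" "W' \<in> ?I" "W \<noteq> W'" for W W'
    proof (rule ccontr)
      assume "lines_in (arr L W) \<inter> lines_in (arr L W') \<noteq> {}"
      then obtain G where G: "G \<in> lines_in (arr L W)" "G \<in> lines_in (arr L W')" by blast
      then obtain x where x: "x \<in> L - ?N" "G = line x" using sub[of "arr L W"] l by blast
      note x = x(1) G[unfolded x(2)]
      then have "x \<in> W" "x \<in> W'" using mem W by blast+
      then show False using W pts_mem_eq[OF o(1)] x(1) by blast
    qed
  qed
  ultimately show ?thesis by simp
qed

text \<open>Some coordinate \<open>x $ i\<close> of a primitive vector is a unit. With w = (1,...,1)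
  - x, adding \<open>v $ i / x $ i\<close> times \<open>w\<close> to \<open>v\<close> sends
  \<open>x\<close> to (1,...,1), a primitive target that singles out no coordinate.\<close>

lemma prim_transitive_std:
  fixes x :: "'k::nonarch_local_field ^ 'n::finite"
  assumes x: "x \<in> prim"
  shows "\<exists>f. linaut f \<and> f ` oball 0 = (oball 0 :: ('k ^ 'n) set) \<and> f x = (\<chi> i. 1)"
proof -
  obtain i where i: "\<not> vge 1 (x $ i)" using x by (auto simp: oball_def)
  have xi: "x $ i \<in> integers" using x by (auto simp: oball_def integers_iff_vge)
  from xi have u: "x $ i \<noteq> 0" "vord (x $ i) = 0" using i integer_unit_cases by blast+
  define w where "w = (\<chi> i. 1) - x"
  have w: "w \<in> oball 0" unfolding w_def using x by (intro omod_diff[OF omod_oball]) (auto simp: oball_def vge_def)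
  have wi: "w $ i = 1 - x $ i" by (simp add: w_def)
  define f where "f v = v + (v $ i / x $ i) *s w" for v
  \<comment> \<open>From \<open>w $ i = 1 - x $ i\<close> one gets (g v) $ i = x $ i * v $ i, so
    \<open>g\<close> inverts \<open>f\<close>; it is integral too.\<close>
  define g where "g v = v - (v $ i) *s w" for v
  have fg: "f (g v) = v" "g (f v) = v" for v
    using u by (simp_all add: f_def g_def vec_eq_iff wi field_simps)
  have "linaut f" unfolding linaut_def
  proof (intro conjI allI)
    show "bij f" using fg by (intro o_bij[of g]) auto
  qed (simp_all add: f_def vec_eq_iff field_simps add_divide_distrib)
  moreover have "f ` oball 0 \<subseteq> oball 0" "g ` oball 0 \<subseteq> oball 0"
  proof -
    have "f v \<in> oball 0" "g v \<in> oball 0" if v: "v \<in> oball 0" for v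
    proof -
      have vi: "v $ i \<in> integers" using v by (auto simp: oball_def integers_iff_vge)
      then have "v $ i / x $ i \<in> integers" using integers_mult[OF vi inverse_unit_integer[OF u]] by (simp add: divide_inverse)
      then show "f v \<in> oball 0" unfolding f_def using v w by (intro omod_add[OF omod_oball] omod_scale[OF omod_oball])
      show "g v \<in> oball 0" unfolding g_def using v w vi by (intro omod_diff[OF omod_oball] omod_scale[OF omod_oball])
    qed
    then show "f ` oball 0 \<subseteq> oball 0" "g ` oball 0 \<subseteq> oball 0" by auto
  qed
  then have "f ` oball 0 = oball 0" using fg by (metis image_subset_iff subsetI subset_antisym imageI)
  moreover have "f x = (\<chi> i. 1)" using u by (simp add: f_def w_def)
  ultimately show ?thesis by blast
qed

lemma linaut_comp: "linaut f \<Longrightarrow> linaut g \<Longrightarrow> linaut (\<lambda>x. f (g x))"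
  unfolding linaut_def using bij_comp[of g f] by (auto simp: comp_def)

lemma prim_transitive:
  fixes L :: "('k::nonarch_local_field ^ 'n::finite) set"
  assumes L: "L \<in> lattices"
  obtains x0 where "\<And>x. x \<in> L - lscale unif L \<Longrightarrow> \<exists>f. linaut f \<and> f ` L = L \<and> f x = x0"
proof -
  obtain h where h: "linaut h" "L = h ` oball 0" using lattice_linaut[OF L] by (auto simp: std_lattice_oball)
  have l: "lscale unif L = h ` oball 1" using h by (simp add: linaut_lscale[symmetric] unif_std)
  have "\<exists>f. linaut f \<and> f ` L = L \<and> f x = h (\<chi> i. 1)" if x: "x \<in> L - lscale unif L" for x
  proof -
    obtain y where y: "x = h y" "y \<in> prim" using x h l by auto
    obtain f where f: "linaut f" "f ` oball 0 = oball 0" "f y = (\<chi> i. 1)" using prim_transitive_std[OF y(2)] by blast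
    have inv: "inv_into UNIV h (h v) = v" for v using h(1) by (simp add: linaut_def bij_is_inj)
    have "(\<lambda>v. h (f (inv_into UNIV h v))) ` L = h ` f ` inv_into UNIV h ` h ` oball 0" unfolding h(2) by (simp add: image_image)
    also have "\<dots> = L" using f(2) h(2) linaut_image_inv(1)[OF h(1)] by simp
    finally have "(\<lambda>v. h (f (inv_into UNIV h v))) ` L = L" .
    then show ?thesis using linaut_comp[OF h(1) linaut_comp[OF f(1) linaut_inv[OF h(1)]]] f(3) y(1) inv
      by (intro exI[of _ "\<lambda>v. h (f (inv_into UNIV h v))"]) simp
  qed
  then show ?thesis by (rule that)
qed

lemma linaut_betw:
  assumes f: "linaut f" and M: "M \<in> betw L" shows "f ` M \<in> betw (f ` L)"
proof -
  have *: "A \<subset> B \<Longrightarrow> f ` A \<subset> f ` B" for A B using linaut_mem[OF f] by blast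
  show ?thesis using M linaut_omod[OF f] * unfolding betw_def linaut_lscale[OF f, symmetric] by blast
qed

text \<open>Automorphisms of \<open>L\<close> permute its submodules, preserve residue dimensions
  and are transitive on primitive vectors. Thus the arrows of type \<open>t\<close> from [L] cover
  every line equally often, which gives (B).\<close>

lemma card_betw_const:
  fixes L :: "('k::nonarch_local_field ^ 'n::finite) set"
  assumes L: "L \<in> lattices"
  shows "\<exists>k. \<forall>x\<in>L - lscale unif L. card {M \<in> betw L. has_residue_dim L M t \<and> x \<in> M} = k"
proof -
  define S where "S x = {M \<in> betw L. has_residue_dim L M t \<and> x \<in> M}" for x
  have fin: "finite (S x)" for x unfolding S_def by (rule finite_subset[OF _ finite_betw[OF L]]) blast
  have le: "card (S x) \<le> card (S (f x))" if f: "linaut f" "f ` L = L" for f x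
  proof (rule card_inj_on_le[of "(`) f"])
    have "inj f" using f(1) by (simp add: linaut_def bij_is_inj)
    then show "inj_on ((`) f) (S x)" by (meson inj_on_def inj_image_eq_iff)
    show "(`) f ` S x \<subseteq> S (f x)"
      unfolding S_def using linaut_betw[OF f(1), of _ L] residue_dim_image[OF f(1), of L] f(2) by auto
  qed (rule fin)
  obtain x0 where x0: "\<And>x. x \<in> L - lscale unif L \<Longrightarrow> \<exists>f. linaut f \<and> f ` L = L \<and> f x = x0" using prim_transitive[OF L] by blast
  have "card (S x) = card (S x0)" if x: "x \<in> L - lscale unif L" for x
  proof -
    obtain f where f: "linaut f" "f ` L = L" "f x = x0" using x0[OF x] by blast
    have "inv_into UNIV f ` L = L" using linaut_image_inv(1)[OF f(1), of L] f(2) by simp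
    moreover have "inv_into UNIV f x0 = x" using f by (metis linaut_def bij_is_inj inv_f_f)
    ultimately show ?thesis using le[OF f(1,2), of x] le[OF linaut_inv[OF f(1)], of x0] f(3) by simp
  qed
  then show ?thesis unfolding S_def by blast
qed

lemma cochain_of_harmonic:
  fixes \<delta> :: "('k::nonarch_local_field ^ 'n::finite) set set \<Rightarrow> 'a::ab_group_add"
  assumes rank: "2 \<le> CARD('n)" and d: "\<delta> \<in> distributions0"
  shows "cochain_of \<delta> \<in> harmonic_building"
  unfolding harmonic_building_def
proof (intro CollectI conjI allI impI ballI)
  fix e :: "('k, 'n) arrow" assume "e \<notin> arrows" then show "cochain_of \<delta> e = 0" by (simp add: cochain_of_def)
next
  fix p :: "('k, 'n) vertex list" assume p: "is_bt_path p \<and> hd p = last p"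
  obtain k where k: "\<And>G. G \<in> lines \<Longrightarrow> length (filter (\<lambda>e. G \<in> lines_in e) (path_arrows p)) = k"
    using closed_path_count p by blast
  let ?as = "path_arrows p"
  have as: "i < length ?as \<Longrightarrow> ?as ! i \<in> arrows" for i using p unfolding is_bt_path_def by (metis nth_mem subsetD)
  \<comment> \<open>The family is indexed by positions, because a path may run through the same
    arrow several times.\<close>
  have "(\<Sum>i<length ?as. \<delta> (lines_in (?as ! i))) = 0"
  proof (rule distribution0_sum_const[OF d, of _ _ k])
    show "\<And>i. i \<in> {..<length ?as} \<Longrightarrow> lines_in (?as ! i) \<in> compact_open"
      using as lines_in_compact_open by blast
    show "\<And>G. G \<in> lines \<Longrightarrow> card {i \<in> {..<length ?as}. G \<in> lines_in (?as ! i)} = k"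
      using k by (simp add: length_filter_conv_card)
  qed simp
  moreover have "sum_list (map (cochain_of \<delta>) ?as) = (\<Sum>i<length ?as. \<delta> (lines_in (?as ! i)))"
    unfolding sum_list_sum_nth using as by (intro sum.cong) (auto simp: cochain_of_def)
  ultimately show "sum_list (map (cochain_of \<delta>) ?as) = 0" by simp
next
  fix v :: "('k, 'n) vertex" and t assume v: "v \<in> vertices"
  then obtain L where L: "L \<in> lattices" "v = sim_class L" using vertices_iff by blast
  let ?S = "{M \<in> betw L. has_residue_dim L M t}"
  have r: "arrow_rep (arr L M) L M" if "M \<in> betw L" for M using that arrow_rep_arr[OF L(1)] by blast
  obtain k where k: "\<And>x. x \<in> L - lscale unif L \<Longrightarrow> card {M \<in> betw L. has_residue_dim L M t \<and> x \<in> M} = k"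
    using card_betw_const[OF L(1)] by meson
  have "(\<Sum>e\<in>arrows_from_type v t. cochain_of \<delta> e) = (\<Sum>M\<in>?S. cochain_of \<delta> (arr L M))"
    unfolding L(2) arrows_from_type_eq[OF L(1)] by (rule sum_arr[OF L(1)]) blast
  also have "\<dots> = (\<Sum>M\<in>?S. \<delta> (lines_in (arr L M)))"
    using arrow_rep_arrow[OF r] by (intro sum.cong) (auto simp: cochain_of_def)
  also have "\<dots> = 0"
  proof (rule distribution0_sum_const[OF d, of _ _ k])
    show "finite ?S" by (rule finite_subset[OF _ finite_betw[OF L(1)]]) blast
    show "\<And>M. M \<in> ?S \<Longrightarrow> lines_in (arr L M) \<in> compact_open" using r arrow_rep_arrow lines_in_compact_open by blast
    fix G :: "('k ^ 'n) set" assume "G \<in> lines"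
    then obtain x where x: "x \<in> L - lscale unif L" "G = line x" using lines_prim[OF L(1)] by blast
    have "{M \<in> ?S. G \<in> lines_in (arr L M)} = {M \<in> betw L. has_residue_dim L M t \<and> x \<in> M}"
      using lines_in_iff[OF r x(1)] x(2) by blast
    then show "card {M \<in> ?S. G \<in> lines_in (arr L M)} = k" using k[OF x(1)] by simp
  qed
  finally show "(\<Sum>e\<in>arrows_from_type v t. cochain_of \<delta> e) = 0" .
next
  fix v and e :: "('k, 'n) arrow" assume v: "v \<in> vertices" and e: "e \<in> arrows_from v"
  then obtain L where L: "L \<in> lattices" "v = sim_class L" using vertices_iff by blast
  obtain M where M: "M \<in> betw L" "e = arr L M" using e arrows_from_eq[OF L(1)] L(2) by blast
  have r: "arr L M \<in> arrows" if "M \<in> betw L" for M using that arrow_rep_arr[OF L(1)] arrow_rep_arrow by blast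
  have "cochain_of \<delta> e = (\<Sum>W | W \<in> pts L \<and> W \<subseteq> M. \<delta> (lines_in (arr L W)))"
    using cochain_of_prec[OF rank _ L(1) M(1), of \<delta>] d r[OF M(1)] M(2) by (simp add: cochain_of_def distributions0_def)
  also have "\<dots> = (\<Sum>W | W \<in> pts L \<and> W \<subseteq> M. cochain_of \<delta> (arr L W))"
    using r pts_betw[OF rank L(1)] by (intro sum.cong) (auto simp: cochain_of_def)
  also have "\<dots> = (\<Sum>e' | e' \<in> arrows_from_type v 1 \<and> arrow_prec e' e. cochain_of \<delta> e')"
    unfolding L(2) M(2) arrows_prec_eq[OF rank L(1) M(1)]
    using pts_betw[OF rank L(1)] by (intro sum_arr[OF L(1), symmetric]) blast
  finally show "cochain_of \<delta> e = (\<Sum>e' | e' \<in> arrows_from_type v 1 \<and> arrow_prec e' e. cochain_of \<delta> e')" .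
qed

section \<open>The tree\<close>

lemma lscale_powi_oball: "lscale (unif powi k) (oball n) = oball (n + k)"
  by (simp add: lscale_oball vord_powi)

text \<open>O x + \<pi>(O x + \<pi>^n O^r) is O x + \<pi>^(n+1) O^r, as \<pi>x is already in O x. So
  raising the level follows an arrow of type 1.\<close>

lemma tlat_Suc_eq:
  assumes x: "x \<in> prim"
  shows "tlat (Suc n) x = cyc x (lscale unif (tlat n x))"
proof -
  have l: "lscale unif (tlat n x) = cyc (unif *s x) (oball (int (Suc n)))"
    by (simp add: lscale_cyc lscale_oball vord_unif add.commute)
  have o: "omod (tlat (Suc n) x)" "omod (lscale unif (tlat n x))" by (simp_all add: omod_cyc omod_lscale)
  show ?thesis
  proof
    show "tlat (Suc n) x \<subseteq> cyc x (lscale unif (tlat n x))"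
      unfolding l by (rule cyc_mono[OF cyc_superset])
    have "unif *s x \<in> tlat (Suc n) x" by (rule omod_scale[OF o(1) integers_unif tlat_self])
    then have "lscale unif (tlat n x) \<subseteq> tlat (Suc n) x"
      unfolding l cyc_subset[OF omod_oball o(1)] using cyc_superset by blast
    then show "cyc x (lscale unif (tlat n x)) \<subseteq> tlat (Suc n) x"
      unfolding cyc_subset[OF o(2,1)] using tlat_self by blast
  qed
qed

lemma tlats_through:
  assumes "P \<in> tlats n" "x \<in> P" "x \<in> prim" shows "P = tlat n x"
proof (cases "1 \<le> n")
  case True
  then show ?thesis using tlats_mem_eq assms by blast
next
  case False
  then have "n = 0" by simp
  then show ?thesis using assms tlats_0[of P] tlat_0[OF assms(3)] by simp
qed

lemma tlats_scaled_sub: "P \<in> tlats n \<Longrightarrow> lscale unif P \<subseteq> oball 1"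
  using lscale_mono[of P "oball 0" unif] tlats_bounds by (auto simp: unif_std)

lemma child_pts:
  assumes P: "P \<in> tlats n" and M: "M \<in> tlats (Suc n)" "M \<subseteq> P"
  shows "M \<in> pts P"
proof -
  obtain x where x: "x \<in> prim" "x \<in> M" "M = tlat (Suc n) x" using tlats_prim_ex[OF M(1)] by blast
  then have "P = tlat n x" using P M(2) by (intro tlats_through) auto
  then have "M = cyc x (lscale unif P)" using tlat_Suc_eq[OF x(1)] x by simp
  moreover have "x \<in> P - lscale unif P" using x M tlats_scaled_sub[OF P] by blast
  ultimately show ?thesis by (auto simp: pts_def)
qed

lemma tlats_lattice: "M \<in> tlats n \<Longrightarrow> M \<in> lattices"
  by (auto simp: tlats_def)

lemma child_rep:
  fixes P :: "('k::nonarch_local_field ^ 'n::finite) set"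
  assumes rank: "2 \<le> CARD('n)" and P: "P \<in> tlats n" and M: "M \<in> tlats (Suc n)" "M \<subseteq> P"
  shows "arrow_rep (arr P M) P M"
  using child_pts[OF P M] pts_betw[OF rank tlats_lattice[OF P]] arrow_rep_arr[OF tlats_lattice[OF P]] by blast

lemma child_type1:
  fixes P :: "('k::nonarch_local_field ^ 'n::finite) set"
  assumes rank: "2 \<le> CARD('n)" and P: "P \<in> tlats n" and M: "M \<in> tlats (Suc n)" "M \<subseteq> P"
  shows "arrow_type (arr P M) = 1"
  using arrow_type_1_iff[OF child_rep[OF rank P M]] child_pts[OF P M] by (auto simp: pts_def)

text \<open>An element a x + \<pi>^(n+1) u of \<open>M\<close> lies in \<pi>O^r only if \<pi>
  divides \<open>a\<close>, and then it lies in \<pi>P. Therefore the lines of the arrow from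
  \<open>P\<close> to \<open>M\<close> form exactly the cell of \<open>M\<close>.\<close>

lemma child_diff:
  assumes P: "P \<in> tlats n" and M: "M \<in> tlats (Suc n)" "M \<subseteq> P"
  shows "M - lscale unif P = M - oball 1"
proof -
  obtain x where x: "x \<in> prim" "x \<in> M" "M = tlat (Suc n) x" using tlats_prim_ex[OF M(1)] by blast
  then have Pt: "P = tlat n x" using P M(2) by (intro tlats_through) auto
  have "y \<in> lscale unif P" if y: "y \<in> M" "y \<in> oball 1" for y
  proof -
    obtain a where a: "a \<in> integers" "y - a *s x \<in> oball (int (Suc n))" using y x(3) by (auto simp: cyc_def)
    have "y - a *s x \<in> oball 1" using a(2) oball_mono[of 1 "int (Suc n)"] by auto
    then have "a *s x \<in> oball 1" using omod_close[OF omod_oball] y(2) by blast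
    then have "\<not> (a \<noteq> 0 \<and> vord a = 0)" using prim_unit_scale[OF x(1), of a] by blast
    then have "vge 1 a" using a(1) integer_unit_cases by blast
    then obtain b where b: "b \<in> integers" "a = unif * b" unfolding vge_1_iff by blast
    have "y - b *s (unif *s x) \<in> oball (int (Suc n))" using a(2) b(2) by (simp add: mult.commute)
    moreover have "lscale unif P = cyc (unif *s x) (oball (int (Suc n)))"
      unfolding Pt by (simp add: lscale_cyc lscale_oball vord_unif add.commute)
    ultimately show ?thesis using b(1) unfolding cyc_def by blast
  qed
  then show ?thesis using tlats_scaled_sub[OF P] by blast
qed

lemma lines_in_child:
  fixes P :: "('k::nonarch_local_field ^ 'n::finite) set"
  assumes rank: "2 \<le> CARD('n)" and P: "P \<in> tlats n" and M: "M \<in> tlats (Suc n)" "M \<subseteq> P"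
  shows "lines_in (arr P M) = cell M"
  using lines_in_rep[OF child_rep[OF rank P M]] child_diff[OF P M] by (simp add: cell_def)

text \<open>Otherwise \<pi>^(n-1) O^r would be O z + \<pi>^n O^r with z = \<pi>^(n-1) x, against
  \<open>cyc_proper\<close>. So the level can be read off from the balls contained in the lattice;
  this bounds distances from below.\<close>

lemma ball_in_tlat:
  fixes x :: "'k::nonarch_local_field ^ 'n::finite"
  assumes rank: "2 \<le> CARD('n)" and x: "x \<in> prim" and k: "oball k \<subseteq> tlat n x"
  shows "int n \<le> k"
proof (rule ccontr)
  assume "\<not> int n \<le> k"
  define j where "j = int n - 1"
  have j: "oball j \<subseteq> tlat n x" "int n = j + 1" using k oball_mono[of k j] \<open>\<not> int n \<le> k\<close> by (auto simp: j_def)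
  define z where "z = unif powi j *s x"
  have "oball j \<subseteq> cyc z (oball (j + 1))"
  proof
    fix v :: "'k ^ 'n" assume v: "v \<in> oball j"
    then obtain a where a: "v - a *s x \<in> oball (j + 1)" using j by (auto simp: cyc_def)
    then have "v - a *s x \<in> oball j" using oball_mono[of j "j + 1"] by auto
    then have ax: "a *s x \<in> oball j" using v omod_close[OF omod_oball] by blast
    have "vge j a"
    proof (cases "a = 0")
      case False
      then have "x \<in> oball (j - vord a)" using ax oball_scale_iff by blast
      then have "\<not> 1 \<le> j - vord a" using x oball_mono[of 1 "j - vord a"] by blast
      then show ?thesis by (simp add: vge_def)
    qed simp
    then have b: "a * unif powi (- j) \<in> integers"
      by (simp add: integers_iff_vge mult.commute[of a] vge_times_iff vord_powi)
    have "(a * unif powi (- j)) *s z = a *s x" by (simp add: z_def power_int_minus)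
    then show "v \<in> cyc z (oball (j + 1))" using a b unfolding cyc_def by (intro CollectI bexI[of _ "a * unif powi (- j)"]) simp
  qed
  moreover have "cyc z (oball (j + 1)) \<subseteq> oball j"
    unfolding cyc_subset[OF omod_oball omod_oball] z_def oball_scale_iff[OF unif_powi_nonzero] vord_powi
    using x oball_mono[of j "j + 1"] by simp
  moreover have "lscale unif (oball j) = (oball (j + 1) :: ('k ^ 'n) set)" by (simp add: lscale_oball vord_unif)
  ultimately show False using cyc_proper[OF rank lattice_oball[of j], of z] by auto
qed

lemma ball_in_tlats:
  fixes M :: "('k::nonarch_local_field ^ 'n::finite) set"
  assumes rank: "2 \<le> CARD('n)" and "M \<in> tlats n" "oball k \<subseteq> M" shows "int n \<le> k"
  using ball_in_tlat[OF rank] assms unfolding tlats_def by blast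

lemma prim_scale_oball: "x \<in> prim \<Longrightarrow> c \<noteq> 0 \<Longrightarrow> c *s x \<in> oball n \<longleftrightarrow> n \<le> vord c"
proof -
  assume x: "x \<in> prim" and c: "c \<noteq> 0"
  have "x \<in> oball (n - vord c) \<longleftrightarrow> n - vord c \<le> 0"
    using x oball_mono[of "n - vord c" 0] oball_mono[of 1 "n - vord c"] by (cases "n - vord c \<le> 0") auto
  then show ?thesis unfolding oball_scale_iff[OF c] by simp
qed

lemma prim_powi: "x \<in> prim \<Longrightarrow> unif powi k *s x \<in> oball m \<longleftrightarrow> m \<le> k"
  by (simp only: prim_scale_oball[OF _ unif_powi_nonzero] vord_powi)

text \<open>Both lattices lie in O^r and contain a primitive vector, so the scaling exponent between
  them is neither negative nor positive. The level is then fixed by the balls inside.\<close>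

lemma tlats_sim_eq:
  fixes M :: "('k::nonarch_local_field ^ 'n::finite) set"
  assumes rank: "2 \<le> CARD('n)" and M: "M \<in> tlats n" "M' \<in> tlats m" "sim_class M = sim_class M'"
  shows "M = M' \<and> n = m"
proof -
  obtain k where k: "M' = lscale (unif powi k) M" using sim_class_eq_powi[OF tlats_omod[OF M(1)] M(3)] .
  obtain x y where x: "x \<in> prim" "x \<in> M" and y: "y \<in> prim" "y \<in> M'" using tlats_prim_ex M by meson
  have "unif powi k *s x \<in> M'" unfolding k using x(2) by simp
  then have "0 \<le> k" using prim_powi[OF x(1), of k 0] tlats_bounds[OF M(2)] by blast
  moreover have "inverse (unif powi k) *s y \<in> M" using y(2) unfolding k by (simp add: mem_lscale)
  then have "unif powi (- k) *s y \<in> M" by (simp add: power_int_minus)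
  then have "0 \<le> - k" using prim_powi[OF y(1), of "- k" 0] tlats_bounds[OF M(1)] by blast
  ultimately have "k = 0" by simp
  then have eq: "M = M'" using k by simp
  then have "int n \<le> int m" "int m \<le> int n"
    using ball_in_tlats[OF rank M(1), of "int m"] ball_in_tlats[OF rank M(2), of "int n"] tlats_bounds[OF M(1)] tlats_bounds[OF M(2)] by auto
  then show ?thesis using eq by simp
qed

section \<open>Distance from the base vertex and special vertices\<close>

definition reach :: "nat \<Rightarrow> ('k::nonarch_local_field, 'n::finite) vertex \<Rightarrow> bool" where
  "reach n v \<longleftrightarrow> (\<exists>p. is_bt_path p \<and> hd p = base_vertex \<and> last p = v \<and> length (path_arrows p) = n)"

lemma path_arrows_snoc: "p \<noteq> [] \<Longrightarrow> path_arrows (p @ [w]) = path_arrows p @ [(last p, w)]"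
  by (induction p rule: induct_list012) auto

lemma is_bt_path_snoc: "p \<noteq> [] \<Longrightarrow> is_bt_path (p @ [w]) \<longleftrightarrow> is_bt_path p \<and> (last p, w) \<in> arrows"
  by (induction p rule: induct_list012) (use arrow_vertices in auto)

lemma base_vertex_vertices: "base_vertex \<in> vertices"
  unfolding base_vertex_def vertices_iff using lattice_std by blast

lemma base_vertex_oball: "base_vertex = sim_class (oball 0)"
  by (simp add: base_vertex_def std_lattice_oball)

lemma reach_0: "reach 0 base_vertex"
  unfolding reach_def using base_vertex_vertices by (intro exI[of _ "[base_vertex]"]) simp

lemma reach_Suc: "reach n v \<Longrightarrow> (v, w) \<in> arrows \<Longrightarrow> reach (Suc n) w"
proof -
  assume "reach n v" and e: "(v, w) \<in> arrows"
  then obtain p where p: "is_bt_path p" "hd p = base_vertex" "last p = v" "length (path_arrows p) = n"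
    unfolding reach_def by blast
  then have "p \<noteq> []" by auto
  then show ?thesis unfolding reach_def using p e
    by (intro exI[of _ "p @ [w]"]) (simp add: is_bt_path_snoc path_arrows_snoc)
qed

lemma reach_lattice_gen:
  "is_bt_path p \<Longrightarrow> L \<in> lattices \<Longrightarrow> hd p = sim_class L \<Longrightarrow> oball (int k) \<subseteq> L \<Longrightarrow> L \<subseteq> oball 0 \<Longrightarrow>
   \<exists>M\<in>lattices. last p = sim_class M \<and> oball (int (k + length (path_arrows p))) \<subseteq> M \<and> M \<subseteq> oball 0"
proof (induction p arbitrary: L k rule: induct_list012)
  case (3 v w p)
  then have e: "(v, w) \<in> arrows" and p: "is_bt_path (w # p)" by auto
  obtain M where M: "arrow_rep (v, w) L M" using arrow_rep_at[OF e 3(4)] 3(5) by auto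
  then have M': "M \<in> lattices" "hd (w # p) = sim_class M" "M \<subseteq> L" "lscale unif L \<subseteq> M" by (auto simp: arrow_rep_def)
  have "oball (int (Suc k)) \<subseteq> lscale unif L" using lscale_mono[OF 3(6), of unif] by (simp add: lscale_oball vord_unif add.commute)
  then have "oball (int (Suc k)) \<subseteq> M" "M \<subseteq> oball 0" using M' 3(7) by blast+
  from 3(2)[OF p M'(1,2) this] show ?case by simp
qed auto

lemma reach_lattice:
  assumes "reach n v" shows "\<exists>L\<in>lattices. v = sim_class L \<and> oball (int n) \<subseteq> L \<and> L \<subseteq> oball 0"
proof -
  obtain p where p: "is_bt_path p" "hd p = base_vertex" "last p = v" "length (path_arrows p) = n"
    using assms unfolding reach_def by blast
  show ?thesis using reach_lattice_gen[OF p(1) lattice_oball[of 0], of 0] p by (simp add: base_vertex_oball)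
qed

text \<open>Induction through L' = L + \<pi>^m O^r: it contains \<pi>^m O^r, and \<pi>L' \<subseteq>
  L \<subseteq> L', so at most one arrow leads from its class to that of \<open>L\<close>.\<close>

lemma lattice_reach:
  fixes L :: "('k::nonarch_local_field ^ 'n::finite) set"
  shows "L \<in> lattices \<Longrightarrow> oball (int m) \<subseteq> L \<Longrightarrow> L \<subseteq> oball 0 \<Longrightarrow> \<exists>n\<le>m. reach n (sim_class L)"
proof (induction m arbitrary: L)
  case 0
  then have "L = oball 0" by auto
  then show ?case using reach_0 by (simp add: base_vertex_oball)
next
  case (Suc m)
  define L' where "L' = {z. \<exists>u\<in>L. z - u \<in> oball (int m)}"
  have oL: "omod L" using lattice_omod Suc.prems by blast
  have LL': "L \<subseteq> L'" unfolding L'_def using omod_0[OF omod_oball] by force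
  have bL': "oball (int m) \<subseteq> L'" unfolding L'_def using omod_0[OF oL] by force
  have L'0: "L' \<subseteq> oball 0"
  proof
    fix z assume "z \<in> L'"
    then obtain u where u: "u \<in> L" "z - u \<in> oball (int m)" unfolding L'_def by blast
    then have "z - u \<in> oball 0" using oball_mono[of 0 "int m"] by auto
    then show "z \<in> oball 0" using omod_close[OF omod_oball] u(1) Suc.prems by blast
  qed
  have oL': "omod L'"
    unfolding omod_def
  proof (intro conjI ballI)
    show "0 \<in> L'" using bL' omod_0[OF omod_oball] by blast
  next
    fix x y assume "x \<in> L'" "y \<in> L'"
    then obtain u w where u: "u \<in> L" "x - u \<in> oball (int m)" "w \<in> L" "y - w \<in> oball (int m)" unfolding L'_def by blast
    have "(x - u) + (y - w) \<in> oball (int m)" by (rule omod_add[OF omod_oball u(2,4)])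
    then have "(x + y) - (u + w) \<in> oball (int m)" by (simp add: algebra_simps)
    then show "x + y \<in> L'" unfolding L'_def using omod_add[OF oL u(1,3)] by blast
  next
    fix a :: 'k and x assume a: "a \<in> integers" "x \<in> L'"
    then obtain u where u: "u \<in> L" "x - u \<in> oball (int m)" unfolding L'_def by blast
    have "a *s (x - u) \<in> oball (int m)" by (rule omod_scale[OF omod_oball a(1) u(2)])
    then have "a *s x - a *s u \<in> oball (int m)" by (simp add: vec.scale_right_diff_distrib)
    then show "a *s x \<in> L'" unfolding L'_def using omod_scale[OF oL a(1) u(1)] by blast
  qed
  have lat': "L' \<in> lattices" by (rule lattice_sandwich[OF lattice_oball lattice_oball oL' bL' L'0])
  have "lscale unif L' \<subseteq> L"
  proof
    fix y assume "y \<in> lscale unif L'"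
    then obtain z where "z \<in> L'" "y = unif *s z" by (auto simp: lscale_def)
    then obtain u where u: "u \<in> L" "z - u \<in> oball (int m)" unfolding L'_def by blast
    have "unif *s (z - u) \<in> oball (int (Suc m))" using u(2) unfolding oball_scale_iff[OF unif_nz] vord_unif by simp
    then have "y - unif *s u \<in> L" using \<open>y = unif *s z\<close> Suc.prems(2) by (auto simp: vec.scale_right_diff_distrib)
    then show "y \<in> L" using omod_close[OF oL] omod_scale[OF oL integers_unif u(1)] by blast
  qed
  obtain n where n: "n \<le> m" "reach n (sim_class L')" using Suc.IH[OF lat' bL' L'0] by blast
  show ?case
  proof (cases "sim_class L = sim_class L'")
    \<comment> \<open>Similar lattices need no further arrow; this is why only
      \<open>n \<le> m\<close> is claimed.\<close>
    case True
    then show ?thesis using n by (intro exI[of _ n]) simp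
  next
    case False
    then have "L \<noteq> L'" "L \<noteq> lscale unif L'" by auto
    then have "L \<in> betw L'" using LL' \<open>lscale unif L' \<subseteq> L\<close> oL by (auto simp: betw_def)
    then have "arr L' L \<in> arrows" using arrow_rep_arr[OF lat'] arrow_rep_arrow by blast
    then show ?thesis using reach_Suc[OF n(2)] n(1) by (intro exI[of _ "Suc n"]) simp
  qed
qed

text \<open>A vertex reached in \<open>j\<close> steps has a representative \<pi>^k M inside O^r
  that contains \<pi>^j O^r. A primitive vector of \<open>M\<close> forces k \<ge> 0, so
  \<open>M\<close> contains \<pi>^j O^r as well, and n \<le> j.\<close>

lemma bt_dist_tlat:
  fixes M :: "('k::nonarch_local_field ^ 'n::finite) set"
  assumes rank: "2 \<le> CARD('n)" and M: "M \<in> tlats n"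
  shows "bt_dist base_vertex (sim_class M) = n"
proof -
  obtain m where m: "m \<le> n" "reach m (sim_class M)"
    using lattice_reach[OF tlats_lattice[OF M]] tlats_bounds[OF M] by blast
  have low: "n \<le> j" if r: "reach j (sim_class M)" for j
  proof -
    obtain L where L: "L \<in> lattices" "sim_class M = sim_class L" "oball (int j) \<subseteq> L" "L \<subseteq> oball 0"
      using reach_lattice[OF r] by blast
    obtain k where k: "L = lscale (unif powi k) M" using sim_class_eq_powi[OF tlats_omod[OF M] L(2)] .
    obtain x where x: "x \<in> prim" "x \<in> M" using tlats_prim_ex[OF M] by blast
    have "unif powi k *s x \<in> L" unfolding k using x(2) by simp
    then have "0 \<le> k" using prim_powi[OF x(1), of k 0] L(4) by blast
    then have "L \<subseteq> lscale 1 M" unfolding k by (intro lscale_vge_subset[OF tlats_omod[OF M]]) (auto simp: vge_def vord_powi)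
    then show "n \<le> j" using ball_in_tlats[OF rank M, of "int j"] L(3) by auto
  qed
  have "bt_dist base_vertex (sim_class M) = (LEAST j. reach j (sim_class M))" by (simp add: bt_dist_def reach_def)
  also have "\<dots> = m" using m low by (intro Least_equality) (auto intro: le_trans)
  also have "m = n" using m low by (simp add: le_antisym)
  finally show ?thesis .
qed

definition spath :: "nat \<Rightarrow> ('k::nonarch_local_field, 'n::finite) vertex \<Rightarrow> bool" where
  "spath n v \<longleftrightarrow> (\<exists>p. is_bt_path p \<and> hd p = base_vertex \<and> last p = v \<and> length (path_arrows p) = n \<and>
     (\<forall>e\<in>set (path_arrows p). arrow_type e = 1))"

lemma spath_0: "spath 0 v \<longleftrightarrow> v = base_vertex"
proof
  assume "spath 0 v"
  then obtain p where p: "is_bt_path p" "hd p = base_vertex" "last p = v" "length (path_arrows p) = 0" unfolding spath_def by blast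
  then obtain u q where q: "p = u # q" by (cases p) auto
  then have "q = []" using p(4) by (cases q) auto
  then show "v = base_vertex" using p q by simp
next
  assume "v = base_vertex"
  then show "spath 0 v" unfolding spath_def using base_vertex_vertices by (intro exI[of _ "[base_vertex]"]) simp
qed

lemma spath_Suc: "spath (Suc n) w \<longleftrightarrow> (\<exists>v. spath n v \<and> (v, w) \<in> arrows \<and> arrow_type (v, w) = 1)"
proof
  assume "spath (Suc n) w"
  then obtain p where p: "is_bt_path p" "hd p = base_vertex" "last p = w" "length (path_arrows p) = Suc n"
    "\<forall>e\<in>set (path_arrows p). arrow_type e = 1" unfolding spath_def by blast
  obtain q where q: "p = q @ [w]" using p(1,3) by (metis append_butlast_last_id not_bt_path_Nil)
  then have "q \<noteq> []" using p(4) by auto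
  note s = is_bt_path_snoc[OF this] path_arrows_snoc[OF this]
  have "spath n (last q)" unfolding spath_def using p \<open>q \<noteq> []\<close> unfolding q
    by (intro exI[of _ q]) (auto simp: s)
  moreover have "(last q, w) \<in> arrows" "arrow_type (last q, w) = 1" using p unfolding q by (auto simp: s)
  ultimately show "\<exists>v. spath n v \<and> (v, w) \<in> arrows \<and> arrow_type (v, w) = 1" by blast
next
  assume "\<exists>v. spath n v \<and> (v, w) \<in> arrows \<and> arrow_type (v, w) = 1"
  then obtain p v where p: "is_bt_path p" "hd p = base_vertex" "last p = v" "length (path_arrows p) = n"
    "\<forall>e\<in>set (path_arrows p). arrow_type e = 1" "(v, w) \<in> arrows" "arrow_type (v, w) = 1" unfolding spath_def by blast
  then have "p \<noteq> []" by auto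
  note s = is_bt_path_snoc[OF this] path_arrows_snoc[OF this]
  show "spath (Suc n) w" unfolding spath_def using p \<open>p \<noteq> []\<close>
    by (intro exI[of _ "p @ [w]"]) (auto simp: s)
qed

lemma spath_tlat:
  fixes M :: "('k::nonarch_local_field ^ 'n::finite) set"
  assumes rank: "2 \<le> CARD('n)"
  shows "M \<in> tlats n \<Longrightarrow> spath n (sim_class M)"
proof (induction n arbitrary: M)
  case 0
  then show ?case by (simp add: spath_0 tlats_0 base_vertex_oball)
next
  case (Suc n)
  then obtain P where P: "P \<in> tlats n" "M \<subseteq> P" using tlats_parent by blast
  show ?case unfolding spath_Suc
    using Suc.IH[OF P(1)] child_type1[OF rank P(1) Suc.prems P(2)] arrow_rep_arrow[OF child_rep[OF rank P(1) Suc.prems P(2)]] by blast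
qed

text \<open>The second alternative says that \<open>v\<close> lies at distance less than \<open>n\<close> from the base vertex.\<close>

lemma spath_cases:
  fixes v :: "('k::nonarch_local_field, 'n::finite) vertex"
  shows "spath n v \<Longrightarrow> (\<exists>M\<in>tlats n. v = sim_class M) \<or>
    (1 \<le> n \<and> (\<exists>L\<in>lattices. v = sim_class L \<and> oball (int n - 1) \<subseteq> L \<and> L \<subseteq> oball 0))"
proof (induction n arbitrary: v)
  case 0
  then show ?case by (simp add: spath_0 tlats_0 base_vertex_oball)
next
  case (Suc n)
  then obtain u where u: "spath n u" "(u, v) \<in> arrows" "arrow_type (u, v) = 1" unfolding spath_Suc by blast
  from Suc.IH[OF u(1)] show ?case
  proof
    assume "\<exists>M\<in>tlats n. u = sim_class M"
    then obtain P where P: "P \<in> tlats n" "u = sim_class P" by blast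
    obtain W where W: "arrow_rep (u, v) P W" using arrow_rep_at[OF u(2) tlats_lattice[OF P(1)]] P(2) by auto
    obtain y where y: "y \<in> P - lscale unif P" "W = cyc y (lscale unif P)" using arrow_type_1_iff[OF W] u(3) by blast
    have vW: "v = sim_class W" "W \<in> lattices" "lscale unif P \<subseteq> W" using W by (auto simp: arrow_rep_def)
    show ?thesis
    proof (cases "y \<in> oball 1")
      case False
      then have yp: "y \<in> prim" using y tlats_bounds[OF P(1)] by blast
      then have "P = tlat n y" using y P by (intro tlats_through) auto
      then have "W = tlat (Suc n) y" using tlat_Suc_eq[OF yp] y by simp
      then show ?thesis using vW tlat_tlats[OF yp] by blast
    next
      case True
      \<comment> \<open>The arrow turns back: \<open>W\<close> lies in \<pi>O^r, so it may be
        divided by \<pi>. The quotient contains \<open>P\<close>, hence \<pi>^n O^r, although the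
        path now has n + 1 arrows.\<close>
      define L where "L = lscale (inverse unif) W"
      have WL: "W = lscale unif L" by (simp add: L_def lscale_lscale)
      have L: "L \<in> lattices" "v = sim_class L" using vW by (simp_all add: L_def lattice_lscale)
      have "P \<subseteq> L" using vW(3) unfolding WL by (simp add: lscale_subset_iff)
      then have "oball (int n) \<subseteq> L" using tlats_bounds[OF P(1)] by blast
      moreover have "W \<subseteq> oball 1" unfolding y cyc_subset[OF omod_lscale[OF tlats_omod[OF P(1)]] omod_oball]
        using True tlats_scaled_sub[OF P(1)] by blast
      then have "lscale unif L \<subseteq> lscale unif (oball 0)" unfolding WL unif_std .
      then have "L \<subseteq> oball 0" by (simp add: lscale_subset_iff)
      ultimately show ?thesis using L by auto
    qed
  next
    assume "1 \<le> n \<and> (\<exists>L\<in>lattices. u = sim_class L \<and> oball (int n - 1) \<subseteq> L \<and> L \<subseteq> oball 0)"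
    then obtain L where L: "L \<in> lattices" "u = sim_class L" "oball (int n - 1) \<subseteq> L" "L \<subseteq> oball 0" by blast
    obtain M where M: "arrow_rep (u, v) L M" using arrow_rep_at[OF u(2) L(1)] L(2) by auto
    have "oball (int n) \<subseteq> lscale unif L" using lscale_mono[OF L(3), of unif] by (simp add: lscale_oball vord_unif)
    then have "M \<in> lattices" "v = sim_class M" "oball (int n) \<subseteq> M" "M \<subseteq> oball 0" using M L(4) by (auto simp: arrow_rep_def)
    then show ?thesis by auto
  qed
qed

lemma special_iff:
  fixes v :: "('k::nonarch_local_field, 'n::finite) vertex"
  assumes rank: "2 \<le> CARD('n)"
  shows "special n v \<longleftrightarrow> (\<exists>M\<in>tlats n. v = sim_class M)"
proof
  assume "special n v"
  then have s: "spath n v" "bt_dist base_vertex v = n" unfolding special_def spath_def by auto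
  from spath_cases[OF s(1)] show "\<exists>M\<in>tlats n. v = sim_class M"
  proof
    assume a: "1 \<le> n \<and> (\<exists>L\<in>lattices. v = sim_class L \<and> oball (int n - 1) \<subseteq> L \<and> L \<subseteq> oball 0)"
    then obtain L where L: "L \<in> lattices" "v = sim_class L" "oball (int (n - 1)) \<subseteq> L" "L \<subseteq> oball 0" by (auto simp: of_nat_diff)
    obtain m where m: "m \<le> n - 1" "reach m v" using lattice_reach[OF L(1,3,4)] L(2) by blast
    have "bt_dist base_vertex v \<le> m" unfolding bt_dist_def using m(2) unfolding reach_def by (rule Least_le)
    then have False using s(2) m(1) conjunct1[OF a] by linarith
    then show ?thesis ..
  qed
next
  assume "\<exists>M\<in>tlats n. v = sim_class M"
  then show "special n v" using spath_tlat[OF rank] bt_dist_tlat[OF rank] unfolding special_def spath_def by blast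
qed

lemma tree_vertices_iff:
  fixes v :: "('k::nonarch_local_field, 'n::finite) vertex"
  assumes rank: "2 \<le> CARD('n)"
  shows "v \<in> tree_vertices \<longleftrightarrow> (\<exists>n. \<exists>M\<in>tlats n. v = sim_class M)"
  using special_iff[OF rank, of _ v] by (simp add: tree_vertices_def)

section \<open>Arrows of the tree as pairs of parent and child\<close>

lemma nested_child:
  fixes M :: "('k::nonarch_local_field ^ 'n::finite) set"
  assumes rank: "2 \<le> CARD('n)" and M: "M \<in> tlats n" "N \<in> tlats m" "N \<subset> M" "lscale unif M \<subseteq> N"
  shows "m = Suc n"
proof -
  have "int n \<le> int m" using ball_in_tlats[OF rank M(1), of "int m"] tlats_bounds[OF M(2)] M(3) by blast
  moreover have "oball (int n + 1) \<subseteq> lscale unif M"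
    using lscale_mono[of "oball (int n)" M unif] tlats_bounds[OF M(1)] by (simp add: lscale_oball vord_unif)
  then have "int m \<le> int n + 1" using ball_in_tlats[OF rank M(2), of "int n + 1"] M(4) by blast
  moreover have "m \<noteq> n"
  proof
    assume "m = n"
    obtain y where y: "y \<in> prim" "y \<in> N" using tlats_prim_ex[OF M(2)] by blast
    then have "N = tlat n y" "M = tlat n y" using M \<open>m = n\<close> tlats_through[of N n y] tlats_through[of M n y] by auto
    then show False using M(3) by blast
  qed
  ultimately show ?thesis by linarith
qed

lemma tree_arrows_iff:
  fixes v w :: "('k::nonarch_local_field, 'n::finite) vertex"
  assumes rank: "2 \<le> CARD('n)"
  shows "(v, w) \<in> tree_arrows \<longleftrightarrow>
    (\<exists>n. \<exists>P\<in>tlats n. \<exists>M\<in>tlats (Suc n). M \<subseteq> P \<and> ((v, w) = arr P M \<or> (v, w) = arr M P))" (is "?l \<longleftrightarrow> ?r")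
proof
  assume "?l"
  then have e: "(v, w) \<in> arrows" "v \<in> tree_vertices" "w \<in> tree_vertices" by (auto simp: tree_arrows_def)
  obtain n M where M: "M \<in> tlats n" "v = sim_class M" using e tree_vertices_iff[OF rank] by blast
  obtain m N where N: "N \<in> tlats m" "w = sim_class N" using e tree_vertices_iff[OF rank] by blast
  obtain N' where r: "arrow_rep (v, w) M N'" using arrow_rep_at[OF e(1) tlats_lattice[OF M(1)]] M(2) by auto
  then have "sim_class N = sim_class N'" and N': "N' \<subset> M" "lscale unif M \<subset> N'" using N by (auto simp: arrow_rep_def)
  \<comment> \<open>Primitive vectors of \<open>M\<close> and \<open>N\<close> leave only k = 0, an
    arrow from parent to child, and k = 1, an arrow from child to parent.\<close>
  then obtain k where k: "N' = lscale (unif powi k) N" using sim_class_eq_powi[OF tlats_omod[OF N(1)]] by blast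
  obtain x y where x: "x \<in> prim" "x \<in> M" and y: "y \<in> prim" "y \<in> N" using tlats_prim_ex M N by meson
  have "unif powi k *s y \<in> N'" unfolding k using y(2) by simp
  then have k0: "0 \<le> k" using prim_powi[OF y(1), of k 0] N'(1) tlats_bounds[OF M(1)] by blast
  have "unif powi 1 *s x \<in> lscale unif M" using x(2) by simp
  then have "unif powi 1 *s x \<in> N'" using N' by blast
  moreover have "N' \<subseteq> oball k" unfolding k using lscale_mono[of N "oball 0" "unif powi k"] tlats_bounds[OF N(1)] lscale_powi_oball[of k 0] by auto
  ultimately have k1: "k \<le> 1" using prim_powi[OF x(1), of 1 k] by blast
  show ?r
  proof (cases "k = 0")
    case True
    then have "N' = N" using k by simp
    then have "m = Suc n" using nested_child[OF rank M(1) N(1)] N' by blast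
    then show ?thesis using M N N' \<open>N' = N\<close> by (intro exI[of _ n] bexI[of _ M] bexI[of _ N]) auto
  next
    case False
    then have "N' = lscale unif N" using k k0 k1 by (cases "k = 1") auto
    then have MN: "M \<subset> N" "lscale unif N \<subseteq> M" using N' by (auto simp: lscale_psubset_iff)
    then have "n = Suc m" using nested_child[OF rank N(1) M(1)] by blast
    then show ?thesis using M N MN by (intro exI[of _ m] bexI[of _ N] bexI[of _ M]) auto
  qed
next
  assume ?r
  then obtain n P M where *: "P \<in> tlats n" "M \<in> tlats (Suc n)" "M \<subseteq> P" "(v, w) = arr P M \<or> (v, w) = arr M P" by blast
  have "arr P M \<in> arrows" using arrow_rep_arrow[OF child_rep[OF rank *(1-3)]] .
  then show ?l using * arrows_sym tree_vertices_iff[OF rank] unfolding tree_arrows_def by blast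
qed

definition children :: "nat \<Rightarrow> ('k::nonarch_local_field ^ 'n::finite) set \<Rightarrow> ('k ^ 'n) set set" where
  "children n P = {M \<in> tlats (Suc n). M \<subseteq> P}"

text \<open>The parent is given as a set of at most one lattice, which is empty at the root, so that
  root and other vertices share one formula.\<close>

lemma tree_arrows_from:
  fixes P :: "('k::nonarch_local_field ^ 'n::finite) set"
  assumes rank: "2 \<le> CARD('n)" and P: "P \<in> tlats n"
  shows "{e \<in> tree_arrows. fst e = sim_class P} = arr P ` (children n P \<union> {Q. \<exists>m. n = Suc m \<and> Q \<in> tlats m \<and> P \<subseteq> Q})"
proof (intro equalityI subsetI)
  fix e assume e: "e \<in> {e \<in> tree_arrows. fst e = sim_class P}"
  then obtain m Q M where *: "Q \<in> tlats m" "M \<in> tlats (Suc m)" "M \<subseteq> Q" "e = arr Q M \<or> e = arr M Q"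
    using tree_arrows_iff[OF rank, of "fst e" "snd e"] unfolding prod.collapse by blast
  from *(4) show "e \<in> arr P ` (children n P \<union> {Q. \<exists>m. n = Suc m \<and> Q \<in> tlats m \<and> P \<subseteq> Q})"
  proof
    assume "e = arr Q M"
    then have "Q = P \<and> m = n" using e tlats_sim_eq[OF rank *(1) P] by auto
    then show ?thesis using * \<open>e = arr Q M\<close> by (auto simp: children_def)
  next
    assume "e = arr M Q"
    then have "M = P \<and> Suc m = n" using e tlats_sim_eq[OF rank *(2) P] by auto
    then show ?thesis using * \<open>e = arr M Q\<close> by auto
  qed
next
  have 1: "arr P M \<in> tree_arrows" if "M \<in> children n P" for M
    unfolding tree_arrows_iff[OF rank] using that P by (auto simp: children_def)
  have 2: "arr P Q \<in> tree_arrows" if "n = Suc m" "Q \<in> tlats m" "P \<subseteq> Q" for m Q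
    unfolding tree_arrows_iff[OF rank] using that P by blast
  fix e assume "e \<in> arr P ` (children n P \<union> {Q. \<exists>m. n = Suc m \<and> Q \<in> tlats m \<and> P \<subseteq> Q})"
  then show "e \<in> {e \<in> tree_arrows. fst e = sim_class P}"
    using 1 2 by auto
qed

lemma inj_on_arr_tlats:
  fixes P :: "('k::nonarch_local_field ^ 'n::finite) set"
  assumes rank: "2 \<le> CARD('n)"
  shows "inj_on (arr P) (\<Union>n. tlats n)"
  using tlats_sim_eq[OF rank] by (auto intro!: inj_onI)

lemma harmonic_tree_base:
  fixes \<psi> :: "('k::nonarch_local_field, 'n::finite) arrow \<Rightarrow> 'a::ab_group_add"
  assumes rank: "2 \<le> CARD('n)" and h: "\<psi> \<in> harmonic_tree"
  shows "(\<Sum>M\<in>tlats 1. \<psi> (arr (oball 0) M)) = 0"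
proof -
  have P: "(oball 0 :: ('k ^ 'n) set) \<in> tlats 0" by (simp add: tlats_0)
  then have "sim_class (oball 0 :: ('k ^ 'n) set) \<in> tree_vertices" using tree_vertices_iff[OF rank] by blast
  then have "(\<Sum>e | e \<in> tree_arrows \<and> fst e = sim_class (oball 0 :: ('k ^ 'n) set). \<psi> e) = 0"
    using h unfolding harmonic_tree_def by blast
  moreover have "children 0 (oball 0) = (tlats 1 :: ('k ^ 'n) set set)" using tlats_bounds by (auto simp: children_def)
  then have "{e \<in> tree_arrows. fst e = sim_class (oball 0 :: ('k ^ 'n) set)} = arr (oball 0) ` tlats 1"
    using tree_arrows_from[OF rank P] by simp
  moreover have "(\<Sum>e\<in>arr (oball 0) ` (tlats 1 :: ('k ^ 'n) set set). \<psi> e) = (\<Sum>M\<in>tlats 1. \<psi> (arr (oball 0) M))"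
    using sum.reindex[OF inj_on_subset[OF inj_on_arr_tlats[OF rank, of "oball 0"]], of "tlats 1" \<psi>] by (simp add: SUP_upper)
  ultimately show ?thesis by simp
qed

lemma harmonic_tree_swap:
  "\<psi> \<in> harmonic_tree \<Longrightarrow> (v, w) \<in> tree_arrows \<Longrightarrow> \<psi> (w, v) = - \<psi> (v, w)"
proof -
  assume "\<psi> \<in> harmonic_tree" "(v, w) \<in> tree_arrows"
  then have "\<psi> (v, w) + \<psi> (prod.swap (v, w)) = 0" unfolding harmonic_tree_def by blast
  then show "\<psi> (w, v) = - \<psi> (v, w)" by (simp add: eq_neg_iff_add_eq_0 add.commute)
qed

text \<open>Since \<psi> changes sign on inverse arrows, the vanishing sum at \<open>P\<close> says
  that the flow arriving from the parent is distributed among the children. For masses of cells this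
  is additivity.\<close>

lemma harmonic_tree_step:
  fixes \<psi> :: "('k::nonarch_local_field, 'n::finite) arrow \<Rightarrow> 'a::ab_group_add"
  assumes rank: "2 \<le> CARD('n)" and h: "\<psi> \<in> harmonic_tree"
    and Q: "Q \<in> tlats n" and P: "P \<in> tlats (Suc n)" "P \<subseteq> Q"
  shows "(\<Sum>M\<in>children (Suc n) P. \<psi> (arr P M)) = \<psi> (arr Q P)"
proof -
  have "sim_class P \<in> tree_vertices" using P tree_vertices_iff[OF rank] by blast
  then have "(\<Sum>e | e \<in> tree_arrows \<and> fst e = sim_class P. \<psi> e) = 0" using h unfolding harmonic_tree_def by blast
  moreover have "{Q'. \<exists>m. Suc n = Suc m \<and> Q' \<in> tlats m \<and> P \<subseteq> Q'} = {Q}"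
  proof (intro equalityI subsetI)
    fix Q' assume "Q' \<in> {Q'. \<exists>m. Suc n = Suc m \<and> Q' \<in> tlats m \<and> P \<subseteq> Q'}"
    then have "Q' \<in> tlats n" "P \<subseteq> Q'" by auto
    then show "Q' \<in> {Q}" using tlats_parent_unique[OF P(1) _ Q _ P(2)] by simp
  qed (use Q P(2) in simp)
  then have "{e \<in> tree_arrows. fst e = sim_class P} = arr P ` (children (Suc n) P \<union> {Q})"
    using tree_arrows_from[OF rank P(1)] by simp
  moreover have "inj_on (arr P) (children (Suc n) P \<union> {Q})"
    by (rule inj_on_subset[OF inj_on_arr_tlats[OF rank]]) (use Q in \<open>auto simp: children_def\<close>)
  ultimately have "(\<Sum>M\<in>children (Suc n) P \<union> {Q}. \<psi> (arr P M)) = 0"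
    using sum.reindex[of "arr P" "children (Suc n) P \<union> {Q}" \<psi>] by simp
  moreover have "Q \<notin> children (Suc n) P" using tlats_sim_eq[OF rank Q, of Q "Suc (Suc n)"] by (auto simp: children_def)
  moreover have "finite (children (Suc n) P)" unfolding children_def by (rule finite_subset[OF _ finite_tlats]) blast
  ultimately have "(\<Sum>M\<in>children (Suc n) P. \<psi> (arr P M)) + \<psi> (arr P Q) = 0" by (simp add: add.commute)
  moreover have "arr Q P \<in> tree_arrows" using tree_arrows_iff[OF rank] Q P by blast
  then have "\<psi> (arr P Q) = - \<psi> (arr Q P)" by (rule harmonic_tree_swap[OF h])
  ultimately show ?thesis by simp
qed

section \<open>Harmonic cochains on the building\<close>

lemma harmonic_off: "\<phi> \<in> harmonic_building \<Longrightarrow> e \<notin> arrows \<Longrightarrow> \<phi> e = 0"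
  unfolding harmonic_building_def by blast

lemma harmonic_closed:
  "\<phi> \<in> harmonic_building \<Longrightarrow> is_bt_path p \<Longrightarrow> hd p = last p \<Longrightarrow> sum_list (map \<phi> (path_arrows p)) = 0"
  unfolding harmonic_building_def by blast

lemma harmonic_swap:
  assumes "\<phi> \<in> harmonic_building"
  shows "\<phi> (w, v) = - \<phi> (v, w)"
proof (cases "(v, w) \<in> arrows")
  case True
  then have "\<phi> (v, w) + \<phi> (w, v) = 0"
    using harmonic_closed[OF assms, of "[v, w, v]"] arrow_vertices[OF True] arrows_sym[of v w] by simp
  then show ?thesis by (simp add: eq_neg_iff_add_eq_0 add.commute)
next
  case False
  then show ?thesis using harmonic_off[OF assms] arrows_sym[of v w] by simp
qed

lemma harmonic_refl: "\<phi> \<in> harmonic_building \<Longrightarrow> \<phi> (v, v) = 0"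
  using harmonic_off arrows_irrefl by blast

lemma sim_class_unif [simp]: "sim_class (lscale unif L) = sim_class L"
  by (rule sim_class_lscale) simp

text \<open>Cochains vanish off the arrows, which makes the next two lemmas true for degenerate flags as well.\<close>

lemma harmonic_triangle:
  fixes L :: "('k::nonarch_local_field ^ 'n::finite) set"
  assumes h: "\<phi> \<in> harmonic_building" and L: "L \<in> lattices" "omod M" "omod N"
    and sub: "lscale unif L \<subseteq> N" "N \<subseteq> M" "M \<subseteq> L"
  shows "\<phi> (arr L M) + \<phi> (arr M N) = \<phi> (arr L N)"
proof -
  consider "M = L" | "M = N" | "N = lscale unif L" | "lscale unif L \<subset> N" "N \<subset> M" "M \<subset> L"
    using sub by blast
  then show ?thesis
  proof cases
    case 3
    then show ?thesis using harmonic_refl[OF h] harmonic_swap[OF h, of "sim_class M" "sim_class L"] by simp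
  next
    case 4
    have M: "M \<in> lattices" using lattice_between[OF L(1,2)] sub by blast
    have "lscale unif M \<subset> N" using lscale_mono[of M L unif] 4 by blast
    then have "M \<in> betw L" "N \<in> betw L" "N \<in> betw M" using 4 L by (auto simp: betw_def)
    then have a: "arr L M \<in> arrows" "arr M N \<in> arrows" "arr L N \<in> arrows"
      using arrow_rep_arr[OF L(1)] arrow_rep_arr[OF M] arrow_rep_arrow by blast+
    then have "\<phi> (arr L M) + (\<phi> (arr M N) + \<phi> (arr N L)) = 0"
      using harmonic_closed[OF h, of "[sim_class L, sim_class M, sim_class N, sim_class L]"]
        arrow_vertices[OF a(1)] arrows_sym[of "sim_class L" "sim_class N"] by simp
    then show ?thesis unfolding harmonic_swap[OF h, of "sim_class N" "sim_class L"] by (simp add: algebra_simps)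
  qed (use harmonic_refl[OF h] in simp_all)
qed

lemma harmonic_pts:
  fixes L :: "('k::nonarch_local_field ^ 'n::finite) set" and \<phi> :: "('k, 'n) arrow \<Rightarrow> 'a::ab_group_add"
  assumes rank: "2 \<le> CARD('n)" and h: "\<phi> \<in> harmonic_building" and L: "L \<in> lattices" "omod M"
    and sub: "lscale unif L \<subseteq> M" "M \<subseteq> L"
  shows "\<phi> (arr L M) = (\<Sum>W | W \<in> pts L \<and> W \<subseteq> M. \<phi> (arr L W))"
proof -
  have v: "sim_class L \<in> vertices" using L vertices_iff by blast
  have oN: "omod (lscale unif L)" by (rule omod_lscale[OF lattice_omod[OF L(1)]])
  consider "M = L" | "M = lscale unif L" | "M \<in> betw L" using sub L unfolding betw_def by blast
  then show ?thesis
  proof cases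
    case 1
    \<comment> \<open>For \<open>M = L\<close> the claim is (B) for t = 1, a type in the range of
      (B) as r \<ge> 2.\<close>
    have "(\<Sum>e\<in>arrows_from_type (sim_class L) 1. \<phi> e) = 0"
      using h v rank unfolding harmonic_building_def by auto
    then have "(\<Sum>W\<in>pts L. \<phi> (arr L W)) = 0"
      using sum_arr[OF L(1) pts_betw[OF rank L(1)], of \<phi>] arrows_from_type1[OF rank L(1)] by simp
    moreover have "{W \<in> pts L. W \<subseteq> M} = pts L" using pts_betw[OF rank L(1)] 1 by (auto simp: betw_def)
    ultimately show ?thesis using harmonic_refl[OF h] 1 by simp
  next
    case 2
    have "\<not> W \<subseteq> M" if "W \<in> pts L" for W using that cyc_self[OF oN] 2 by (auto simp: pts_def)
    then have "{W \<in> pts L. W \<subseteq> M} = {}" by blast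
    then show ?thesis using harmonic_refl[OF h] 2 by (simp only: sum.empty sim_class_unif)
  next
    case 3
    have "arr L M \<in> arrows_from (sim_class L)" using 3 arrows_from_eq[OF L(1)] by blast
    then have "\<phi> (arr L M) = (\<Sum>e' | e' \<in> arrows_from_type (sim_class L) 1 \<and> arrow_prec e' (arr L M). \<phi> e')"
      using h v unfolding harmonic_building_def by blast
    also have "\<dots> = (\<Sum>W | W \<in> pts L \<and> W \<subseteq> M. \<phi> (arr L W))"
      unfolding arrows_prec_eq[OF rank L(1) 3] using pts_betw[OF rank L(1)] by (intro sum_arr[OF L(1)]) blast
    finally show ?thesis .
  qed
qed

lemma finite_pts:
  fixes L :: "('k::nonarch_local_field ^ 'n::finite) set"
  assumes "2 \<le> CARD('n)" "L \<in> lattices" shows "finite (pts L)"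
  using finite_subset[OF pts_betw[OF assms] finite_betw[OF assms(2)]] .

lemma harmonic_pts_all:
  fixes L :: "('k::nonarch_local_field ^ 'n::finite) set" and \<phi> :: "('k, 'n) arrow \<Rightarrow> 'a::ab_group_add"
  assumes rank: "2 \<le> CARD('n)" and h: "\<phi> \<in> harmonic_building" and L: "L \<in> lattices"
  shows "(\<Sum>W\<in>pts L. \<phi> (arr L W)) = 0"
proof -
  have "{W \<in> pts L. W \<subseteq> L} = pts L" using pts_betw[OF rank L] by (auto simp: betw_def)
  then show ?thesis
    using harmonic_pts[OF rank h L lattice_omod[OF L] lscale_unif_subset[OF lattice_omod[OF L]] order_refl]
      harmonic_refl[OF h, of "sim_class L"] by simp
qed

lemma harmonic_pts_compl:
  fixes L :: "('k::nonarch_local_field ^ 'n::finite) set" and \<phi> :: "('k, 'n) arrow \<Rightarrow> 'a::ab_group_add"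
  assumes rank: "2 \<le> CARD('n)" and h: "\<phi> \<in> harmonic_building" and L: "L \<in> lattices" "omod M"
    and sub: "lscale unif L \<subseteq> M" "M \<subseteq> L"
  shows "(\<Sum>W | W \<in> pts L \<and> \<not> W \<subseteq> M. \<phi> (arr L W)) = - \<phi> (arr L M)"
proof -
  have "(\<Sum>W\<in>pts L. \<phi> (arr L W)) = (\<Sum>W | W \<in> pts L \<and> W \<subseteq> M. \<phi> (arr L W)) + (\<Sum>W | W \<in> pts L \<and> \<not> W \<subseteq> M. \<phi> (arr L W))"
    by (subst sum.union_disjoint[symmetric]) (auto simp: finite_pts[OF rank L(1)] intro: sum.cong)
  then show ?thesis
    unfolding harmonic_pts_all[OF rank h L(1)] harmonic_pts[OF rank h L sub, symmetric]
    by (simp add: eq_neg_iff_add_eq_0 add.commute)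
qed


section \<open>Restriction to the tree\<close>

lemma children_0: "children 0 (oball 0) = (pts (oball 0) :: ('k::nonarch_local_field ^ 'n::finite) set set)"
proof -
  have "(tlats 1 :: ('k ^ 'n) set set) = pts (oball 0)" by (simp add: tlats_def pts_def unif_std)
  moreover have "children 0 (oball 0) = (tlats 1 :: ('k ^ 'n) set set)" using tlats_bounds by (auto simp: children_def)
  ultimately show ?thesis by simp
qed

text \<open>The arrow from \<open>P\<close> back to \<open>Q\<close> corresponds to the subspace
  \<pi>Q/\<pi>P of P/\<pi>P. A vector of \<open>P\<close> outside \<pi>Q is primitive in O^r, so the
  points not in this subspace are the next tree lattices.\<close>

lemma children_Suc:
  assumes P: "P \<in> tlats (Suc m)" and Q: "Q \<in> tlats m" "P \<subseteq> Q"
  shows "children (Suc m) P = {W \<in> pts P. \<not> W \<subseteq> lscale unif Q}"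
proof (intro equalityI subsetI)
  fix M assume M: "M \<in> children (Suc m) P"
  then have M': "M \<in> tlats (Suc (Suc m))" "M \<subseteq> P" by (auto simp: children_def)
  obtain x where "x \<in> M" "x \<in> prim" using tlats_prim_ex[OF M'(1)] by blast
  then have "\<not> M \<subseteq> lscale unif Q" using tlats_scaled_sub[OF Q(1)] by blast
  then show "M \<in> {W \<in> pts P. \<not> W \<subseteq> lscale unif Q}" using child_pts[OF P M'] by blast
next
  fix W assume W: "W \<in> {W \<in> pts P. \<not> W \<subseteq> lscale unif Q}"
  then obtain y where y: "y \<in> W" "y \<notin> lscale unif Q" by blast
  have "lscale unif P \<subseteq> lscale unif Q" using lscale_mono[OF Q(2)] .
  then have Wc: "W = cyc y (lscale unif P)" using pts_mem_eq[OF tlats_omod[OF P], of W y] W y by blast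
  have "W \<subseteq> P"
  proof -
    obtain z where "z \<in> P" "W = cyc z (lscale unif P)" using W by (auto simp: pts_def)
    then show ?thesis using cyc_subset[OF omod_lscale[OF tlats_omod[OF P]] tlats_omod[OF P], of z unif]
        lscale_unif_subset[OF tlats_omod[OF P]] by simp
  qed
  then have "y \<in> P - oball 1" using child_diff[OF Q(1) P Q(2)] y by blast
  then have yp: "y \<in> prim" "y \<in> P" using tlats_bounds[OF P] by blast+
  then have Pt: "P = tlat (Suc m) y" using tlats_through[OF P] by blast
  have "W = tlat (Suc (Suc m)) y" using tlat_Suc_eq[OF yp(1), of "Suc m"] Wc Pt by metis
  then have "W \<in> tlats (Suc (Suc m))" using tlat_tlats[OF yp(1), of "Suc (Suc m)"] by metis
  then show "W \<in> children (Suc m) P" using \<open>W \<subseteq> P\<close> by (simp add: children_def)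
qed

lemma tree_arrows_sym: "(v, w) \<in> tree_arrows \<longleftrightarrow> (w, v) \<in> tree_arrows"
  unfolding tree_arrows_def using arrows_sym by blast

text \<open>At the root the arrows of the tree are all those of type 1, and (B) applies. Elsewhere,
  by (B) and (C), the sum over the points outside \<pi>Q is minus the value on the arrow to [\<pi>Q]
  = [Q], which cancels the parent's term.\<close>

lemma restrict_tree_harmonic:
  fixes \<phi> :: "('k::nonarch_local_field, 'n::finite) arrow \<Rightarrow> 'a::ab_group_add"
  assumes rank: "2 \<le> CARD('n)" and h: "\<phi> \<in> harmonic_building"
  shows "restrict_tree \<phi> \<in> harmonic_tree"
  unfolding harmonic_tree_def
proof (intro CollectI conjI allI impI ballI)
  fix e :: "('k, 'n) arrow" assume "e \<notin> tree_arrows" then show "restrict_tree \<phi> e = 0" by (simp add: restrict_tree_def)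
next
  fix e :: "('k, 'n) arrow" assume e: "e \<in> tree_arrows"
  then show "restrict_tree \<phi> e + restrict_tree \<phi> (prod.swap e) = 0"
    using tree_arrows_sym[of "fst e" "snd e"] harmonic_swap[OF h, of "snd e" "fst e"]
    by (cases e) (simp add: restrict_tree_def)
next
  fix v :: "('k, 'n) vertex" assume "v \<in> tree_vertices"
  then obtain n P where P: "P \<in> tlats n" "v = sim_class P" using tree_vertices_iff[OF rank] by blast
  have lat: "P \<in> lattices" using tlats_lattice[OF P(1)] .
  have "(\<Sum>e | e \<in> tree_arrows \<and> fst e = v. restrict_tree \<phi> e) = (\<Sum>e | e \<in> tree_arrows \<and> fst e = v. \<phi> e)"
    by (rule sum.cong) (auto simp: restrict_tree_def)
  also have "\<dots> = 0"
  proof (cases n)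
    case 0
    have P0: "P = oball 0" using P(1) 0 tlats_0[of P] by simp
    have "{Q. \<exists>m. 0 = Suc m \<and> Q \<in> tlats m \<and> P \<subseteq> Q} = {}" by simp
    moreover have "children 0 P = pts P" unfolding P0 by (rule children_0)
    ultimately have "{e \<in> tree_arrows. fst e = v} = arr P ` pts P"
      using tree_arrows_from[OF rank P(1)] P(2) 0 by simp
    then show ?thesis using harmonic_pts_all[OF rank h lat] sum_arr[OF lat pts_betw[OF rank lat], of \<phi>] by simp
  next
    case (Suc m)
    then have P': "P \<in> tlats (Suc m)" using P by simp
    then obtain Q where Q: "Q \<in> tlats m" "P \<subseteq> Q" using tlats_parent by blast
    have up: "{Q. \<exists>l. n = Suc l \<and> Q \<in> tlats l \<and> P \<subseteq> Q} = {Q}"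
    proof (intro equalityI subsetI)
      fix Q' assume "Q' \<in> {Q. \<exists>l. n = Suc l \<and> Q \<in> tlats l \<and> P \<subseteq> Q}"
      then have "Q' \<in> tlats m" "P \<subseteq> Q'" using Suc by auto
      then show "Q' \<in> {Q}" using tlats_parent_unique[OF P' _ Q(1) _ Q(2)] by simp
    qed (use Q Suc in simp)
    have ch: "children n P = {W \<in> pts P. \<not> W \<subseteq> lscale unif Q}" using children_Suc[OF P' Q] Suc by simp
    have set: "{e \<in> tree_arrows. fst e = v} = arr P ` (children n P \<union> {Q})"
      using tree_arrows_from[OF rank P(1)] unfolding P(2) up .
    have inj: "inj_on (arr P) (children n P \<union> {Q})"
      by (rule inj_on_subset[OF inj_on_arr_tlats[OF rank]]) (use Q in \<open>auto simp: children_def\<close>)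
    have nin: "Q \<notin> children n P" using tlats_sim_eq[OF rank Q(1), of Q "Suc n"] Suc by (auto simp: children_def)
    have r: "arrow_rep (arr Q P) Q P" by (rule child_rep[OF rank Q(1) P' Q(2)])
    have s: "lscale unif Q \<subseteq> P" "lscale unif P \<subseteq> lscale unif Q" using r lscale_mono[OF Q(2)] by (auto simp: arrow_rep_def)
    have "(\<Sum>e | e \<in> tree_arrows \<and> fst e = v. \<phi> e) = (\<Sum>M\<in>children n P \<union> {Q}. \<phi> (arr P M))"
      unfolding set using sum.reindex[OF inj, of \<phi>] by simp
    also have "\<dots> = (\<Sum>M\<in>children n P. \<phi> (arr P M)) + \<phi> (arr P Q)"
      using nin finite_pts[OF rank lat] by (subst sum.union_disjoint) (auto simp: ch)
    also have "(\<Sum>M\<in>children n P. \<phi> (arr P M)) = - \<phi> (arr P (lscale unif Q))"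
      unfolding ch by (rule harmonic_pts_compl[OF rank h lat omod_lscale[OF tlats_omod[OF Q(1)]] s(2,1)])
    finally show ?thesis by simp
  qed
  finally show "(\<Sum>e | e \<in> tree_arrows \<and> fst e = v. restrict_tree \<phi> e) = 0" .
qed


section \<open>Injectivity of the restriction\<close>

text \<open>By (C) the hypothesis says that \<open>\<phi>\<close> agrees on the arrows from \<open>L'\<close> to \<open>cyc x \<pi>L\<close> and to \<open>\<pi>L\<close>; now compare with \<open>L\<close> by (A).\<close>

lemma harmonic_refine:
  fixes L :: "('k::nonarch_local_field ^ 'n::finite) set" and \<phi> :: "('k, 'n) arrow \<Rightarrow> 'a::ab_group_add"
  assumes rank: "2 \<le> CARD('n)" and h: "\<phi> \<in> harmonic_building" and L: "L \<in> lattices" "omod L'"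
    and sub: "lscale unif L \<subseteq> L'" "L' \<subseteq> L" and x: "x \<in> L'"
    and zero: "\<And>Z. Z \<in> pts L' \<Longrightarrow> Z \<subseteq> cyc x (lscale unif L) \<Longrightarrow> \<not> Z \<subseteq> lscale unif L \<Longrightarrow> \<phi> (arr L' Z) = 0"
  shows "\<phi> (arr L (cyc x (lscale unif L))) = 0"
proof -
  let ?N = "lscale unif L" and ?W = "cyc x (lscale unif L)"
  have lat': "L' \<in> lattices" using lattice_between[OF L sub] .
  have oN: "omod ?N" by (rule omod_lscale[OF lattice_omod[OF L(1)]])
  have oW: "omod ?W" by (rule omod_cyc[OF oN])
  have W: "?N \<subseteq> ?W" "?W \<subseteq> L'" using cyc_superset cyc_subset[OF oN L(2), of x] x sub by auto
  have N': "lscale unif L' \<subseteq> ?N" using lscale_mono[OF sub(2)] .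
  have fin: "finite {Z \<in> pts L'. Z \<subseteq> ?W}" using finite_pts[OF rank lat'] by simp
  have "\<phi> (arr L' ?W) = (\<Sum>Z | Z \<in> pts L' \<and> Z \<subseteq> ?W. \<phi> (arr L' Z))"
    using harmonic_pts[OF rank h lat' oW] N' W by blast
  also have "\<dots> = (\<Sum>Z | Z \<in> pts L' \<and> Z \<subseteq> ?N. \<phi> (arr L' Z))"
    using zero W(1) by (intro sum.mono_neutral_right[OF fin]) auto
  also have "\<dots> = \<phi> (arr L' ?N)" using harmonic_pts[OF rank h lat' oN N' sub(1)] by simp
  finally have eq: "\<phi> (arr L' ?W) = \<phi> (arr L' ?N)" .
  have "\<phi> (arr L L') + \<phi> (arr L' ?W) = \<phi> (arr L ?W)"
    by (rule harmonic_triangle[OF h L(1) L(2) oW W sub(2)])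
  moreover have "\<phi> (arr L L') + \<phi> (arr L' ?N) = \<phi> (arr L ?N)"
    by (rule harmonic_triangle[OF h L(1) L(2) oN order_refl sub])
  ultimately show ?thesis using eq harmonic_refl[OF h, of "sim_class L"] by simp
qed

text \<open>The lattices \<open>L \<inter> tlat j x\<close> interpolate between \<open>L\<close> for
  j = 0 and \<open>tlat m x\<close> for j = m, where the arrow belongs to the tree. Downward
  induction on \<open>j\<close>, each step by \<open>harmonic_refine\<close>; \<open>x\<close>
  varies because refinement produces other primitive vectors \<open>y\<close>, with the same
  \<open>tlat (Suc j)\<close>.\<close>

lemma harmonic_zero_prim:
  fixes L :: "('k::nonarch_local_field ^ 'n::finite) set" and \<phi> :: "('k, 'n) arrow \<Rightarrow> 'a::ab_group_add"
  assumes rank: "2 \<le> CARD('n)" and h: "\<phi> \<in> harmonic_building" and z: "\<And>e. e \<in> tree_arrows \<Longrightarrow> \<phi> e = 0"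
    and L: "L \<in> lattices" "L \<subseteq> oball 0" "oball (int m) \<subseteq> L" and x: "x \<in> L" "x \<notin> oball 1" and j: "j \<le> m"
  shows "\<phi> (arr (L \<inter> tlat j x) (cyc x (lscale unif (L \<inter> tlat j x)))) = 0"
  using j x
proof (induction j arbitrary: x rule: inc_induct)
  case base
  then have xp: "x \<in> prim" using L(2) by blast
  have "tlat m x \<subseteq> L" using cyc_subset[OF omod_oball lattice_omod[OF L(1)], of x "int m"] L(3) base by simp
  then have "L \<inter> tlat m x = tlat m x" by blast
  moreover have "tlat (Suc m) x \<subseteq> tlat m x" using cyc_mono[OF oball_mono[of "int m" "int (Suc m)"]] by simp
  then have "arr (tlat m x) (tlat (Suc m) x) \<in> tree_arrows"
    using tree_arrows_iff[OF rank] tlat_tlats[OF xp] by blast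
  ultimately show ?case using z tlat_Suc_eq[OF xp, of m] by simp
next
  case (step j)
  then have xp: "x \<in> prim" using L(2) by blast
  let ?L1 = "L \<inter> tlat j x" and ?L2 = "L \<inter> tlat (Suc j) x"
  have lat1: "?L1 \<in> lattices" using lattice_Int[OF L(1) tlat_lattice] .
  have lat2: "?L2 \<in> lattices" using lattice_Int[OF L(1) tlat_lattice] .
  have o: "omod ?L1" "omod ?L2" "omod (lscale unif ?L1)" using lattice_omod[OF lat1] lattice_omod[OF lat2] omod_lscale by auto
  have s1: "?L1 \<subseteq> oball 0" using L(2) by blast
  have p1: "lscale unif ?L1 \<subseteq> oball 1" using lscale_mono[OF s1, of unif] by (simp add: unif_std)
  have "lscale unif (tlat j x) \<subseteq> tlat (Suc j) x"
    unfolding tlat_Suc_eq[OF xp] by (rule cyc_superset)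
  then have sub: "lscale unif ?L1 \<subseteq> ?L2"
    using lscale_unif_subset[OF lattice_omod[OF L(1)]] lscale_mono[of ?L1 L unif] lscale_mono[of ?L1 "tlat j x" unif] by blast
  have "tlat (Suc j) x \<subseteq> tlat j x" using cyc_mono[OF oball_mono[of "int j" "int (Suc j)"]] by simp
  then have sub2: "?L2 \<subseteq> ?L1" by blast
  have x2: "x \<in> ?L2" using step tlat_self by blast
  show ?case
  proof (rule harmonic_refine[OF rank h lat1 o(2) sub sub2 x2])
    fix Z assume Z: "Z \<in> pts ?L2" "Z \<subseteq> cyc x (lscale unif ?L1)" "\<not> Z \<subseteq> lscale unif ?L1"
    then obtain y where y: "y \<in> Z" "y \<notin> lscale unif ?L1" by blast
    obtain a where a: "a \<in> integers" "y - a *s x \<in> lscale unif ?L1" using y(1) Z(2) unfolding cyc_def by blast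
    \<comment> \<open>A non-unit \<open>a\<close> would put a x, and then \<open>y\<close>, into
      \<pi> times the larger lattice. With \<open>a\<close> a unit, \<open>y\<close> inherits
      primitivity in O^r from \<open>x\<close>.\<close>
    have u: "a \<noteq> 0 \<and> vord a = 0"
    proof (rule ccontr)
      assume "\<not> (a \<noteq> 0 \<and> vord a = 0)"
      then have "vge 1 a" using a(1) integer_unit_cases by blast
      then obtain b where b: "b \<in> integers" "a = unif * b" unfolding vge_1_iff by blast
      have "b *s x \<in> ?L1" using omod_scale[OF o(1) b(1)] x2 sub2 by blast
      then have "unif *s (b *s x) \<in> lscale unif ?L1" by (simp only: scale_mem_lscale[OF unif_nz])
      then have "a *s x \<in> lscale unif ?L1" using b(2) by simp
      then show False using omod_close[OF o(3) a(2)] y(2) by blast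
    qed
    have "a *s x \<notin> oball 1" using omod_unit_iff[OF omod_oball, of a x 1] u step.prems by blast
    then have y1: "y \<notin> oball 1" using omod_close[OF omod_oball, of y "a *s x" 1] a(2) p1 by blast
    have "Z \<subseteq> ?L2" using pts_betw[OF rank lat2] Z(1) by (auto simp: betw_def)
    then have yL: "y \<in> L" "y \<in> tlat (Suc j) x" using y(1) by auto
    have t: "tlat (Suc j) y = tlat (Suc j) x" using tlat_eq[OF xp _ yL(2) y1] by simp
    have "y \<notin> lscale unif ?L2" using y(2) lscale_mono[OF sub2, of unif] by blast
    then have "Z = cyc y (lscale unif ?L2)" using pts_mem_eq[OF o(2) Z(1) y(1)] by blast
    then show "\<phi> (arr ?L2 Z) = 0" using step.IH[OF yL(1) y1] unfolding t by simp
  qed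
qed

lemma path_join:
  assumes "is_bt_path p" "is_bt_path q" "last p = hd q"
  shows "is_bt_path (p @ tl q)" "path_arrows (p @ tl q) = path_arrows p @ path_arrows q"
    "hd (p @ tl q) = hd p" "last (p @ tl q) = last q"
proof -
  obtain w q' where q: "q = w # q'" using assms(2) by (cases q) auto
  have "is_bt_path (p @ q') \<and> path_arrows (p @ q') = path_arrows p @ path_arrows (w # q')"
    using assms(1,2,3) unfolding q
  proof (induction p rule: induct_list012)
    case (2 v)
    then show ?case by (cases q') (auto simp: path_arrows_def)
  qed auto
  then show "is_bt_path (p @ tl q)" "path_arrows (p @ tl q) = path_arrows p @ path_arrows q" using q by auto
  have "p \<noteq> []" using assms(1) by auto
  then show "hd (p @ tl q) = hd p" "last (p @ tl q) = last q" using q assms(3) by (auto simp: last_append)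
qed

definition zpath :: "(('k::nonarch_local_field, 'n::finite) arrow \<Rightarrow> 'a::ab_group_add) \<Rightarrow>
    ('k, 'n) vertex \<Rightarrow> ('k, 'n) vertex \<Rightarrow> bool" where
  "zpath \<phi> v w \<longleftrightarrow> (\<exists>p. is_bt_path p \<and> hd p = v \<and> last p = w \<and> sum_list (map \<phi> (path_arrows p)) = 0)"

lemma zpath_refl: "v \<in> vertices \<Longrightarrow> zpath \<phi> v v"
  unfolding zpath_def by (intro exI[of _ "[v]"]) simp

lemma zpath_arrow: "(v, w) \<in> arrows \<Longrightarrow> \<phi> (v, w) = 0 \<Longrightarrow> zpath \<phi> v w"
  unfolding zpath_def using arrow_vertices by (intro exI[of _ "[v, w]"]) auto

lemma zpath_trans:
  assumes "zpath \<phi> u v" "zpath \<phi> v w" shows "zpath \<phi> u w"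
proof -
  obtain p q where p: "is_bt_path p" "hd p = u" "last p = v" "sum_list (map \<phi> (path_arrows p)) = 0"
    and q: "is_bt_path q" "hd q = v" "last q = w" "sum_list (map \<phi> (path_arrows q)) = 0"
    using assms unfolding zpath_def by blast
  have j: "last p = hd q" using p q by simp
  show ?thesis unfolding zpath_def using path_join[OF p(1) q(1) j] p q by (intro exI[of _ "p @ tl q"]) simp
qed

text \<open>Condition (B) makes \<open>\<phi>\<close> vanish on the arrow from \<open>[L]\<close> to \<open>[\<pi>\<^sup>-\<^sup>1L \<inter> L\<^sub>0]\<close>, a step towards \<open>[L\<^sub>0]\<close>.\<close>

lemma harmonic_zero_zpath:
  fixes L :: "('k::nonarch_local_field ^ 'n::finite) set" and \<phi> :: "('k, 'n) arrow \<Rightarrow> 'a::ab_group_add"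
  assumes rank: "2 \<le> CARD('n)" and h: "\<phi> \<in> harmonic_building" and z: "\<And>e. e \<in> tree_arrows \<Longrightarrow> \<phi> e = 0"
  shows "L \<in> lattices \<Longrightarrow> L \<subseteq> oball 0 \<Longrightarrow> oball (int m) \<subseteq> L \<Longrightarrow>
    zpath \<phi> (sim_class L) base_vertex \<and> zpath \<phi> base_vertex (sim_class L)"
proof (induction m arbitrary: L)
  case 0
  then have "sim_class L = base_vertex" by (simp add: base_vertex_oball)
  then show ?case using zpath_refl[OF base_vertex_vertices] by simp
next
  case (Suc m)
  note L = Suc.prems
  have oL: "omod L" using lattice_omod[OF L(1)] .
  have zp: "\<phi> (arr L (cyc x (lscale unif L))) = 0" if "x \<in> L" "x \<notin> oball 1" for x
  proof -
    have "L \<inter> tlat 0 x = L" using tlat_0[of x] that L(2) by auto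
    then show ?thesis using harmonic_zero_prim[OF rank h z L that, of 0] by simp
  qed
  \<comment> \<open>\<pi>L' is \<open>L \<inter> oball 1\<close>, so \<open>L'\<close> represents
    the end of the arrow on which (B) makes \<phi> vanish. It again lies in O^r but contains
    \<open>oball m\<close>, one exponent better than \<open>L\<close>.\<close>
  define L' where "L' = lscale (inverse unif) L \<inter> oball 0"
  have M: "lscale unif L' = L \<inter> oball 1"
    by (simp add: L'_def lscale_inter lscale_lscale unif_std)
  have sub: "lscale unif L \<subseteq> L \<inter> oball 1" "L \<inter> oball 1 \<subseteq> L"
    using lscale_unif_subset[OF oL] lscale_mono[OF L(2), of unif] by (auto simp: unif_std)
  have oM: "omod (L \<inter> oball 1)" using oL by (intro omod_Int) auto
  have "(\<Sum>W | W \<in> pts L \<and> \<not> W \<subseteq> L \<inter> oball 1. \<phi> (arr L W)) = 0"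
  proof (rule sum.neutral, intro ballI)
    fix W assume W: "W \<in> {W. W \<in> pts L \<and> \<not> W \<subseteq> L \<inter> oball 1}"
    then have "W \<subseteq> L" using pts_betw[OF rank L(1)] by (auto simp: betw_def)
    then obtain y where y: "y \<in> W" "y \<in> L" "y \<notin> oball 1" using W by blast
    then have "y \<notin> lscale unif L" using sub by blast
    then have "W = cyc y (lscale unif L)" using pts_mem_eq[OF oL _ y(1)] W by blast
    then show "\<phi> (arr L W) = 0" using zp[OF y(2,3)] by simp
  qed
  then have "\<phi> (arr L (L \<inter> oball 1)) = 0" using harmonic_pts_compl[OF rank h L(1) oM sub] by simp
  then have zLL': "\<phi> (arr L L') = 0" unfolding M[symmetric] by simp
  have lat': "L' \<in> lattices" unfolding L'_def using L(1) by (intro lattice_Int) (auto simp: lattice_lscale)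
  have "lscale (inverse unif) (oball (int (Suc m))) \<subseteq> lscale (inverse unif) L" by (rule lscale_mono[OF L(3)])
  then have "oball (int m) \<subseteq> L'"
    using oball_mono[of 0 "int m"] by (simp add: L'_def lscale_oball vord_inverse vord_unif)
  then have IH: "zpath \<phi> (sim_class L') base_vertex" "zpath \<phi> base_vertex (sim_class L')"
    using Suc.IH[OF lat'] by (auto simp: L'_def)
  show ?case
  proof (cases "sim_class L = sim_class L'")
    case True
    then show ?thesis using IH by simp
  next
    case False
    then have "L \<inter> oball 1 \<noteq> L" "L \<inter> oball 1 \<noteq> lscale unif L" unfolding M[symmetric]
      by (metis sim_class_unif)+
    then have "L \<inter> oball 1 \<in> betw L" using sub oM by (auto simp: betw_def)
    then have "arr L (L \<inter> oball 1) \<in> arrows" using arrow_rep_arr[OF L(1)] arrow_rep_arrow by blast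
    then have a: "arr L L' \<in> arrows" unfolding M[symmetric] by simp
    have "zpath \<phi> (sim_class L) (sim_class L')" "zpath \<phi> (sim_class L') (sim_class L)"
      using zpath_arrow[of "sim_class L" "sim_class L'" \<phi>, OF a zLL'] zpath_arrow[of "sim_class L'" "sim_class L" \<phi>] a arrows_sym[of "sim_class L" "sim_class L'"]
        harmonic_swap[OF h, of "sim_class L'" "sim_class L"] zLL' by auto
    then show ?thesis using IH zpath_trans by blast
  qed
qed

lemma vertex_rep:
  assumes "v \<in> vertices"
  obtains L m where "L \<in> lattices" "v = sim_class L" "L \<subseteq> oball 0" "oball (int m) \<subseteq> L"
proof -
  obtain L where L: "L \<in> lattices" "v = sim_class L" using assms vertices_iff by blast
  obtain m n where mn: "oball m \<subseteq> L" "L \<subseteq> oball n" using L(1) unfolding lattices_iff by blast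
  let ?M = "lscale (unif powi (- n)) L"
  have 1: "?M \<in> lattices" "v = sim_class ?M" using L by (simp_all add: lattice_lscale)
  have 2: "?M \<subseteq> oball 0" using lscale_mono[OF mn(2), of "unif powi (- n)"] by (simp add: lscale_powi_oball)
  have "oball (m - n) \<subseteq> ?M" using lscale_mono[OF mn(1), of "unif powi (- n)"] by (simp add: lscale_powi_oball)
  moreover have "m - n \<le> int (nat (m - n))" by linarith
  ultimately have "oball (int (nat (m - n))) \<subseteq> ?M" using oball_mono by blast
  then show ?thesis by (rule that[OF 1 2])
qed

lemma harmonic_zero:
  fixes \<phi> :: "('k::nonarch_local_field, 'n::finite) arrow \<Rightarrow> 'a::ab_group_add"
  assumes rank: "2 \<le> CARD('n)" and h: "\<phi> \<in> harmonic_building" and z: "\<And>e. e \<in> tree_arrows \<Longrightarrow> \<phi> e = 0"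
  shows "\<phi> e = 0"
proof (cases "e \<in> arrows")
  case True
  obtain v w where e: "e = (v, w)" by (cases e)
  have vw: "v \<in> vertices" "w \<in> vertices" using True e arrow_vertices by auto
  have zb: "zpath \<phi> u base_vertex \<and> zpath \<phi> base_vertex u" if "u \<in> vertices" for u
    using vertex_rep[OF that] harmonic_zero_zpath[OF rank h z] by metis
  have "zpath \<phi> w v" using zb[OF vw(1)] zb[OF vw(2)] zpath_trans by blast
  then obtain p where p: "is_bt_path p" "hd p = w" "last p = v" "sum_list (map \<phi> (path_arrows p)) = 0"
    unfolding zpath_def by blast
  have "p \<noteq> []" using p(1) by auto
  then obtain p' where p': "p = w # p'" using p(2) by (cases p) auto
  \<comment> \<open>The arrow from \<open>v\<close> to \<open>w\<close>, followed by a path of sum 0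
    back to \<open>v\<close>, is closed.\<close>
  have "sum_list (map \<phi> (path_arrows (v # p))) = 0"
    using p True e p' by (intro harmonic_closed[OF h]) auto
  then show ?thesis using p(4) e p' by simp
next
  case False
  then show ?thesis using harmonic_off[OF h] by blast
qed

lemma harmonic_diff:
  "f \<in> harmonic_building \<Longrightarrow> g \<in> harmonic_building \<Longrightarrow> (\<lambda>e. f e - g e) \<in> harmonic_building"
  by (auto simp: harmonic_building_def sum_subtractf sum_list_subtractf)

lemma restrict_tree_inj:
  fixes f :: "('k::nonarch_local_field, 'n::finite) arrow \<Rightarrow> 'a::ab_group_add"
  assumes rank: "2 \<le> CARD('n)" and h: "f \<in> harmonic_building" "g \<in> harmonic_building"
    and eq: "restrict_tree f = restrict_tree g"
  shows "f = g"
proof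
  fix e
  have "f e - g e = 0" if "e \<in> tree_arrows" for e
    using fun_cong[OF eq, of e] that by (simp add: restrict_tree_def)
  then have "f e - g e = 0" using harmonic_zero[OF rank harmonic_diff[OF h]] by blast
  then show "f e = g e" by simp
qed


section \<open>From the tree to distributions\<close>

text \<open>The flow of \<psi> into \<open>M\<close> from its parent, to become the mass of the cell
  of \<open>M\<close>. Level 0 has no parent; all uses have \<open>1 \<le> n\<close>.\<close>

definition tree_mass :: "(('k::nonarch_local_field, 'n::finite) arrow \<Rightarrow> 'a::ab_group_add) \<Rightarrow> nat \<Rightarrow>
    ('k ^ 'n) set \<Rightarrow> 'a" where
  "tree_mass \<psi> n M = \<psi> (arr (THE P. P \<in> tlats (n - 1) \<and> M \<subseteq> P) M)"

lemma tree_mass_eq: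
  assumes "P \<in> tlats n" "M \<in> tlats (Suc n)" "M \<subseteq> P"
  shows "tree_mass \<psi> (Suc n) M = \<psi> (arr P M)"
proof -
  have "(THE P. P \<in> tlats n \<and> M \<subseteq> P) = P"
    using assms tlats_parent_unique[OF assms(2)] by (intro the_equality) auto
  then show ?thesis by (simp add: tree_mass_def)
qed

lemma tree_mass_sum:
  fixes \<psi> :: "('k::nonarch_local_field, 'n::finite) arrow \<Rightarrow> 'a::ab_group_add"
  assumes rank: "2 \<le> CARD('n)" and h: "\<psi> \<in> harmonic_tree" and n: "1 \<le> n" and P: "P \<in> tlats n"
  shows "(\<Sum>M | M \<in> tlats (Suc n) \<and> M \<subseteq> P. tree_mass \<psi> (Suc n) M) = tree_mass \<psi> n P"
proof -
  obtain m where m: "n = Suc m" using n by (cases n) auto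
  obtain Q where Q: "Q \<in> tlats m" "P \<subseteq> Q" using tlats_parent P m by blast
  have "(\<Sum>M | M \<in> tlats (Suc n) \<and> M \<subseteq> P. tree_mass \<psi> (Suc n) M) = (\<Sum>M\<in>children n P. \<psi> (arr P M))"
    unfolding children_def by (rule sum.cong) (use tree_mass_eq[OF P] in auto)
  also have "\<dots> = \<psi> (arr Q P)" using harmonic_tree_step[OF rank h Q(1) _ Q(2)] P m by simp
  also have "\<dots> = tree_mass \<psi> n P" using tree_mass_eq[OF Q(1) _ Q(2), of \<psi>] P m by simp
  finally show ?thesis .
qed

definition tree_dist :: "(('k::nonarch_local_field, 'n::finite) arrow \<Rightarrow> 'a::ab_group_add) \<Rightarrow>
    ('k ^ 'n) set set \<Rightarrow> 'a" where
  "tree_dist \<psi> = dist_of (tree_mass \<psi>)"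

lemma tree_dist_cell:
  fixes \<psi> :: "('k::nonarch_local_field, 'n::finite) arrow \<Rightarrow> 'a::ab_group_add"
  assumes rank: "2 \<le> CARD('n)" and h: "\<psi> \<in> harmonic_tree"
    and P: "P \<in> tlats n" "M \<in> tlats (Suc n)" "M \<subseteq> P"
  shows "tree_dist \<psi> (cell M) = \<psi> (arr P M)"
  unfolding tree_dist_def
  using dist_of_cell[of "tree_mass \<psi>", OF tree_mass_sum[OF rank h] P(2)] tree_mass_eq[OF P] by simp

lemma tree_dist_distributions0:
  fixes \<psi> :: "('k::nonarch_local_field, 'n::finite) arrow \<Rightarrow> 'a::ab_group_add"
  assumes rank: "2 \<le> CARD('n)" and h: "\<psi> \<in> harmonic_tree"
  shows "tree_dist \<psi> \<in> distributions0"
proof -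
  have "tree_dist \<psi> lines = (\<Sum>M\<in>tlats 1. tree_mass \<psi> 1 M)"
    unfolding tree_dist_def by (rule dist_of_lines[OF tree_mass_sum[OF rank h]])
  also have "\<dots> = (\<Sum>M\<in>tlats 1. \<psi> (arr (oball 0) M))"
  proof (rule sum.cong[OF refl])
    fix M :: "('k ^ 'n) set" assume "M \<in> tlats 1"
    then show "tree_mass \<psi> 1 M = \<psi> (arr (oball 0) M)"
      using tree_mass_eq[of "oball 0" 0 M \<psi>] tlats_0[of "oball 0"] tlats_bounds[of M 1] by simp
  qed
  also have "\<dots> = 0" by (rule harmonic_tree_base[OF rank h])
  finally show ?thesis using dist_of_distribution[OF tree_mass_sum[OF rank h]]
    by (simp add: distributions0_def tree_dist_def)
qed

text \<open>On an arrow from parent to child, \<open>lines_in\<close> is the cell of the child,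
  whose mass is the value of \<psi>. The inverse arrows follow because both sides are
  antisymmetric.\<close>

lemma restrict_cochain_of_tree_dist:
  fixes \<psi> :: "('k::nonarch_local_field, 'n::finite) arrow \<Rightarrow> 'a::ab_group_add"
  assumes rank: "2 \<le> CARD('n)" and h: "\<psi> \<in> harmonic_tree"
  shows "restrict_tree (cochain_of (tree_dist \<psi>)) = \<psi>"
proof
  fix e :: "('k, 'n) arrow"
  let ?\<phi> = "cochain_of (tree_dist \<psi>)"
  have hb: "?\<phi> \<in> harmonic_building" by (rule cochain_of_harmonic[OF rank tree_dist_distributions0[OF rank h]])
  show "restrict_tree ?\<phi> e = \<psi> e"
  proof (cases "e \<in> tree_arrows")
    case True
    obtain v w where vw: "e = (v, w)" by (cases e)
    obtain n P M where *: "P \<in> tlats n" "M \<in> tlats (Suc n)" "M \<subseteq> P" "(v, w) = arr P M \<or> (v, w) = arr M P"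
      using True unfolding vw tree_arrows_iff[OF rank] by blast
    have a: "arr P M \<in> arrows" using arrow_rep_arrow[OF child_rep[OF rank *(1-3)]] .
    have "arr P M \<in> tree_arrows" using tree_arrows_iff[OF rank] *(1-3) by blast
    then have sw: "\<psi> (arr M P) = - \<psi> (arr P M)" by (rule harmonic_tree_swap[OF h])
    have "?\<phi> (arr P M) = \<psi> (arr P M)"
      using a lines_in_child[OF rank *(1-3)] tree_dist_cell[OF rank h *(1-3)] by (simp add: cochain_of_def)
    then have "?\<phi> e = \<psi> e" using *(4) harmonic_swap[OF hb, of "sim_class M" "sim_class P"] sw unfolding vw by auto
    then show ?thesis using True by (simp add: restrict_tree_def)
  next
    case False
    then have "\<psi> e = 0" using h unfolding harmonic_tree_def by blast
    then show ?thesis using False by (simp add: restrict_tree_def)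
  qed
qed

text \<open>Both cochains have the same restriction to the tree, so \<open>restrict_tree_inj\<close>
  identifies them. Only through injectivity do the values of \<phi> away from the tree become masses
  of the distribution.\<close>

lemma cochain_of_tree_dist_restrict:
  fixes \<phi> :: "('k::nonarch_local_field, 'n::finite) arrow \<Rightarrow> 'a::ab_group_add"
  assumes rank: "2 \<le> CARD('n)" and h: "\<phi> \<in> harmonic_building"
  shows "cochain_of (tree_dist (restrict_tree \<phi>)) = \<phi>"
  using restrict_tree_inj[OF rank cochain_of_harmonic[OF rank tree_dist_distributions0[OF rank]] h]
    restrict_tree_harmonic[OF rank h] restrict_cochain_of_tree_dist[OF rank] by blast

lemma type1_cochain_of:
  assumes "e \<in> type1_arrows" shows "\<delta> (lines_of_arrow e) = cochain_of \<delta> e"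
proof -
  have e: "e \<in> arrows" "arrow_type e = 1" using assms by (auto simp: type1_arrows_def)
  then obtain L M where "arrow_rep e L M" using arrows_iff by blast
  then show ?thesis using lines_of_arrow_type1 e by (metis cochain_of_def)
qed

text \<open>Every cell of level at least 1 is the set of lines of the type 1 arrow from its parent,
  and a distribution is determined by these cells.\<close>

lemma distribution_type1_unique:
  fixes \<delta> :: "('k::nonarch_local_field ^ 'n::finite) set set \<Rightarrow> 'a::ab_group_add"
  assumes rank: "2 \<le> CARD('n)" and d: "\<delta> \<in> distributions0" "\<delta>' \<in> distributions0"
    and eq: "\<And>e. e \<in> type1_arrows \<Longrightarrow> \<delta> (lines_of_arrow e) = \<delta>' (lines_of_arrow e)"
  shows "\<delta> = \<delta>'"
proof (rule distribution_eqI)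
  fix n and M :: "('k ^ 'n) set" assume n: "1 \<le> n" and M: "M \<in> tlats n"
  then obtain m where m: "n = Suc m" by (cases n) auto
  then obtain P where P: "P \<in> tlats m" "M \<subseteq> P" using M tlats_parent by blast
  have r: "arrow_rep (arr P M) P M" using child_rep[OF rank P(1) _ P(2)] M m by blast
  have t: "arrow_type (arr P M) = 1" using child_type1[OF rank P(1) _ P(2)] M m by blast
  have "lines_of_arrow (arr P M) = cell M"
    using lines_of_arrow_type1[OF r t] lines_in_child[OF rank P(1) _ P(2)] M m by simp
  moreover have "arr P M \<in> type1_arrows" using arrow_rep_arrow[OF r] t by (simp add: type1_arrows_def)
  ultimately show "\<delta> (cell M) = \<delta>' (cell M)" using eq by metis
qed (use d in \<open>auto simp: distributions0_def\<close>)

lemma tilde_eqI: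
  fixes \<delta> :: "('k::nonarch_local_field ^ 'n::finite) set set \<Rightarrow> 'a::ab_group_add"
  assumes rank: "2 \<le> CARD('n)" and d: "\<delta> \<in> distributions0"
    and eq: "\<And>e. e \<in> type1_arrows \<Longrightarrow> \<delta> (lines_of_arrow e) = \<phi> e"
  shows "tilde \<phi> = \<delta>"
  unfolding tilde_def
proof (rule the_equality)
  fix \<delta>' assume "\<delta>' \<in> distributions0 \<and> (\<forall>e\<in>type1_arrows. \<delta>' (lines_of_arrow e) = \<phi> e)"
  then show "\<delta>' = \<delta>" using distribution_type1_unique[OF rank _ d] eq by metis
qed (use d eq in blast)

lemma tilde_eq:
  fixes \<phi> :: "('k::nonarch_local_field, 'n::finite) arrow \<Rightarrow> 'a::ab_group_add"
  assumes rank: "2 \<le> CARD('n)" and h: "\<phi> \<in> harmonic_building"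
  shows "tilde \<phi> = tree_dist (restrict_tree \<phi>)"
  by (rule tilde_eqI[OF rank tree_dist_distributions0[OF rank restrict_tree_harmonic[OF rank h]]])
    (simp add: type1_cochain_of cochain_of_tree_dist_restrict[OF rank h])

lemma tilde_props:
  fixes \<phi> :: "('k::nonarch_local_field, 'n::finite) arrow \<Rightarrow> 'a::ab_group_add"
  assumes rank: "2 \<le> CARD('n)" and h: "\<phi> \<in> harmonic_building"
  shows "tilde \<phi> \<in> distributions0" "cochain_of (tilde \<phi>) = \<phi>"
    "\<And>e. e \<in> type1_arrows \<Longrightarrow> tilde \<phi> (lines_of_arrow e) = \<phi> e"
  using tree_dist_distributions0[OF rank restrict_tree_harmonic[OF rank h]]
  unfolding tilde_eq[OF rank h] by (simp_all add: type1_cochain_of cochain_of_tree_dist_restrict[OF rank h])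

section \<open>Equivariance\<close>

definition vimg :: "('k::nonarch_local_field ^ 'n \<Rightarrow> 'k ^ 'n) \<Rightarrow> ('k, 'n) vertex \<Rightarrow> ('k, 'n) vertex" where
  "vimg f v = (\<lambda>L. f ` L) ` v"

abbreviation aimg :: "('k::nonarch_local_field ^ 'n \<Rightarrow> 'k ^ 'n) \<Rightarrow> ('k, 'n) arrow \<Rightarrow> ('k, 'n) arrow" where
  "aimg f \<equiv> map_prod (vimg f) (vimg f)"

lemma vertex_act_vimg: "vertex_act v g = vimg (\<lambda>x. x v* g) v"
  by (simp add: vertex_act_def vecs_act_def vimg_def)

lemma arrow_act_aimg: "arrow_act e g = aimg (\<lambda>x. x v* g) e"
  by (simp add: arrow_act_def vertex_act_vimg map_prod_def split_beta)

lemma vimg_inv: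
  assumes "linaut f"
  shows "vimg (inv_into UNIV f) (vimg f v) = v" "vimg f (vimg (inv_into UNIV f) v) = v"
  unfolding vimg_def by (subst image_image, simp add: linaut_image_inv[OF assms])+

lemma aimg_inv:
  assumes "linaut f"
  shows "aimg (inv_into UNIV f) (aimg f e) = e" "aimg f (aimg (inv_into UNIV f) e) = e"
  using vimg_inv[OF assms] by (cases e; simp)+

lemma vimg_sim_class: "linaut f \<Longrightarrow> vimg f (sim_class L) = sim_class (f ` L)"
  unfolding vimg_def sim_class_def by (simp add: setcompr_eq_image image_image linaut_lscale)

lemma linaut_psubset: "linaut f \<Longrightarrow> A \<subset> B \<Longrightarrow> f ` A \<subset> f ` B"
  using linaut_mem[of f] by blast

lemma arrow_rep_aimg:
  fixes f :: "'k::nonarch_local_field ^ 'n \<Rightarrow> 'k ^ 'n::finite"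
  assumes f: "linaut f" and r: "arrow_rep e L M"
  shows "arrow_rep (aimg f e) (f ` L) (f ` M)"
  using r vimg_sim_class[OF f] linaut_psubset[OF f] lattice_image[OF f]
  unfolding arrow_rep_def linaut_lscale[OF f, symmetric] by (cases e) simp

lemma arrows_aimg:
  fixes f :: "'k::nonarch_local_field ^ 'n \<Rightarrow> 'k ^ 'n::finite"
  assumes f: "linaut f" shows "aimg f e \<in> arrows \<longleftrightarrow> e \<in> arrows"
proof -
  have "aimg g e \<in> arrows" if "linaut g" "e \<in> arrows" for g and e :: "('k, 'n) arrow"
    using that arrow_rep_aimg[OF that(1)] unfolding arrows_iff by blast
  then show ?thesis using f linaut_inv[OF f] aimg_inv(1)[OF f] by metis
qed

lemma vertices_vimg:
  fixes f :: "'k::nonarch_local_field ^ 'n \<Rightarrow> 'k ^ 'n::finite"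
  assumes f: "linaut f" shows "vimg f v \<in> vertices \<longleftrightarrow> v \<in> vertices"
proof -
  have "vimg g v \<in> vertices" if "linaut g" "v \<in> vertices" for g and v :: "('k, 'n) vertex"
    using that vimg_sim_class[OF that(1)] lattice_image[OF that(1)] unfolding vertices_iff by blast
  then show ?thesis using f linaut_inv[OF f] vimg_inv(1)[OF f] by metis
qed

lemma arrow_type_aimg:
  fixes f :: "'k::nonarch_local_field ^ 'n \<Rightarrow> 'k ^ 'n::finite"
  assumes f: "linaut f" and e: "e \<in> arrows" shows "arrow_type (aimg f e) = arrow_type e"
proof -
  obtain L M where r: "arrow_rep e L M" using e arrows_iff by blast
  have "has_residue_dim L M (arrow_type e)" using arrow_type_iff[OF r] by blast
  then show ?thesis using arrow_type_eq[OF arrow_rep_aimg[OF f r] residue_dim_image[OF f]] by blast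
qed

lemma arrow_prec_aimg:
  fixes f :: "'k::nonarch_local_field ^ 'n \<Rightarrow> 'k ^ 'n::finite"
  assumes f: "linaut f" shows "arrow_prec (aimg f e') (aimg f e) \<longleftrightarrow> arrow_prec e' e"
proof -
  have "arrow_prec (aimg g e') (aimg g e)" if g: "linaut g" and p: "arrow_prec e' e"
    for g and e e' :: "('k, 'n) arrow"
  proof -
    obtain L M' M where r: "arrow_rep e' L M'" "arrow_rep e L M" using p unfolding arrow_prec_def by blast
    then have "M' \<subseteq> M" using arrow_prec_iff p by blast
    then show ?thesis using arrow_prec_iff[OF arrow_rep_aimg[OF g r(1)] arrow_rep_aimg[OF g r(2)]] by blast
  qed
  then show ?thesis using f linaut_inv[OF f] aimg_inv(1)[OF f] by metis
qed

lemma arrows_from_type_aimg: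
  fixes f :: "'k::nonarch_local_field ^ 'n \<Rightarrow> 'k ^ 'n::finite"
  assumes f: "linaut f"
  shows "aimg f e \<in> arrows_from_type (vimg f v) t \<longleftrightarrow> e \<in> arrows_from_type v t"
proof -
  have "vimg f (fst e) = vimg f v \<longleftrightarrow> fst e = v" using vimg_inv(1)[OF f] by metis
  then show ?thesis unfolding arrows_from_type_def arrows_from_def
    using arrows_aimg[OF f, of e] arrow_type_aimg[OF f, of e] by auto
qed

lemma sum_aimg:
  assumes f: "linaut f" and AB: "\<And>e. aimg f e \<in> B \<longleftrightarrow> e \<in> A"
  shows "(\<Sum>e\<in>A. \<phi> (aimg f e)) = (\<Sum>e\<in>B. \<phi> e)"
proof (rule sum.reindex_bij_betw)
  show "bij_betw (aimg f) A B"
  proof (rule bij_betw_byWitness[of _ "aimg (inv_into UNIV f)"])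
    show "aimg f ` A \<subseteq> B" by (rule image_subsetI) (rule AB[THEN iffD2])
    show "aimg (inv_into UNIV f) ` B \<subseteq> A"
    proof
      fix e assume "e \<in> aimg (inv_into UNIV f) ` B"
      then obtain d where d: "e = aimg (inv_into UNIV f) d" "d \<in> B" by (rule imageE)
      have "aimg f e = d" unfolding d(1) by (rule aimg_inv(2)[OF f])
      then show "e \<in> A" using AB[of e] d(2) by simp
    qed
    show "\<forall>e\<in>A. aimg (inv_into UNIV f) (aimg f e) = e" by (rule ballI) (rule aimg_inv(1)[OF f])
    show "\<forall>e\<in>B. aimg f (aimg (inv_into UNIV f) e) = e" by (rule ballI) (rule aimg_inv(2)[OF f])
  qed
qed

lemma path_arrows_map: "path_arrows (map h p) = map (map_prod h h) (path_arrows p)"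
  unfolding path_arrows_def by (simp add: map_tl[symmetric] zip_map_map map_prod_def)

lemma is_bt_path_vimg:
  fixes f :: "'k::nonarch_local_field ^ 'n \<Rightarrow> 'k ^ 'n::finite"
  assumes f: "linaut f" and p: "is_bt_path p" shows "is_bt_path (map (vimg f) p)"
  using p vertices_vimg[OF f] arrows_aimg[OF f] unfolding is_bt_path_def path_arrows_map by auto

lemma harmonic_building_aimg:
  fixes \<phi> :: "('k::nonarch_local_field, 'n::finite) arrow \<Rightarrow> 'a::ab_group_add"
  assumes f: "linaut f" and h: "\<phi> \<in> harmonic_building"
  shows "(\<lambda>e. \<phi> (aimg f e)) \<in> harmonic_building"
  unfolding harmonic_building_def
proof (intro CollectI conjI allI impI ballI)
  fix e :: "('k, 'n) arrow" assume "e \<notin> arrows"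
  then show "\<phi> (aimg f e) = 0" using harmonic_off[OF h] arrows_aimg[OF f] by blast
next
  fix p :: "('k, 'n) vertex list" assume p: "is_bt_path p \<and> hd p = last p"
  then have "p \<noteq> []" by auto
  then have "sum_list (map \<phi> (path_arrows (map (vimg f) p))) = 0"
    using p by (intro harmonic_closed[OF h is_bt_path_vimg[OF f]]) (simp_all add: hd_map last_map)
  then show "sum_list (map (\<lambda>e. \<phi> (aimg f e)) (path_arrows p)) = 0" unfolding path_arrows_map by (simp add: comp_def)
next
  fix v :: "('k, 'n) vertex" and t assume v: "v \<in> vertices" and t: "t \<in> {1..CARD('n) - 1}"
  have "(\<Sum>e\<in>arrows_from_type v t. \<phi> (aimg f e)) = (\<Sum>e\<in>arrows_from_type (vimg f v) t. \<phi> e)"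
    by (rule sum_aimg[OF f arrows_from_type_aimg[OF f]])
  also have "\<dots> = 0" using h t vertices_vimg[OF f, of v] v unfolding harmonic_building_def by blast
  finally show "(\<Sum>e\<in>arrows_from_type v t. \<phi> (aimg f e)) = 0" .
next
  fix v :: "('k, 'n) vertex" and e assume v: "v \<in> vertices" and e: "e \<in> arrows_from v"
  have e': "aimg f e \<in> arrows_from (vimg f v)" using e arrows_aimg[OF f, of e] by (auto simp: arrows_from_def)
  have "(\<Sum>e' | e' \<in> arrows_from_type v 1 \<and> arrow_prec e' e. \<phi> (aimg f e')) =
      (\<Sum>e' | e' \<in> arrows_from_type (vimg f v) 1 \<and> arrow_prec e' (aimg f e). \<phi> e')"
    by (rule sum_aimg[OF f]) (simp only: mem_Collect_eq arrows_from_type_aimg[OF f] arrow_prec_aimg[OF f])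
  also have "\<dots> = \<phi> (aimg f e)" using h e' vertices_vimg[OF f, of v] v unfolding harmonic_building_def by simp
  finally show "\<phi> (aimg f e) = (\<Sum>e' | e' \<in> arrows_from_type v 1 \<and> arrow_prec e' e. \<phi> (aimg f e'))" by simp
qed

section \<open>Linear automorphisms acting on lines, compact-open sets and distributions\<close>

definition limg :: "('k::nonarch_local_field ^ 'n::finite \<Rightarrow> 'k ^ 'n) \<Rightarrow> ('k ^ 'n) set set \<Rightarrow> ('k ^ 'n) set set" where
  "limg f U = (\<lambda>G. f ` G) ` U"

lemma lines_act_limg: "lines_act U g = limg (\<lambda>x. x v* g) U"
  by (simp add: lines_act_def vecs_act_def limg_def)

lemma limg_inv:
  assumes "linaut f"
  shows "limg (inv_into UNIV f) (limg f U) = U" "limg f (limg (inv_into UNIV f) U) = U"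
  unfolding limg_def by (subst image_image, simp add: linaut_image_inv[OF assms])+

lemma linaut_line:
  fixes f :: "'k::nonarch_local_field ^ 'n::finite \<Rightarrow> 'k ^ 'n"
  assumes "linaut f" shows "f ` line x = line (f x)"
proof -
  have "f ` range (\<lambda>k. k *s x) = range (\<lambda>k. k *s f x)"
    using assms unfolding linaut_def image_image by simp
  then show ?thesis by (simp add: vec.span_singleton)
qed

lemma linaut_nonzero: "linaut f \<Longrightarrow> x \<noteq> 0 \<Longrightarrow> f x \<noteq> 0"
  using linaut_mem[of f x "{0}"] linaut_0[of f] by auto

lemma limg_lines_subset:
  fixes f :: "'k::nonarch_local_field ^ 'n::finite \<Rightarrow> 'k ^ 'n"
  assumes f: "linaut f" and U: "U \<subseteq> lines" shows "limg f U \<subseteq> lines"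
  unfolding limg_def
proof (rule image_subsetI)
  fix G assume "G \<in> U"
  then obtain x where x: "x \<noteq> 0" "G = line x" using U unfolding lines_eq by blast
  then show "f ` G \<in> lines" using linaut_line[OF f, of x] linaut_nonzero[OF f x(1)] unfolding lines_eq by simp
qed

lemma limg_lines:
  fixes f :: "'k::nonarch_local_field ^ 'n::finite \<Rightarrow> 'k ^ 'n"
  assumes f: "linaut f" shows "limg f lines = lines"
proof
  show "limg f lines \<subseteq> lines" using limg_lines_subset[OF f] by blast
  have "limg (inv_into UNIV f) lines \<subseteq> lines" using limg_lines_subset[OF linaut_inv[OF f]] by blast
  then have "limg f (limg (inv_into UNIV f) lines) \<subseteq> limg f lines" by (auto simp: limg_def)
  then show "lines \<subseteq> limg f lines" unfolding limg_inv(2)[OF f] .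
qed

lemma limg_lines_in:
  fixes f :: "'k::nonarch_local_field ^ 'n::finite \<Rightarrow> 'k ^ 'n"
  assumes f: "linaut f" shows "lines_in (aimg f e) = limg f (lines_in e)"
proof -
  have sub: "limg g (lines_in e) \<subseteq> lines_in (aimg g e)" if g: "linaut g" for g and e :: "('k, 'n) arrow"
  proof
    fix H assume "H \<in> limg g (lines_in e)"
    then obtain G L M where *: "H = g ` G" "G \<in> lines" "arrow_rep e L M" "L \<inter> G \<subseteq> M"
      unfolding limg_def lines_in_def by blast
    have "g ` L \<inter> g ` G \<subseteq> g ` M" using *(4) linaut_mem[OF g] by blast
    then show "H \<in> lines_in (aimg g e)"
      using limg_lines_subset[OF g, of "{G}"] * arrow_rep_aimg[OF g *(3)] unfolding lines_in_def limg_def by blast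
  qed
  have "limg f (limg (inv_into UNIV f) (lines_in (aimg f e))) \<subseteq> limg f (lines_in e)"
    using sub[OF linaut_inv[OF f], of "aimg f e"] unfolding aimg_inv(1)[OF f] by (auto simp: limg_def)
  then show ?thesis using sub[OF f, of e] unfolding limg_inv(2)[OF f] by blast
qed

lemma linaut_bound:
  fixes f :: "'k::nonarch_local_field ^ 'n \<Rightarrow> 'k ^ 'n::finite"
  assumes "linaut f"
  shows "\<exists>m. \<forall>n. \<forall>x\<in>oball n. f x \<in> oball (m + n)"
proof -
  obtain B where B: "f = (\<lambda>x. x v* B)" using linaut_matrix_ex[OF assms] by blast
  show ?thesis unfolding B by (rule matrix_bound[of B]) blast
qed

text \<open>Let \<open>k\<close> and \<open>l\<close> bound the map and its inverse
  \<open>h\<close>. If c h(x) and \<open>x\<close> are primitive, then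
  \<open>vord c \<ge> k\<close>, so changing \<open>x\<close> modulo \<pi>^(n-k-l) changes c h(x) by
  an element of \<pi>^n O^r. Hence the image is saturated at that level, truncated at 0.\<close>

lemma limg_compact_open:
  fixes f :: "'k::nonarch_local_field ^ 'n::finite \<Rightarrow> 'k ^ 'n"
  assumes f: "linaut f" shows "limg f U \<in> compact_open \<longleftrightarrow> U \<in> compact_open"
proof -
  have *: "limg g U \<in> compact_open" if g: "linaut g" and U: "U \<in> compact_open" for g and U :: "('k ^ 'n) set set"
  proof -
    obtain n where n: "saturated n U" using U compact_open_iff by blast
    define h where "h = inv_into UNIV g"
    have lh: "linaut h" unfolding h_def by (rule linaut_inv[OF g])
    have gh: "g (h x) = x" for x using g by (simp add: h_def linaut_def bij_is_surj surj_f_inv_f)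
    obtain k where k: "\<forall>n. \<forall>x\<in>oball n. g x \<in> oball (k + n)" using linaut_bound[OF g] by blast
    obtain l where l: "\<forall>n. \<forall>x\<in>oball n. h x \<in> oball (l + n)" using linaut_bound[OF lh] by blast
    have "saturated (nat (int n - k - l)) (limg g U)"
      unfolding saturated_def
    proof (intro conjI ballI allI impI)
      show "limg g U \<subseteq> lines" using limg_lines_subset[OF g] n by (simp add: saturated_def)
      fix x y :: "'k ^ 'n" assume x: "x \<in> prim" and xy: "x - y \<in> oball (int (nat (int n - k - l)))" and xU: "line x \<in> limg g U"
      have hU: "line (h z) \<in> U \<longleftrightarrow> line z \<in> limg g U" for z
      proof -
        have "g ` line (h z) = line z" using linaut_line[OF g, of "h z"] gh by simp
        moreover have "inj (\<lambda>G. g ` G)" using linaut_image_inv(1)[OF g] by (rule inj_on_inverseI)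
        ultimately show ?thesis unfolding limg_def using inj_image_mem_iff[of "\<lambda>G. g ` G" "line (h z)" U] by simp
      qed
      have "h x \<noteq> 0" using linaut_nonzero[OF lh prim_not_0[OF x]] .
      then obtain c where c: "c \<noteq> 0" "c *s h x \<in> prim"
        using lattice_prim_ex[OF lattice_oball[of 0], of "h x"] unfolding unif_std by blast
      have "g (c *s h x) \<in> oball (k + 0)" using k c(2) by blast
      then have "c *s x \<in> oball k" using g gh by (simp add: linaut_def)
      then have vc: "k \<le> vord c" using prim_scale_oball[OF x c(1)] by blast
      have "h x - h y \<in> oball (l + int (nat (int n - k - l)))" using l xy unfolding linaut_diff[OF lh, symmetric] by blast
      moreover have "int n - vord c \<le> l + int (nat (int n - k - l))" using vc by linarith
      ultimately have "h x - h y \<in> oball (int n - vord c)" using oball_mono by blast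
      then have "c *s (h x - h y) \<in> oball (int n)" using oball_scale_iff[OF c(1)] by blast
      then have "c *s h x - c *s h y \<in> oball (int n)" by (simp add: vec.scale_right_diff_distrib)
      moreover have "line (c *s h x) \<in> U" using xU hU line_scale[OF c(1), of "h x"] by simp
      ultimately have "line (c *s h y) \<in> U" using n c(2) unfolding saturated_def by blast
      then show "line y \<in> limg g U" using hU line_scale[OF c(1), of "h y"] by simp
    qed
    then show ?thesis using compact_open_iff by blast
  qed
  show ?thesis using *[OF f] *[OF linaut_inv[OF f]] limg_inv(1)[OF f] by metis
qed

lemma distributions0_limg:
  fixes \<delta> :: "('k::nonarch_local_field ^ 'n::finite) set set \<Rightarrow> 'a::ab_group_add"
  assumes f: "linaut f" and d: "\<delta> \<in> distributions0"
  shows "(\<lambda>U. \<delta> (limg f U)) \<in> distributions0"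
proof -
  have d': "\<delta> \<in> distributions" "\<delta> lines = 0" using d by (auto simp: distributions0_def)
  have "\<delta> (limg f (\<Union>F)) = (\<Sum>U\<in>F. \<delta> (limg f U))" if F: "finite F" "F \<subseteq> compact_open" "disjoint F" for F
  proof -
    have inj: "inj (limg f)" using limg_inv(1)[OF f] by (rule inj_on_inverseI)
    have injf: "inj (\<lambda>G. f ` G)" using linaut_image_inv(1)[OF f] by (rule inj_on_inverseI)
    have "limg f (\<Union>F) = \<Union> (limg f ` F)" by (auto simp: limg_def)
    also have "\<delta> \<dots> = (\<Sum>U\<in>limg f ` F. \<delta> U)"
    proof (rule distribution_Union[OF d'(1)])
      show "limg f ` F \<subseteq> compact_open" using F(2) limg_compact_open[OF f] by blast
      show "disjoint (limg f ` F)"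
        unfolding pairwise_def disjnt_def
      proof (intro ballI impI; elim imageE; hypsubst)
        fix U V assume UV: "U \<in> F" "V \<in> F" "limg f U \<noteq> limg f V"
        then have "U \<noteq> V" by blast
        then have "U \<inter> V = {}" using F(3) UV(1,2) unfolding pairwise_def disjnt_def by blast
        then show "limg f U \<inter> limg f V = {}" unfolding limg_def image_Int[OF injf, symmetric] by simp
      qed
    qed (use F in simp)
    also have "\<dots> = (\<Sum>U\<in>F. \<delta> (limg f U))" using sum.reindex[OF inj_on_subset[OF inj subset_UNIV], of \<delta> F] by simp
    finally show ?thesis .
  qed
  moreover have "\<delta> (limg f U) = 0" if "U \<notin> compact_open" for U
    using that d'(1) limg_compact_open[OF f] unfolding distributions_def by blast
  ultimately show ?thesis using d'(2) limg_lines[OF f] by (simp add: distributions0_def distributions_def)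
qed

lemma GL_K_linaut: "g \<in> GL_K \<Longrightarrow> linaut (\<lambda>x. x v* (g :: 'k::nonarch_local_field ^ 'n ^ 'n::finite))"
  by (simp add: GL_K_def linaut_matrix)

lemma cochain_of_limg:
  fixes f :: "'k::nonarch_local_field ^ 'n::finite \<Rightarrow> 'k ^ 'n"
  assumes f: "linaut f" shows "cochain_of (\<lambda>U. \<delta> (limg f U)) e = cochain_of \<delta> (aimg f e)"
  by (simp only: cochain_of_def arrows_aimg[OF f] limg_lines_in[OF f])

text \<open>The translate of \<open>tilde \<phi>\<close> is a distribution with the values of the
  translated cochain on all arrows of type 1, so the uniqueness in \<open>tilde_eqI\<close>
  identifies it.\<close>

lemma tilde_equivariant:
  assumes rank: "2 \<le> CARD('n::finite)"
  shows "equivariant GL_K cochain_act dist_act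
    (harmonic_building :: (('k::nonarch_local_field, 'n) arrow \<Rightarrow> 'a::ab_group_add) set)
    (distributions0 :: (('k ^ 'n) set set \<Rightarrow> 'a) set) tilde"
  unfolding equivariant_def
proof (intro ballI conjI)
  fix g :: "'k ^ 'n ^ 'n" assume g: "g \<in> GL_K"
  let ?f = "\<lambda>x. x v* g"
  have f: "linaut ?f" using GL_K_linaut[OF g] .
  have ca: "cochain_act g \<phi> = (\<lambda>e. \<phi> (aimg ?f e))" for \<phi> :: "('k, 'n) arrow \<Rightarrow> 'a"
    by (simp add: cochain_act_def arrow_act_aimg)
  have da: "dist_act g \<delta> = (\<lambda>U. \<delta> (limg ?f U))" for \<delta> :: "('k ^ 'n) set set \<Rightarrow> 'a"
    by (simp add: dist_act_def lines_act_limg)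
  show "cochain_act g \<phi> \<in> harmonic_building" if "\<phi> \<in> harmonic_building" for \<phi> :: "('k, 'n) arrow \<Rightarrow> 'a"
    unfolding ca by (rule harmonic_building_aimg[OF f that])
  show "dist_act g \<delta> \<in> distributions0" if "\<delta> \<in> distributions0" for \<delta> :: "('k ^ 'n) set set \<Rightarrow> 'a"
    unfolding da by (rule distributions0_limg[OF f that])
  show "tilde (cochain_act g \<phi>) = dist_act g (tilde \<phi>)" if h: "\<phi> \<in> harmonic_building" for \<phi> :: "('k, 'n) arrow \<Rightarrow> 'a"
    unfolding ca da
  proof (rule tilde_eqI[OF rank distributions0_limg[OF f tilde_props(1)[OF rank h]]])
    fix e :: "('k, 'n) arrow" assume e: "e \<in> type1_arrows"
    show "tilde \<phi> (limg ?f (lines_of_arrow e)) = \<phi> (aimg ?f e)"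
      using type1_cochain_of[OF e, of "\<lambda>U. tilde \<phi> (limg ?f U)"] cochain_of_limg[OF f, of "tilde \<phi>" e]
        tilde_props(2)[OF rank h] by simp
  qed
qed


section \<open>The stabilizer of the base vertex\<close>

lemma mat_act: "x v* mat c = c *s (x :: 'k::comm_ring_1 ^ 'n::finite)"
  by (simp add: vec_eq_iff vector_matrix_mult_def mat_def if_distrib cong: if_cong)

lemma matrix_eq_act:
  fixes A B :: "'k::comm_ring_1 ^ 'n ^ 'n::finite"
  assumes "\<And>x. x v* A = x v* B" shows "A = B"
proof -
  have "A $ i = B $ i" for i
  proof -
    have "axis i 1 v* A = A $ i" "axis i 1 v* B = B $ i"
      by (simp_all add: vector_matrix_mult_sum_rows axis_def if_distrib[of "\<lambda>c. c *s _"] cong: if_cong)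
    then show ?thesis using assms by metis
  qed
  then show ?thesis by (simp add: vec_eq_iff)
qed

lemma mat_GL_K: "c \<noteq> 0 \<Longrightarrow> mat c \<in> GL_K"
proof -
  assume c: "c \<noteq> 0"
  have "mat c ** mat (inverse c) = (mat 1 :: 'a ^ 'b ^ 'b)" "mat (inverse c) ** mat c = (mat 1 :: 'a ^ 'b ^ 'b)"
    using c by (auto intro!: matrix_eq_act simp: vector_matrix_mul_assoc[symmetric] mat_act)
  then show ?thesis unfolding GL_K_def invertible_def by blast
qed

lemma mat_center: "c \<noteq> 0 \<Longrightarrow> mat c \<in> center_GL_K"
  unfolding center_GL_K_def
  by (auto simp: mat_GL_K vector_matrix_mul_assoc[symmetric] mat_act scale_vector_matrix intro!: matrix_eq_act)

text \<open>Comparing row i in the commutation with one elementary matrix already determines row j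
  of \<open>z\<close>: it has z_ii on the diagonal and 0 elsewhere. Rank at least 2 provides an i
  \<noteq> j for every j.\<close>

lemma center_scalar:
  fixes z :: "'k::nonarch_local_field ^ 'n ^ 'n::finite"
  assumes rank: "2 \<le> CARD('n)" and z: "z \<in> center_GL_K"
  obtains c where "c \<noteq> 0" "z = mat c"
proof -
  have comm: "z $ j $ b = (if b = j then z $ i $ i else 0)" if ij: "i \<noteq> j" for i j b :: 'n
  proof -
    \<comment> \<open>The identity plus \<open>s\<close> in position (i, j); its inverse is
      \<open>E (- s)\<close>, and it sends the i-th basis row to itself plus \<open>s\<close> times
      the j-th.\<close>
    define E where "E s = ((\<chi> a b. (if a = b then 1 else 0) + (if a = i \<and> b = j then s else 0)) :: 'k ^ 'n ^ 'n)" for s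
    have act: "x v* E s = (\<chi> b. x $ b + (if b = j then s * x $ i else 0))" for x s
      unfolding vec_eq_iff
    proof
      fix b
      have "(x v* E s) $ b = (\<Sum>a\<in>UNIV. ((if a = b then x $ a else 0) + (if a = i then (if b = j then s * x $ a else 0) else 0)))"
        unfolding vector_matrix_mult_def E_def by (simp add: algebra_simps) (rule sum.cong, auto)
      also have "\<dots> = x $ b + (if b = j then s * x $ i else 0)" by (simp add: sum.distrib)
      finally show "(x v* E s) $ b = (\<chi> b. x $ b + (if b = j then s * x $ i else 0)) $ b" by simp
    qed
    have "E s ** E (- s) = mat 1" for s
      using ij by (intro matrix_eq_act) (simp add: vector_matrix_mul_assoc[symmetric] act vec_eq_iff)
    from this[of 1] this[of "- 1"] have "E 1 \<in> GL_K" unfolding GL_K_def invertible_def by (intro CollectI exI[of _ "E (- 1)"]) simp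
    then have "z ** E 1 = E 1 ** z" using z unfolding center_GL_K_def by blast
    then have "(axis i 1 v* z) v* E 1 = (axis i 1 v* E 1) v* z" by (simp add: vector_matrix_mul_assoc)
    moreover have ax: "axis i 1 v* z = z $ i"
      by (simp add: vector_matrix_mult_sum_rows axis_def if_distrib[of "\<lambda>c. c *s _"] cong: if_cong)
    moreover have "axis i 1 v* E 1 = axis i 1 + axis j 1" using ij by (simp add: act vec_eq_iff axis_def)
    then have "(axis i 1 v* E 1) v* z = z $ i + z $ j"
      by (simp add: vector_matrix_left_distrib ax)
        (simp add: vector_matrix_mult_sum_rows axis_def if_distrib[of "\<lambda>c. c *s _"] cong: if_cong)
    ultimately have "(z $ i v* E 1) $ b = z $ i $ b + z $ j $ b" by simp
    then have "(if b = j then z $ i $ i else 0) = z $ j $ b" by (auto simp: act split: if_splits)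
    then show ?thesis by (rule sym)
  qed
  have "\<not> is_singleton (UNIV :: 'n set)" using rank by (simp add: is_singleton_altdef)
  then have ex: "\<exists>i. i \<noteq> j" for j :: 'n by (metis UNIV_I is_singletonI' empty_iff)
  define k where "k = (undefined :: 'n)"
  have off: "z $ j $ b = 0" if "b \<noteq> j" for j b using ex[of j] comm that by metis
  have diag: "z $ j $ j = z $ k $ k" for j using comm[of k j j] by (cases "k = j") auto
  have zm: "z = mat (z $ k $ k)" using off diag by (auto simp: vec_eq_iff mat_def)
  have "z $ k $ k \<noteq> 0"
  proof
    assume "z $ k $ k = 0"
    then have "z = 0" using zm by (simp add: mat_def vec_eq_iff)
    moreover have "invertible z" using z by (simp add: center_GL_K_def GL_K_def)
    ultimately show False using invertible_det_nz[of z] by (simp add: det_0[unfolded mat_0])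
  qed
  then show ?thesis using zm that by blast
qed

lemma GL_O_std:
  assumes g: "g \<in> GL_O" shows "(\<lambda>x. x v* g) ` oball 0 = (oball 0 :: ('k::nonarch_local_field ^ 'n::finite) set)"
proof -
  have *: "x v* h \<in> oball 0" if "x \<in> oball 0" "\<And>i j. h $ i $ j \<in> integers" for x and h :: "'k ^ 'n ^ 'n"
    using that unfolding vector_matrix_mult_sum_rows
    by (intro omod_sum[OF omod_oball] omod_scale[OF omod_oball]) (auto simp: oball_def integers_iff_vge)
  obtain h where h: "\<forall>i j. h $ i $ j \<in> integers" "h ** g = mat 1" and gi: "\<forall>i j. g $ i $ j \<in> integers"
    using g unfolding GL_O_def by blast
  show ?thesis
  proof (intro equalityI subsetI)
    fix x :: "'k ^ 'n" assume "x \<in> oball 0"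
    then have "x v* h \<in> oball 0" using * h(1) by blast
    moreover have "x = (x v* h) v* g" using h(2) by (simp add: vector_matrix_mul_assoc)
    ultimately show "x \<in> (\<lambda>x. x v* g) ` oball 0" by blast
  qed (use * gi in blast)
qed

lemma std_GL_O:
  fixes g :: "'k::nonarch_local_field ^ 'n ^ 'n::finite"
  assumes g: "invertible g" "(\<lambda>x. x v* g) ` oball 0 = oball 0"
  shows "g \<in> GL_O"
proof -
  obtain h where h: "g ** h = mat 1" "h ** g = mat 1" using g(1) by (auto simp: invertible_def)
  have h0: "(\<lambda>x. x v* h) ` oball 0 = oball 0"
  proof -
    have "(\<lambda>x. x v* h) ` (\<lambda>x. x v* g) ` oball 0 = oball 0" using h(1) by (simp add: image_image vector_matrix_mul_assoc)
    then show ?thesis using g(2) by simp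
  qed
  have ent: "A $ i $ j \<in> integers" if A: "(\<lambda>x. x v* A) ` oball 0 = oball 0" for A :: "'k ^ 'n ^ 'n" and i j
  proof -
    have "axis i 1 v* A \<in> oball 0" using A oball_axis[of i 1 0] by (auto simp: vge_def)
    moreover have "axis i 1 v* A = A $ i"
      by (simp add: vector_matrix_mult_sum_rows axis_def if_distrib[of "\<lambda>c. c *s _"] cong: if_cong)
    ultimately show ?thesis by (auto simp: oball_def integers_iff_vge)
  qed
  show ?thesis unfolding GL_O_def using ent[OF g(2)] ent[OF h0] h by blast
qed

text \<open>Central elements are scalars, so they only rescale O^r. Conversely, dividing
  \<open>g\<close> by the scalar \<open>c\<close> gives a matrix that maps O^r onto itself, hence
  one in \<open>GL_O\<close>.\<close>

lemma stabilizer_linaut: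
  fixes g :: "'k::nonarch_local_field ^ 'n ^ 'n::finite"
  assumes rank: "2 \<le> CARD('n)"
  shows "g \<in> GL_O_center \<longleftrightarrow> g \<in> GL_K \<and> (\<exists>c. c \<noteq> 0 \<and> (\<lambda>x. x v* g) ` oball 0 = lscale c (oball 0))"
proof
  assume "g \<in> GL_O_center"
  then obtain h z where hz: "g = h ** z" "h \<in> GL_O" "z \<in> center_GL_K" unfolding GL_O_center_def by blast
  obtain c where c: "c \<noteq> 0" "z = mat c" using center_scalar[OF rank hz(3)] .
  have "invertible h" using hz(2) unfolding GL_O_def invertible_def by blast
  moreover have "invertible z" using hz(3) by (simp add: center_GL_K_def GL_K_def)
  ultimately have "g \<in> GL_K" unfolding GL_K_def hz(1) using invertible_mult by blast
  moreover have "(\<lambda>x. x v* g) ` oball 0 = lscale c ((\<lambda>x. x v* h) ` oball 0)"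
    unfolding hz(1) c(2) lscale_def image_image vector_matrix_mul_assoc[symmetric] mat_act ..
  ultimately show "g \<in> GL_K \<and> (\<exists>c. c \<noteq> 0 \<and> (\<lambda>x. x v* g) ` oball 0 = lscale c (oball 0))"
    using GL_O_std[OF hz(2)] c(1) by auto
next
  assume "g \<in> GL_K \<and> (\<exists>c. c \<noteq> 0 \<and> (\<lambda>x. x v* g) ` oball 0 = lscale c (oball 0))"
  then obtain c where g: "g \<in> GL_K" and c: "c \<noteq> 0" "(\<lambda>x. x v* g) ` oball 0 = lscale c (oball 0)" by blast
  define h where "h = g ** mat (inverse c)"
  have "(\<lambda>x. x v* h) ` oball 0 = lscale (inverse c) ((\<lambda>x. x v* g) ` oball 0)"
    unfolding h_def lscale_def image_image vector_matrix_mul_assoc[symmetric] mat_act ..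
  then have h0: "(\<lambda>x. x v* h) ` oball 0 = oball 0" using c by simp
  have "invertible h" unfolding h_def using g mat_GL_K[of "inverse c"] c(1) invertible_mult
    by (auto simp: GL_K_def)
  then have "h \<in> GL_O" using std_GL_O h0 by blast
  moreover have "g = h ** mat c"
    using c(1) by (intro matrix_eq_act) (simp add: h_def vector_matrix_mul_assoc[symmetric] mat_act)
  ultimately show "g \<in> GL_O_center" unfolding GL_O_center_def using mat_center[OF c(1)] by blast
qed

lemma stabilizer_eq:
  assumes rank: "2 \<le> CARD('n::finite)"
  shows "{g \<in> GL_K. vertex_act base_vertex g = (base_vertex :: ('k::nonarch_local_field, 'n) vertex)} = GL_O_center"
proof -
  have *: "vertex_act base_vertex g = base_vertex \<longleftrightarrow> (\<exists>c. c \<noteq> 0 \<and> (\<lambda>x. x v* g) ` oball 0 = lscale c (oball 0))"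
    if "g \<in> GL_K" for g :: "'k ^ 'n ^ 'n"
    unfolding vertex_act_vimg base_vertex_oball vimg_sim_class[OF GL_K_linaut[OF that]]
    using sim_class_eq_iff[of "oball 0" "(\<lambda>x. x v* g) ` oball 0"] by metis
  show ?thesis
  proof (rule Set.set_eqI)
    fix g :: "'k ^ 'n ^ 'n"
    show "g \<in> {g \<in> GL_K. vertex_act base_vertex g = base_vertex} \<longleftrightarrow> g \<in> GL_O_center"
      unfolding mem_Collect_eq stabilizer_linaut[OF rank] using *[of g] by (rule conj_cong[OF refl])
  qed
qed

text \<open>The map \<open>f\<close> divided by \<open>c\<close> preserves O^r, hence every ball and
  the set of primitive vectors, and so permutes the lattices \<open>tlat n x\<close>. It moves
  vertices in the same way as \<open>f\<close>.\<close>

lemma tree_vertices_vimg: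
  fixes f :: "'k::nonarch_local_field ^ 'n \<Rightarrow> 'k ^ 'n::finite"
  assumes rank: "2 \<le> CARD('n)" and f: "linaut f" and c: "c \<noteq> 0" "f ` oball 0 = lscale c (oball 0)"
  shows "v \<in> tree_vertices \<Longrightarrow> vimg f v \<in> tree_vertices"
proof -
  assume "v \<in> tree_vertices"
  then obtain n x where x: "x \<in> prim" "v = sim_class (tlat n x)"
    using tree_vertices_iff[OF rank] unfolding tlats_def by blast
  define h where "h x = inverse c *s f x" for x
  have h: "linaut h" unfolding h_def using c(1) by (intro linaut_comp[OF linaut_scale f]) simp
  have "h ` oball 0 = lscale (inverse c) (f ` oball 0)" by (simp add: h_def lscale_def image_image)
  then have h0: "h ` oball 0 = oball 0" using c by simp
  have hb: "h ` oball m = oball m" for m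
  proof -
    have "h ` lscale (unif powi m) (oball 0) = lscale (unif powi m) (oball 0)" using linaut_lscale[OF h] h0 by metis
    then show ?thesis by (simp add: lscale_powi_oball)
  qed
  have "h x \<in> prim" using linaut_mem[OF h, of x] x(1) hb by (metis DiffD1 DiffD2 DiffI)
  then have "h ` tlat n x \<in> tlats n" unfolding linaut_cyc[OF h] hb by (rule tlat_tlats)
  moreover have "vimg f v = sim_class (h ` tlat n x)"
  proof -
    have "h ` tlat n x = lscale (inverse c) (f ` tlat n x)" by (simp add: h_def lscale_def image_image)
    then show ?thesis using x(2) c(1) by (simp add: vimg_sim_class[OF f])
  qed
  ultimately show "vimg f v \<in> tree_vertices" using tree_vertices_iff[OF rank] by blast
qed

lemma tree_invariant:
  fixes f :: "'k::nonarch_local_field ^ 'n \<Rightarrow> 'k ^ 'n::finite"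
  assumes rank: "2 \<le> CARD('n)" and f: "linaut f" and c: "c \<noteq> 0" "f ` oball 0 = lscale c (oball 0)"
  shows "vimg f v \<in> tree_vertices \<longleftrightarrow> v \<in> tree_vertices" "aimg f e \<in> tree_arrows \<longleftrightarrow> e \<in> tree_arrows"
proof -
  let ?h = "inv_into UNIV f"
  have "?h ` lscale c (oball 0) = oball 0" using linaut_image_inv(1)[OF f, of "oball 0"] c(2) by simp
  then have "lscale c (?h ` oball 0) = oball 0" using linaut_lscale[OF linaut_inv[OF f]] by metis
  then have "?h ` oball 0 = lscale (inverse c) (oball 0)" using lscale_inverse[OF c(1)] by metis
  then have bwd: "w \<in> tree_vertices \<Longrightarrow> vimg ?h w \<in> tree_vertices" for w
    using tree_vertices_vimg[OF rank linaut_inv[OF f], of "inverse c"] c(1) by simp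
  show v: "vimg f v \<in> tree_vertices \<longleftrightarrow> v \<in> tree_vertices" for v
    using tree_vertices_vimg[OF rank f c] bwd[of "vimg f v"] vimg_inv(1)[OF f] by auto
  show "aimg f e \<in> tree_arrows \<longleftrightarrow> e \<in> tree_arrows"
    using v arrows_aimg[OF f, of e] unfolding tree_arrows_def by (cases e) simp
qed

lemma restrict_tree_equivariant:
  assumes rank: "2 \<le> CARD('n::finite)"
  shows "equivariant GL_O_center cochain_act cochain_act
    (harmonic_building :: (('k::nonarch_local_field, 'n) arrow \<Rightarrow> 'a::ab_group_add) set)
    (harmonic_tree :: (('k, 'n) arrow \<Rightarrow> 'a) set) restrict_tree"
  unfolding equivariant_def
proof (intro ballI conjI)
  fix g :: "'k ^ 'n ^ 'n" assume "g \<in> GL_O_center"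
  then obtain c where g: "g \<in> GL_K" and c: "c \<noteq> 0" "(\<lambda>x. x v* g) ` oball 0 = lscale c (oball 0)"
    using stabilizer_linaut[OF rank] by blast
  let ?f = "\<lambda>x. x v* g"
  have f: "linaut ?f" using GL_K_linaut[OF g] .
  note inv = tree_invariant[OF rank f c]
  have ca: "cochain_act g \<phi> = (\<lambda>e. \<phi> (aimg ?f e))" for \<phi> :: "('k, 'n) arrow \<Rightarrow> 'a"
    by (simp add: cochain_act_def arrow_act_aimg)
  show "cochain_act g \<phi> \<in> harmonic_building" if "\<phi> \<in> harmonic_building" for \<phi> :: "('k, 'n) arrow \<Rightarrow> 'a"
    unfolding ca by (rule harmonic_building_aimg[OF f that])
  show "restrict_tree (cochain_act g \<phi>) = cochain_act g (restrict_tree \<phi>)" for \<phi> :: "('k, 'n) arrow \<Rightarrow> 'a"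
    unfolding ca restrict_tree_def by (simp only: inv)
  show "cochain_act g \<psi> \<in> harmonic_tree" if h: "\<psi> \<in> harmonic_tree" for \<psi> :: "('k, 'n) arrow \<Rightarrow> 'a"
    unfolding ca harmonic_tree_def
  proof (intro CollectI conjI allI impI ballI)
    fix e :: "('k, 'n) arrow" assume "e \<notin> tree_arrows"
    then show "\<psi> (aimg ?f e) = 0" using h inv(2)[of e] unfolding harmonic_tree_def by blast
  next
    fix e :: "('k, 'n) arrow" assume "e \<in> tree_arrows"
    then have "\<psi> (aimg ?f e) + \<psi> (prod.swap (aimg ?f e)) = 0" using h inv(2)[of e] unfolding harmonic_tree_def by blast
    then show "\<psi> (aimg ?f e) + \<psi> (aimg ?f (prod.swap e)) = 0" by (cases e) simp
  next
    fix v :: "('k, 'n) vertex" assume v: "v \<in> tree_vertices"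
    have "(\<Sum>e | e \<in> tree_arrows \<and> fst e = v. \<psi> (aimg ?f e)) = (\<Sum>e | e \<in> tree_arrows \<and> fst e = vimg ?f v. \<psi> e)"
    proof (rule sum_aimg[OF f])
      fix e :: "('k, 'n) arrow"
      have "vimg ?f (fst e) = vimg ?f v \<longleftrightarrow> fst e = v" using vimg_inv(1)[OF f] by metis
      then show "aimg ?f e \<in> {e \<in> tree_arrows. fst e = vimg ?f v} \<longleftrightarrow> e \<in> {e \<in> tree_arrows. fst e = v}"
        using inv(2)[of e] by simp
    qed
    also have "\<dots> = 0" using h inv(1)[of v] v unfolding harmonic_tree_def by blast
    finally show "(\<Sum>e | e \<in> tree_arrows \<and> fst e = v. \<psi> (aimg ?f e)) = 0" .
  qed
qed


section \<open>The isomorphisms\<close>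

lemma restrict_tree_iso:
  assumes rank: "2 \<le> CARD('n::finite)"
  shows "restrict_tree \<in> iso
    (fun_group (harmonic_building :: (('k::nonarch_local_field, 'n) arrow \<Rightarrow> 'a::ab_group_add) set))
    (fun_group (harmonic_tree :: (('k, 'n) arrow \<Rightarrow> 'a) set))"
proof (rule isoI)
  show "restrict_tree \<in> hom (fun_group (harmonic_building :: (('k, 'n) arrow \<Rightarrow> 'a) set)) (fun_group harmonic_tree)"
    by (rule homI) (auto simp: fun_group_def restrict_tree_harmonic[OF rank], auto simp: restrict_tree_def)
  have "bij_betw restrict_tree (harmonic_building :: (('k, 'n) arrow \<Rightarrow> 'a) set) harmonic_tree"
  proof (rule bij_betw_byWitness[of _ "\<lambda>\<psi>. cochain_of (tree_dist \<psi>)"])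
    show "(\<lambda>\<psi>. cochain_of (tree_dist \<psi>)) ` harmonic_tree \<subseteq> (harmonic_building :: (('k, 'n) arrow \<Rightarrow> 'a) set)"
      using cochain_of_harmonic[OF rank tree_dist_distributions0[OF rank]] by blast
  qed (use cochain_of_tree_dist_restrict[OF rank] restrict_cochain_of_tree_dist[OF rank] restrict_tree_harmonic[OF rank] in blast)+
  then show "bij_betw restrict_tree (carrier (fun_group (harmonic_building :: (('k, 'n) arrow \<Rightarrow> 'a) set)))
      (carrier (fun_group harmonic_tree))" by (simp add: fun_group_def)
qed

lemma distributions0_add:
  "\<delta> \<in> distributions0 \<Longrightarrow> \<delta>' \<in> distributions0 \<Longrightarrow> (\<lambda>U. \<delta> U + \<delta>' U) \<in> distributions0"
  by (auto simp: distributions0_def distributions_def sum.distrib)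

lemma tilde_iso:
  assumes rank: "2 \<le> CARD('n::finite)"
  shows "tilde \<in> iso
    (fun_group (harmonic_building :: (('k::nonarch_local_field, 'n) arrow \<Rightarrow> 'a::ab_group_add) set))
    (fun_group (distributions0 :: (('k ^ 'n) set set \<Rightarrow> 'a) set))"
proof (rule isoI)
  \<comment> \<open>As \<open>tilde\<close> is given by a description, its additivity too comes from
    uniqueness.\<close>
  have add: "tilde (\<lambda>e. f e + g e) = (\<lambda>U. tilde f U + tilde g U)"
    if "f \<in> harmonic_building" "g \<in> harmonic_building" for f g :: "('k, 'n) arrow \<Rightarrow> 'a"
    by (rule tilde_eqI[OF rank distributions0_add[OF tilde_props(1)[OF rank that(1)] tilde_props(1)[OF rank that(2)]]])
      (simp add: tilde_props(3)[OF rank that(1)] tilde_props(3)[OF rank that(2)])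
  show "tilde \<in> hom (fun_group (harmonic_building :: (('k, 'n) arrow \<Rightarrow> 'a) set)) (fun_group distributions0)"
    by (rule homI) (auto simp: fun_group_def tilde_props(1)[OF rank] add)
  have "bij_betw tilde (harmonic_building :: (('k, 'n) arrow \<Rightarrow> 'a) set) distributions0"
  proof (rule bij_betw_byWitness[of _ cochain_of])
    show "\<forall>\<delta>\<in>distributions0. tilde (cochain_of \<delta>) = (\<delta> :: ('k ^ 'n) set set \<Rightarrow> 'a)"
    proof
      fix \<delta> :: "('k ^ 'n) set set \<Rightarrow> 'a" assume d: "\<delta> \<in> distributions0"
      show "tilde (cochain_of \<delta>) = \<delta>" by (rule tilde_eqI[OF rank d]) (rule type1_cochain_of)
    qed
  qed (use tilde_props[OF rank] cochain_of_harmonic[OF rank] in blast)+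
  then show "bij_betw tilde (carrier (fun_group (harmonic_building :: (('k, 'n) arrow \<Rightarrow> 'a) set)))
      (carrier (fun_group distributions0))" by (simp add: fun_group_def)
qed

text \<open>The clause with \<open>\<exists>!\<close> is there because \<open>tilde\<close> is given
  by a description: it shows that the description denotes.\<close>

theorem theorem4p16:
  assumes rank: "CARD('n::finite) \<ge> 2"
  defines "HB \<equiv> harmonic_building ::
      (('k::nonarch_local_field, 'n) arrow \<Rightarrow> 'a::ab_group_add) set"
    and "HT \<equiv> harmonic_tree :: (('k, 'n) arrow \<Rightarrow> 'a) set"
    and "D0 \<equiv> distributions0 :: (('k ^ 'n) set set \<Rightarrow> 'a) set"
  shows "restrict_tree \<in> iso (fun_group HB) (fun_group HT) \<and>
    (\<forall>\<phi>\<in>HB. \<exists>!\<delta>. \<delta> \<in> D0 \<and> (\<forall>e\<in>type1_arrows. \<delta> (lines_of_arrow e) = \<phi> e)) \<and>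
    tilde \<in> iso (fun_group HB) (fun_group D0) \<and>
    (\<forall>\<phi>\<in>HB. \<forall>e\<in>type1_arrows. tilde \<phi> (lines_of_arrow e) = \<phi> e) \<and>
    equivariant GL_K cochain_act dist_act HB D0 tilde \<and>
    {g \<in> GL_K. vertex_act base_vertex g = (base_vertex :: ('k, 'n) vertex)} = GL_O_center \<and>
    equivariant GL_O_center cochain_act cochain_act HB HT restrict_tree"
  unfolding HB_def HT_def D0_def
proof (intro conjI)
  show "\<forall>\<phi>\<in>harmonic_building. \<exists>!\<delta>. \<delta> \<in> distributions0 \<and>
      (\<forall>e\<in>type1_arrows. \<delta> (lines_of_arrow e) = (\<phi> :: ('k, 'n) arrow \<Rightarrow> 'a) e)"
  proof
    fix \<phi> :: "('k, 'n) arrow \<Rightarrow> 'a" assume h: "\<phi> \<in> harmonic_building"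
    show "\<exists>!\<delta>. \<delta> \<in> distributions0 \<and> (\<forall>e\<in>type1_arrows. \<delta> (lines_of_arrow e) = \<phi> e)"
    proof (rule ex1I[of _ "tilde \<phi>"])
      show "tilde \<phi> \<in> distributions0 \<and> (\<forall>e\<in>type1_arrows. tilde \<phi> (lines_of_arrow e) = \<phi> e)"
        using tilde_props[OF rank h] by blast
      fix \<delta> assume "\<delta> \<in> distributions0 \<and> (\<forall>e\<in>type1_arrows. \<delta> (lines_of_arrow e) = \<phi> e)"
      then show "\<delta> = tilde \<phi>" using tilde_eqI[OF rank, of \<delta> \<phi>] by blast
    qed
  qed
  show "\<forall>\<phi>\<in>harmonic_building. \<forall>e\<in>type1_arrows. tilde \<phi> (lines_of_arrow e) = (\<phi> :: ('k, 'n) arrow \<Rightarrow> 'a) e"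
    using tilde_props(3)[OF rank] by blast
qed (rule restrict_tree_iso[OF rank] tilde_iso[OF rank] tilde_equivariant[OF rank] stabilizer_eq[OF rank]
  restrict_tree_equivariant[OF rank])+

end
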